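(* Consider a three-dimensional motion of a fluid with internal inertia, with density $\rho(t,\boldsymbol x)>0$, velocity $\boldsymbol u(t,\boldsymbol x)$, potential $W(\rho,\dot\rho)$ evaluated at $\dot\rho=\frac{D\rho}{Dt}$, and external force potential $V(t,\boldsymbol x)$, i.e. $\rho,\boldsymbol u$ satisfy $$\frac{\partial\rho}{\partial t}+{\rm div}(\rho\,\boldsymbol u)=0,\qquad \frac{\partial\rho\,\boldsymbol u^T}{\partial t}+{\rm div}\left(\rho\,\boldsymbol u\otimes\boldsymbol u+p\,\boldsymbol I\right)+\rho\,\frac{\partial V}{\partial\boldsymbol x}=\boldsymbol 0^T,$$ where $$p=\rho\,\frac{\delta W}{\delta\rho}-W,\qquad \frac{\delta W}{\delta\rho}=\frac{\partial W}{\partial\rho}-\frac{\partial}{\partial t}\left(\frac{\partial W}{\partial\dot\rho}\right)-{\rm div}\left(\frac{\partial W}{\partial\dot\rho}\,\boldsymbol u\right).$$ Let $$\sigma=-\rho\,\frac{\partial W}{\partial\dot\rho},\qquad \boldsymbol K=\boldsymbol u+\frac{\nabla\sigma}{\rho},\qquad \boldsymbol\Omega={\rm curl}\,\boldsymbol K,$$ and let $\tilde E(\rho,\sigma)$ be the energy function defined from $W$ by partial Legendre transform (see context), with $\tilde E_\rho=\frac{\partial\tilde E}{\partial\rho}(\rho,\sigma)$. $1^o)$ The following conservation law holds: $$\frac{\partial}{\partial t}\left(\boldsymbol K^T\boldsymbol\Omega\right)+{\rm div}\left\{\left(\boldsymbol K^T\boldsymbol\Omega\right)\boldsymbol u+\left(\tilde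 E_\rho+V-\frac{|\boldsymbol u|^2}{2}\right)\boldsymbol\Omega\right\}=0 .$$ $2^o)$ Let $D_t$ be a material domain with boundary $S_t$. If at $t=0$ the vector field $\boldsymbol\Omega$ is tangent to $S_0$, then for any time $t$ the vector field $\boldsymbol\Omega$ is tangent to $S_t$, and the helicity $$\mathcal H=\iiint_{D_t}\boldsymbol K^T\boldsymbol\Omega\,dD$$ keeps a constant value along the motion. Both $1^o)$ and $2^o)$ remain true if $\boldsymbol\Omega$ is replaced throughout by any of the vector fields $\boldsymbol E_i$, $i=1,2,3$, where $\boldsymbol E_i$ is the $i$-th column of $\boldsymbol F/\det\boldsymbol F$ and $\boldsymbol F$ is the deformation gradient of the motion, regarded as a function of $(t,\boldsymbol x)$.
   Context: Vectors are column vectors; $^T$ is transposition, so $\boldsymbol a^T\boldsymbol b$ is the scalar product and $\boldsymbol a\otimes\boldsymbol b=\boldsymbol a\,\boldsymbol b^T$; $\boldsymbol I$ is the identity. $\nabla f=(\partial f/\partial\boldsymbol x)^T$ is the column vector of spatial partial derivatives of a scalar $f$. The divergence of a second-order tensor $\boldsymbol A$ is the row vector with $({\rm div}\,\boldsymbol A)\,\boldsymbol a={\rm div}(\boldsymbol A\,\boldsymbol a)$ for every constant vector $\boldsymbol a$. The divergence, curl and all spatial derivatives are with respect to the Eulerian coordinates $\boldsymbol x$. The material derivative is $\frac{D}{Dt}=\frac{\partial}{\partial t}+\boldsymbol u^T\nabla$. Partial Legendre transform: set $\tau=-\frac{\partial W}{\partial\dot\rho}(\rho,\dot\rho)$, and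 assume this relation can be solved (smoothly) for $\dot\rho$ as a function of $(\rho,\tau)$. Define $E(\rho,\tau)=W-\dot\rho\,\frac{\partial W}{\partial\dot\rho}=W+\dot\rho\,\tau$, with $\dot\rho$ expressed through $(\rho,\tau)$, and $\tilde E(\rho,\sigma)=E(\rho,\sigma/\rho)$. In $\tilde E_\rho$ the derivative is taken at fixed $\sigma$, and it is then evaluated at $\rho=\rho(t,\boldsymbol x)$ and $\sigma=-\rho\,\partial W/\partial\dot\rho$ along the motion (with $\dot\rho=D\rho/Dt$). A fluid motion is $\boldsymbol x=\boldsymbol\varphi(t,\boldsymbol X)$, where at each time $\boldsymbol\varphi(t,\cdot)$ is a diffeomorphism from a three-dimensional reference configuration (Lagrangian coordinates $\boldsymbol X=(X^1,X^2,X^3)^T$) to physical space (Eulerian coordinates $\boldsymbol x$), with continuous derivatives up to second order. The velocity is $\boldsymbol u(t,\boldsymbol x)=\partial\boldsymbol\varphi(t,\boldsymbol X)/\partial t$ at $\boldsymbol X=\boldsymbol\varphi^{-1}(t,\boldsymbol x)$, and the deformation gradient is $\boldsymbol F=\partial\boldsymbol\varphi(t,\boldsymbol X)/\partial\boldsymbol X$, expressed in Eulerian coordinates through $\boldsymbol X=\boldsymbol\varphi^{-1}(t,\boldsymbol x)$. A material domain $D_t$ is the image under $\boldsymbol\varphi(t,\cdot)$ of a fixed domain of the reference configuration; its boundary $S_t$ is transported likewise, and $S_0$ in the claim denotes $S_t$ at $t=0$. Material domains are bounded with boundary regular enough for the divergence theorem, and all fields and the function $W$ are smooth enough (up to the boundary)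 that all derivatives needed exist and are continuous. A field is tangent to $S_t$ if its scalar product with the normal to $S_t$ vanishes on $S_t$. *)

theory Defs
  imports "HOL-Analysis.Analysis"
begin

(* C^k regularity; used on open sets only, where it is the usual notion: all partial
   derivatives up to order k exist and are continuous on S. *)
primrec Ck_on ::
    "nat \<Rightarrow> 'a::euclidean_space set \<Rightarrow> ('a \<Rightarrow> 'b::real_normed_vector) \<Rightarrow> bool" where
  "Ck_on 0 S f \<longleftrightarrow> continuous_on S f"
| "Ck_on (Suc k) S f \<longleftrightarrow>
     (\<forall>x\<in>S. f differentiable (at x)) \<and>
     (\<forall>b\<in>Basis. Ck_on k S (\<lambda>x. frechet_derivative f (at x) b))"

(* Time-dependent fields are curried, f t x, with x the Eulerian position. *)

definition dt :: "(real \<Rightarrow> real^3 \<Rightarrow> 'b::real_normed_vector) \<Rightarrow> real \<Rightarrow> real^3 \<Rightarrow> 'b" where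
  "dt f t x = vector_derivative (\<lambda>s. f s x) (at t)"

definition grad :: "(real^3 \<Rightarrow> real) \<Rightarrow> real^3 \<Rightarrow> real^3" where
  "grad f x = (\<chi> i. frechet_derivative f (at x) (axis i 1))"

definition divg :: "(real^3 \<Rightarrow> real^3) \<Rightarrow> real^3 \<Rightarrow> real" where
  "divg v x = trace (jacobian v (at x))"

(* (div A) a = div (A a) for constant a; below, a runs through the standard basis. *)
definition tensor_div :: "(real^3 \<Rightarrow> real^3^3) \<Rightarrow> real^3 \<Rightarrow> real^3" where
  "tensor_div A x = (\<chi> j. divg (\<lambda>y. A y *v axis j 1) x)"

(* The (i,j) entry of the Jacobian matrix is the j-th partial derivative of v_i. *)
definition curl :: "(real^3 \<Rightarrow> real^3) \<Rightarrow> real^3 \<Rightarrow> real^3" where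
  "curl v x = (let G = jacobian v (at x) in
     vector [G$3$2 - G$2$3, G$1$3 - G$3$1, G$2$1 - G$1$2])"

definition outer :: "real^3 \<Rightarrow> real^3 \<Rightarrow> real^3^3" where
  "outer a b = (\<chi> i j. a$i * b$j)"

definition material_deriv ::
    "(real \<Rightarrow> real^3 \<Rightarrow> real^3) \<Rightarrow> (real \<Rightarrow> real^3 \<Rightarrow> real) \<Rightarrow> real \<Rightarrow> real^3 \<Rightarrow> real" where
  "material_deriv u f t x = dt f t x + u t x \<bullet> grad (f t) x"

(* Regularity up to the boundary is expressed by extension: the motion and all fields are smooth
   on an open region U of Lagrangian coordinates (more precisely on its image under the motion),
   while the equations of motion are only imposed on the reference configuration B, open and
   contained in U.  The case U = B is allowed. *)
definition fluid_motion ::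
    "real set \<Rightarrow> (real^3) set \<Rightarrow> (real \<Rightarrow> real^3 \<Rightarrow> real^3) \<Rightarrow> bool" where
  "fluid_motion J U \<phi> \<longleftrightarrow>
     open J \<and> is_interval J \<and> open U \<and>
     Ck_on 2 (J \<times> U) (\<lambda>(t, X). \<phi> t X) \<and>
     (\<forall>t\<in>J. inj_on (\<phi> t) U \<and> Ck_on 2 (\<phi> t ` U) (the_inv_into U (\<phi> t)))"

definition is_velocity ::
    "real set \<Rightarrow> (real^3) set \<Rightarrow> (real \<Rightarrow> real^3 \<Rightarrow> real^3) \<Rightarrow> (real \<Rightarrow> real^3 \<Rightarrow> real^3) \<Rightarrow> bool" where
  "is_velocity J U \<phi> u \<longleftrightarrow>
     (\<forall>t\<in>J. \<forall>X\<in>U. ((\<lambda>s. \<phi> s X) has_vector_derivative u t (\<phi> t X)) (at t))"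

definition spacetime_region ::
    "real set \<Rightarrow> (real^3) set \<Rightarrow> (real \<Rightarrow> real^3 \<Rightarrow> real^3) \<Rightarrow> (real \<times> (real^3)) set" where
  "spacetime_region J U \<phi> = {(t, x). t \<in> J \<and> x \<in> \<phi> t ` U}"

definition deformation_gradient ::
    "(real^3) set \<Rightarrow> (real \<Rightarrow> real^3 \<Rightarrow> real^3) \<Rightarrow> real \<Rightarrow> real^3 \<Rightarrow> real^3^3" where
  "deformation_gradient U \<phi> t x = jacobian (\<phi> t) (at (the_inv_into U (\<phi> t) x))"

definition E_field ::
    "(real^3) set \<Rightarrow> (real \<Rightarrow> real^3 \<Rightarrow> real^3) \<Rightarrow> 3 \<Rightarrow> real \<Rightarrow> real^3 \<Rightarrow> real^3" where
  "E_field U \<phi> i t x =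
     column i ((1 / det (deformation_gradient U \<phi> t x)) *\<^sub>R deformation_gradient U \<phi> t x)"

definition W_rho :: "(real \<Rightarrow> real \<Rightarrow> real) \<Rightarrow> real \<Rightarrow> real \<Rightarrow> real" where
  "W_rho W r q = deriv (\<lambda>r'. W r' q) r"

definition W_rhodot :: "(real \<Rightarrow> real \<Rightarrow> real) \<Rightarrow> real \<Rightarrow> real \<Rightarrow> real" where
  "W_rhodot W r q = deriv (\<lambda>q'. W r q') q"

(* A smooth solution q = R r tau of tau = - W_rhodot W r q, with (r, q) in the domain A of W. *)
definition legendre_solution ::
    "(real \<times> real) set \<Rightarrow> (real \<Rightarrow> real \<Rightarrow> real) \<Rightarrow> (real \<Rightarrow> real \<Rightarrow> real) \<Rightarrow> bool" where
  "legendre_solution A W R \<longleftrightarrow>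
     (\<forall>(r, q)\<in>A. R r (- W_rhodot W r q) = q) \<and>
     Ck_on 3 ((\<lambda>(r, q). (r, - W_rhodot W r q)) ` A) (\<lambda>(r, \<tau>). R r \<tau>)"

definition energy ::
    "(real \<Rightarrow> real \<Rightarrow> real) \<Rightarrow> (real \<Rightarrow> real \<Rightarrow> real) \<Rightarrow> real \<Rightarrow> real \<Rightarrow> real" where
  "energy W R r \<tau> = W r (R r \<tau>) + R r \<tau> * \<tau>"

definition energy_tilde ::
    "(real \<Rightarrow> real \<Rightarrow> real) \<Rightarrow> (real \<Rightarrow> real \<Rightarrow> real) \<Rightarrow> real \<Rightarrow> real \<Rightarrow> real" where
  "energy_tilde W R r s = energy W R r (s / r)"

definition energy_tilde_rho ::
    "(real \<Rightarrow> real \<Rightarrow> real) \<Rightarrow> (real \<Rightarrow> real \<Rightarrow> real) \<Rightarrow> real \<Rightarrow> real \<Rightarrow> real" where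
  "energy_tilde_rho W R r s = deriv (\<lambda>r'. energy_tilde W R r' s) r"

context
  fixes W :: "real \<Rightarrow> real \<Rightarrow> real"
    and \<rho> :: "real \<Rightarrow> real^3 \<Rightarrow> real"
    and u :: "real \<Rightarrow> real^3 \<Rightarrow> real^3"
begin

definition W_along :: "real \<Rightarrow> real^3 \<Rightarrow> real" where
  "W_along t x = W (\<rho> t x) (material_deriv u \<rho> t x)"

definition W_rho_along :: "real \<Rightarrow> real^3 \<Rightarrow> real" where
  "W_rho_along t x = W_rho W (\<rho> t x) (material_deriv u \<rho> t x)"

definition W_rhodot_along :: "real \<Rightarrow> real^3 \<Rightarrow> real" where
  "W_rhodot_along t x = W_rhodot W (\<rho> t x) (material_deriv u \<rho> t x)"

definition delta_W :: "real \<Rightarrow> real^3 \<Rightarrow> real" where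
  "delta_W t x =
     W_rho_along t x - dt W_rhodot_along t x - divg (\<lambda>y. W_rhodot_along t y *\<^sub>R u t y) x"

definition pressure :: "real \<Rightarrow> real^3 \<Rightarrow> real" where
  "pressure t x = \<rho> t x * delta_W t x - W_along t x"

definition sigma :: "real \<Rightarrow> real^3 \<Rightarrow> real" where
  "sigma t x = - \<rho> t x * W_rhodot_along t x"

definition K_field :: "real \<Rightarrow> real^3 \<Rightarrow> real^3" where
  "K_field t x = u t x + (1 / \<rho> t x) *\<^sub>R grad (sigma t) x"

definition Omega_field :: "real \<Rightarrow> real^3 \<Rightarrow> real^3" where
  "Omega_field t x = curl (K_field t) x"

end

definition mass_equation ::
    "(real \<Rightarrow> real^3 \<Rightarrow> real) \<Rightarrow> (real \<Rightarrow> real^3 \<Rightarrow> real^3) \<Rightarrow> real \<Rightarrow> real^3 \<Rightarrow> bool" where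
  "mass_equation \<rho> u t x \<longleftrightarrow> dt \<rho> t x + divg (\<lambda>y. \<rho> t y *\<^sub>R u t y) x = 0"

(* Row vectors are identified with elements of real^3; mat p is p times the identity. *)
definition momentum_equation ::
    "(real \<Rightarrow> real \<Rightarrow> real) \<Rightarrow> (real \<Rightarrow> real^3 \<Rightarrow> real) \<Rightarrow> (real \<Rightarrow> real^3 \<Rightarrow> real) \<Rightarrow>
     (real \<Rightarrow> real^3 \<Rightarrow> real^3) \<Rightarrow> real \<Rightarrow> real^3 \<Rightarrow> bool" where
  "momentum_equation W V \<rho> u t x \<longleftrightarrow>
     dt (\<lambda>s y. \<rho> s y *\<^sub>R u s y) t x
     + tensor_div (\<lambda>y. \<rho> t y *\<^sub>R outer (u t y) (u t y) + mat (pressure W \<rho> u t y)) x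
     + \<rho> t x *\<^sub>R grad (V t) x = 0"

(* The geometric outer unit normal n of D at p: to first order at p, D is the half-space
   n . (x - p) < 0.  Such an n is unique.  It exists at every point of a C^1 boundary, at the
   points of the smooth faces of a piecewise C^1 boundary, and almost everywhere on a
   Lipschitz boundary. *)
definition outer_unit_normal :: "(real^3) set \<Rightarrow> real^3 \<Rightarrow> real^3 \<Rightarrow> bool" where
  "outer_unit_normal D p n \<longleftrightarrow>
     p \<in> frontier D \<and> norm n = 1 \<and>
     (\<forall>e>0. eventually (\<lambda>x.
        (n \<bullet> (x - p) < - e * norm (x - p) \<longrightarrow> x \<in> D) \<and>
        (n \<bullet> (x - p) > e * norm (x - p) \<longrightarrow> x \<notin> D)) (at p))"

definition tangent_to_boundary :: "(real^3) set \<Rightarrow> (real^3 \<Rightarrow> real^3) \<Rightarrow> bool" where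
  "tangent_to_boundary D v \<longleftrightarrow> (\<forall>p n. outer_unit_normal D p n \<longrightarrow> v p \<bullet> n = 0)"

(* Bounded domains with boundary regular enough for the divergence theorem: for fields that
   are C^1 up to the boundary, the integral of the divergence equals the outward flux through
   the boundary, with mu the surface measure (finite, and carried by the boundary points
   having a normal). *)
definition divergence_domain :: "(real^3) set \<Rightarrow> bool" where
  "divergence_domain D \<longleftrightarrow>
     open D \<and> bounded D \<and>
     (\<exists>\<mu> n. finite_measure \<mu> \<and> sets \<mu> = sets borel \<and> n \<in> borel_measurable borel \<and>
        (AE p in \<mu>. outer_unit_normal D p (n p)) \<and>
        (\<forall>N v. open N \<longrightarrow> closure D \<subseteq> N \<longrightarrow> Ck_on 1 N v \<longrightarrow>
           (LINT x:D|lborel. divg v x) = (LINT p|\<mu>. v p \<bullet> n p)))"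

(* D lies in the reference configuration B and may reach its boundary, as long as the motion is
   smooth there: closure D is only required to lie in U. *)
definition material_domain ::
    "real set \<Rightarrow> (real^3) set \<Rightarrow> (real^3) set \<Rightarrow> (real \<Rightarrow> real^3 \<Rightarrow> real^3) \<Rightarrow> (real^3) set \<Rightarrow> bool" where
  "material_domain J U B \<phi> D \<longleftrightarrow>
     open D \<and> bounded D \<and> D \<subseteq> B \<and> closure D \<subseteq> U \<and>
     (\<forall>t\<in>J. divergence_domain (\<phi> t ` D))"

end

theory Submission
  imports Defs
begin

text \<open>
  Write \<open>D\<close> for the material derivative, \<open>q = D \<rho>\<close> and \<open>w\<close> for the derivative of \<open>W\<close> in its second argument, so that
  \<open>\<sigma> = - \<rho> w\<close>. The mass equation turns \<open>\<delta>W/\<delta>\<rho>\<close> into \<open>W_\<rho> + q w / \<rho> - D w\<close>, where the first two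
  terms are exactly \<open>\<partial>E~/\<partial>\<rho>\<close>; inserting this into the momentum equation gives
  \<open>D K + (\<nabla>u)^T K + \<nabla>(E~_\<rho> + V - |u|^2/2) = 0\<close>.
  Taking the curl, \<open>\<Omega>\<close> satisfies \<open>D Z = (Z \<cdot> \<nabla>) u - (div u) Z\<close> and \<open>div Z = 0\<close>. The same holds for
  \<open>E_i\<close>, because the columns of \<open>F / det F\<close> are the cross products of the gradients of the
  Lagrangian labels \<open>Y\<close>, and \<open>D Y = 0\<close>. The conservation law is then the product rule.

  For a field \<open>Z\<close> with these two properties the components \<open>\<zeta> = (det \<nabla>Y)^(-1) \<nabla>Y Z\<close>
  are constant along particle paths, so tangency to the boundary at any time means that \<open>\<zeta>\<close> is
  tangent to the boundary of the reference domain. Pulling the helicity integral back to the reference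
  domain and differentiating in time leaves the flux of
  \<open>(E~_\<rho> + V - |u|^2/2) Z\<close> through the boundary, which vanishes.
\<close>

section \<open>Functions of class \<open>C\<^sup>k\<close>\<close>

text \<open>Every field is treated as a function of one space-time point, because time and space
  derivatives get mixed and their symmetry is needed. Smoothness of the inverse motion is given only
  at each fixed time, so joint regularity of the labels must be extracted by inverting (t, X) -> (t,
  \<open>\<phi> t X\<close>). Fields are smooth on the image of U, while the equations hold on the
  image of B. A material domain may reach the boundary of B, so facts needed on its boundary come
  from the interior by continuity. The sign of det F is not prescribed, hence the absolute values of
  Jacobians. Normals are defined by cones, without charts, so they are carried along by a
  first-order estimate. Regularity is counted out: density and W of class 4 make
  \<open>\<sigma>\<close> of class 3, K of class 2 and its curl of class 1, just enough for the
  conservation law.\<close>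

text \<open>A Frechet derivative sees a full neighbourhood of the point, which is why agreement on
  an open set is enough. Later fields agree with their representatives only inside the region of the
  flow.\<close>

lemma Ck_on_cong_imp:
  assumes "open S" "\<And>x. x \<in> S \<Longrightarrow> f x = g x" "Ck_on k S f"
  shows "Ck_on k S g"
  using assms(2,3)
proof (induction k arbitrary: f g)
  case 0
  then show ?case by (simp cong: continuous_on_cong)
next
  case (Suc k)
  have fd: "frechet_derivative f (at x) = frechet_derivative g (at x)" if "x \<in> S" for x
    using frechet_derivative_transform_within_open[of f x S g] Suc.prems that assms(1) by auto
  have "g differentiable (at x)" if "x \<in> S" for x
    using Suc.prems that assms(1)
    by (metis (no_types, lifting) Ck_on.simps(2) differentiable_def has_derivative_transform_within_open)
  moreover have "Ck_on k S (\<lambda>x. frechet_derivative g (at x) b)" if "b \<in> Basis" for b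
    using Suc.IH[of "\<lambda>x. frechet_derivative f (at x) b"] Suc.prems that fd by auto
  ultimately show ?case by simp
qed

lemma Ck_on_cong:
  assumes "open S" "\<And>x. x \<in> S \<Longrightarrow> f x = g x"
  shows "Ck_on k S f \<longleftrightarrow> Ck_on k S g"
  using Ck_on_cong_imp[OF assms(1), of f g] Ck_on_cong_imp[OF assms(1), of g f] assms(2) by metis

text \<open>Replaces the derivative chosen by \<open>frechet_derivative\<close> by an explicit
  formula, so that induction on the order can run on that formula.\<close>

lemma Ck_on_SucI:
  assumes "open S" "\<And>x. x \<in> S \<Longrightarrow> (f has_derivative f' x) (at x)"
    and "\<And>b. b \<in> Basis \<Longrightarrow> Ck_on k S (\<lambda>x. f' x b)"
  shows "Ck_on (Suc k) S f"
proof -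
  have "frechet_derivative f (at x) = f' x" if "x \<in> S" for x
    using assms(2)[OF that] frechet_derivative_at by metis
  then have "Ck_on k S (\<lambda>x. frechet_derivative f (at x) b)" if "b \<in> Basis" for b
    using Ck_on_cong[OF assms(1), of "\<lambda>x. frechet_derivative f (at x) b" "\<lambda>x. f' x b"]
      assms(3)[OF that] by auto
  then show ?thesis using assms(2) by (auto simp: differentiable_def)
qed

lemma Ck_on_SucD:
  assumes "Ck_on (Suc k) S f"
  shows "\<And>x. x \<in> S \<Longrightarrow> (f has_derivative frechet_derivative f (at x)) (at x)"
    and "\<And>b. b \<in> Basis \<Longrightarrow> Ck_on k S (\<lambda>x. frechet_derivative f (at x) b)"
  using assms by (auto simp: frechet_derivative_works[symmetric])

lemma Ck_on_lower: "Ck_on (Suc k) S f \<Longrightarrow> Ck_on k S f"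
proof (induction k arbitrary: f)
  case 0
  then show ?case
    by (auto intro!: continuous_at_imp_continuous_on differentiable_imp_continuous_within)
next
  case (Suc k)
  then show ?case by auto
qed

lemma Ck_on_le: "Ck_on k S f \<Longrightarrow> j \<le> k \<Longrightarrow> Ck_on j S f"
  by (induction k) (auto simp: le_Suc_eq dest: Ck_on_lower simp del: Ck_on.simps(2))

lemma Ck_on_continuous: "Ck_on k S f \<Longrightarrow> continuous_on S f"
  using Ck_on_le[of k S f 0] by simp

lemma Ck_on_differentiable: "Ck_on k S f \<Longrightarrow> 0 < k \<Longrightarrow> x \<in> S \<Longrightarrow> f differentiable (at x)"
  by (cases k) auto

lemma Ck_on_const [simp]:
  assumes "open S"
  shows "Ck_on k S (\<lambda>x. c)"
proof (induction k arbitrary: c)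
  case (Suc k)
  show ?case
    by (rule Ck_on_SucI[where f' = "\<lambda>x h. 0"]) (use assms Suc in auto)
qed simp

lemma Ck_on_bounded_linear_compose:
  assumes "open S" "bounded_linear h" "Ck_on k S f"
  shows "Ck_on k S (\<lambda>x. h (f x))"
  using assms(3)
proof (induction k arbitrary: f)
  case 0
  then show ?case
    by (simp add: bounded_linear.continuous_on[OF assms(2)])
next
  case (Suc k)
  show ?case
    by (rule Ck_on_SucI[where f' = "\<lambda>x b. h (frechet_derivative f (at x) b)"])
      (use assms(1) Suc Ck_on_SucD[OF Suc.prems] in
        \<open>auto intro!: bounded_linear.has_derivative[OF assms(2)]\<close>)
qed

lemma Ck_on_add:
  assumes "open S" "Ck_on k S f" "Ck_on k S g"
  shows "Ck_on k S (\<lambda>x. f x + g x)"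
  using assms(2,3)
proof (induction k arbitrary: f g)
  case 0
  then show ?case by (auto intro: continuous_intros)
next
  case (Suc k)
  show ?case
    by (rule Ck_on_SucI[where
          f' = "\<lambda>x b. frechet_derivative f (at x) b + frechet_derivative g (at x) b"])
      (use assms(1) Suc Ck_on_SucD[OF Suc.prems(1)] Ck_on_SucD[OF Suc.prems(2)] in
        \<open>auto intro!: has_derivative_add\<close>)
qed

lemma Ck_on_sum:
  assumes "open S" "\<And>i. i \<in> I \<Longrightarrow> Ck_on k S (f i)"
  shows "Ck_on k S (\<lambda>x. \<Sum>i\<in>I. f i x)"
  using assms(2)
  by (induction I rule: infinite_finite_induct) (auto intro: Ck_on_add assms(1) simp: assms(1))

lemma Ck_on_bilinear:
  assumes "open S" "bounded_bilinear pr" "Ck_on k S f" "Ck_on k S g"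
  shows "Ck_on k S (\<lambda>x. pr (f x) (g x))"
  using assms(3,4)
proof (induction k arbitrary: f g)
  case 0
  then show ?case by (auto intro: bounded_bilinear.continuous_on[OF assms(2)])
next
  case (Suc k)
  show ?case
    by (rule Ck_on_SucI[where f' = "\<lambda>x b. pr (f x) (frechet_derivative g (at x) b)
          + pr (frechet_derivative f (at x) b) (g x)"])
      (use assms(1) Suc Ck_on_SucD[OF Suc.prems(1)] Ck_on_SucD[OF Suc.prems(2)]
         Ck_on_lower[OF Suc.prems(1)] Ck_on_lower[OF Suc.prems(2)] in
        \<open>auto intro!: bounded_bilinear.FDERIV[OF assms(2)] Ck_on_add\<close>)
qed

lemmas Ck_on_mult = Ck_on_bilinear[OF _ bounded_bilinear_mult]
  and Ck_on_scaleR = Ck_on_bilinear[OF _ bounded_bilinear_scaleR]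
  and Ck_on_minus = Ck_on_bounded_linear_compose[OF _ bounded_linear_minus[OF bounded_linear_ident]]
  and Ck_on_nth = Ck_on_bounded_linear_compose[OF _ bounded_linear_vec_nth]
  and Ck_on_inner_left = Ck_on_bounded_linear_compose[OF _ bounded_linear_inner_left]

lemma Ck_on_diff:
  assumes "open S" "Ck_on k S f" "Ck_on k S g"
  shows "Ck_on k S (\<lambda>x. f x - g x)"
  using Ck_on_add[OF assms(1,2) Ck_on_minus[OF assms(1,3)]] by simp

lemma Ck_on_bounded_linear:
  assumes "open S" "bounded_linear f"
  shows "Ck_on k S f"
proof (cases k)
  case 0
  then show ?thesis using linear_continuous_on[OF assms(2)] by simp
next
  case (Suc j)
  have "Ck_on (Suc j) S f"
    by (rule Ck_on_SucI[where f' = "\<lambda>x. f"])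
      (use assms in \<open>auto intro: bounded_linear_imp_has_derivative\<close>)
  then show ?thesis using Suc by simp
qed

text \<open>Only derivatives in basis directions are controlled by \<open>Ck_on\<close>, so the
  chain rule is expanded over the basis of the middle space. Each directional derivative is then a
  sum of products to which the induction hypothesis applies, with f lowered by one order.\<close>

lemma Ck_on_compose:
  fixes f :: "'a::euclidean_space \<Rightarrow> 'b::euclidean_space" and g :: "'b \<Rightarrow> 'c::real_normed_vector"
  assumes "open S" "open T" "f ` S \<subseteq> T" "Ck_on k S f" "Ck_on k T g"
  shows "Ck_on k S (\<lambda>x. g (f x))"
  using assms(4,5)
proof (induction k arbitrary: g)
  case 0
  then show ?case using continuous_on_compose2[of T g S f] assms(3) by auto
next
  case (Suc k)
  let ?f' = "\<lambda>x. frechet_derivative f (at x)" and ?g' = "\<lambda>y. frechet_derivative g (at y)"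
  have fd: "(f has_derivative ?f' x) (at x)" if "x \<in> S" for x
    using Ck_on_SucD(1)[OF Suc.prems(1)] that by auto
  have gd: "(g has_derivative ?g' (f x)) (at (f x))" if "x \<in> S" for x
    using Ck_on_SucD(1)[OF Suc.prems(2)] that assms(3) by auto
  show ?case
  proof (rule Ck_on_SucI[where f' = "\<lambda>x b. \<Sum>c\<in>Basis. (?f' x b \<bullet> c) *\<^sub>R ?g' (f x) c"])
    fix x assume x: "x \<in> S"
    have "?g' (f x) (?f' x b) = (\<Sum>c\<in>Basis. (?f' x b \<bullet> c) *\<^sub>R ?g' (f x) c)" for b
    proof -
      have "linear (?g' (f x))" using gd[OF x] by (rule has_derivative_linear)
      then show ?thesis
        by (subst (1) euclidean_representation[symmetric, of "?f' x b"])
          (simp add: linear_sum linear_cmul del: euclidean_representation)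
    qed
    moreover have "((\<lambda>x. g (f x)) has_derivative (\<lambda>b. ?g' (f x) (?f' x b))) (at x)"
      using diff_chain_at[OF fd[OF x] gd[OF x]] by (simp add: o_def)
    ultimately show "((\<lambda>x. g (f x)) has_derivative
        (\<lambda>b. \<Sum>c\<in>Basis. (?f' x b \<bullet> c) *\<^sub>R ?g' (f x) c)) (at x)" by simp
  next
    fix b :: 'a assume b: "b \<in> Basis"
    show "Ck_on k S (\<lambda>x. \<Sum>c\<in>Basis. (?f' x b \<bullet> c) *\<^sub>R ?g' (f x) c)"
      by (intro Ck_on_sum Ck_on_scaleR Ck_on_inner_left Suc.IH[OF Ck_on_lower[OF Suc.prems(1)]]
          assms(1) Ck_on_SucD(2)[OF Suc.prems(1)] Ck_on_SucD(2)[OF Suc.prems(2)] b)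
  qed (rule assms(1))
qed

text \<open>The derivative is a polynomial in \<open>inverse\<close> itself, so the induction closes
  on one function.\<close>

lemma Ck_on_inverse_nonzero: "Ck_on k {x::real. x \<noteq> 0} inverse"
proof (induction k)
  case 0
  then show ?case by (auto intro!: continuous_intros)
next
  case (Suc k)
  have o: "open {x::real. x \<noteq> 0}" by (simp add: open_Collect_neq)
  show ?case
    by (rule Ck_on_SucI[where f' = "\<lambda>x h. - (inverse x * h * inverse x)"])
      (auto intro!: o Ck_on_minus Ck_on_mult Suc derivative_eq_intros)
qed

lemma Ck_on_inverse:
  fixes f :: "'a::euclidean_space \<Rightarrow> real"
  assumes "open S" "Ck_on k S f" "\<And>x. x \<in> S \<Longrightarrow> f x \<noteq> 0"
  shows "Ck_on k S (\<lambda>x. inverse (f x))"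
  by (rule Ck_on_compose[OF assms(1) _ _ assms(2) Ck_on_inverse_nonzero])
    (use assms in \<open>auto simp: open_Collect_neq\<close>)

lemma Ck_on_divide:
  fixes f g :: "'a::euclidean_space \<Rightarrow> real"
  assumes "open S" "Ck_on k S f" "Ck_on k S g" "\<And>x. x \<in> S \<Longrightarrow> g x \<noteq> 0"
  shows "Ck_on k S (\<lambda>x. f x / g x)"
  unfolding divide_inverse by (intro Ck_on_mult Ck_on_inverse assms)

lemma Ck_on_vec:
  fixes f :: "'a::euclidean_space \<Rightarrow> real^'n"
  assumes "open S" "\<And>i. Ck_on k S (\<lambda>x. f x $ i)"
  shows "Ck_on k S f"
proof -
  have "f = (\<lambda>x. \<Sum>i\<in>UNIV. (f x $ i) *\<^sub>R axis i 1)"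
    by (auto simp: vec_eq_iff sum_component axis_def if_distrib cong: if_cong)
  moreover have "Ck_on k S (\<lambda>x. \<Sum>i\<in>UNIV. (f x $ i) *\<^sub>R (axis i 1 :: real^'n))"
    by (intro Ck_on_sum Ck_on_scaleR assms Ck_on_const)
  ultimately show ?thesis by simp
qed

lemma Ck_on_Pair:
  fixes f :: "'a::euclidean_space \<Rightarrow> 'b::euclidean_space" and g :: "'a \<Rightarrow> 'c::euclidean_space"
  assumes "open S" "Ck_on k S f" "Ck_on k S g"
  shows "Ck_on k S (\<lambda>x. (f x, g x))"
proof -
  have "Ck_on k S (\<lambda>x. (f x, 0) + (0, g x))"
    by (intro Ck_on_add assms Ck_on_bounded_linear_compose[of S "\<lambda>y. (y, 0)"]
        Ck_on_bounded_linear_compose[of S "\<lambda>y. (0, y)"])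
      (auto intro!: bounded_linear_Pair bounded_linear_ident bounded_linear_zero)
  then show ?thesis by simp
qed

text \<open>Exchanging \<open>b\<close> and \<open>c\<close> does not change the left-hand side, which yields the symmetry of mixed
  derivatives.\<close>

lemma second_difference_mvt:
  fixes f :: "'a::real_normed_vector \<Rightarrow> real"
  assumes h: "h > 0"
    and fd: "\<And>s r. 0 \<le> s \<Longrightarrow> s \<le> h \<Longrightarrow> 0 \<le> r \<Longrightarrow> r \<le> h \<Longrightarrow>
      f differentiable (at (p + s *\<^sub>R b + r *\<^sub>R c))"
    and fd2: "\<And>s r. 0 \<le> s \<Longrightarrow> s \<le> h \<Longrightarrow> 0 \<le> r \<Longrightarrow> r \<le> h \<Longrightarrow>
      (\<lambda>x. frechet_derivative f (at x) b) differentiable (at (p + s *\<^sub>R b + r *\<^sub>R c))"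
  obtains s r where "0 < s" "s < h" "0 < r" "r < h"
    "f (p + h *\<^sub>R b + h *\<^sub>R c) - f (p + h *\<^sub>R b) - f (p + h *\<^sub>R c) + f p =
     h * h * frechet_derivative (\<lambda>x. frechet_derivative f (at x) b)
       (at (p + s *\<^sub>R b + r *\<^sub>R c)) c"
proof -
  let ?D = "\<lambda>x. frechet_derivative f (at x) b"
  have line: "((\<lambda>s. g (q + s *\<^sub>R d)) has_real_derivative frechet_derivative g (at (q + s *\<^sub>R d)) d)
      (at s)" if "g differentiable (at (q + s *\<^sub>R d))" for g :: "'a \<Rightarrow> real" and q d s
  proof -
    have *: "((\<lambda>s. q + s *\<^sub>R d) has_derivative (\<lambda>t. t *\<^sub>R d)) (at s)"
      by (auto intro!: derivative_eq_intros)
    have "((\<lambda>s. g (q + s *\<^sub>R d)) has_derivative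
        (\<lambda>t. frechet_derivative g (at (q + s *\<^sub>R d)) (t *\<^sub>R d))) (at s)"
      using diff_chain_at[OF *] that by (auto simp: frechet_derivative_works o_def)
    moreover have "linear (frechet_derivative g (at (q + s *\<^sub>R d)))"
      using that by (simp add: linear_frechet_derivative)
    ultimately show ?thesis
      by (simp add: has_field_derivative_def linear_cmul mult.commute[of _ "frechet_derivative g (at (q + s *\<^sub>R d)) d"])
  qed
  have d1: "((\<lambda>s. f (p + s *\<^sub>R b + h *\<^sub>R c) - f (p + s *\<^sub>R b)) has_real_derivative
      (?D (p + s *\<^sub>R b + h *\<^sub>R c) - ?D (p + s *\<^sub>R b))) (at s)" if "0 \<le> s" "s \<le> h" for s
    using line[of f "p + h *\<^sub>R c" s b] line[of f p s b] fd[of s h] fd[of s 0] that h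
    by (auto intro!: DERIV_diff simp: algebra_simps)
  obtain s where s: "0 < s" "s < h"
    "(f (p + h *\<^sub>R b + h *\<^sub>R c) - f (p + h *\<^sub>R b)) - (f (p + h *\<^sub>R c) - f p)
      = h * (?D (p + s *\<^sub>R b + h *\<^sub>R c) - ?D (p + s *\<^sub>R b))"
    using MVT2[OF h d1] by (auto simp: algebra_simps)
  have d2: "((\<lambda>r. ?D (p + s *\<^sub>R b + r *\<^sub>R c)) has_real_derivative
      frechet_derivative ?D (at (p + s *\<^sub>R b + r *\<^sub>R c)) c) (at r)" if "0 \<le> r" "r \<le> h" for r
    using line[of ?D "p + s *\<^sub>R b" r c] fd2[of s r] that s by auto
  obtain r where r: "0 < r" "r < h"
    "?D (p + s *\<^sub>R b + h *\<^sub>R c) - ?D (p + s *\<^sub>R b)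
      = h * frechet_derivative ?D (at (p + s *\<^sub>R b + r *\<^sub>R c)) c"
    using MVT2[OF h d2] by auto
  show ?thesis
    using that[OF s(1,2) r(1,2)] s(3) r(3) by (simp add: algebra_simps)
qed

text \<open>The second difference of f over a small parallelogram equals h * h times either mixed
  derivative, each at its own nearby point. Continuity of the mixed derivatives then forbids a gap
  at p.\<close>

lemma frechet_derivative_commute:
  fixes f :: "'a::euclidean_space \<Rightarrow> real"
  assumes S: "open S" "p \<in> S" and f: "Ck_on 2 S f" and b: "b \<in> Basis" and c: "c \<in> Basis"
  shows "frechet_derivative (\<lambda>x. frechet_derivative f (at x) b) (at p) c
       = frechet_derivative (\<lambda>x. frechet_derivative f (at x) c) (at p) b"
proof (rule ccontr)
  let ?D = "\<lambda>d e x. frechet_derivative (\<lambda>x. frechet_derivative f (at x) d) (at x) e"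
  assume "?D b c p \<noteq> ?D c b p"
  \<comment> \<open>Half the gap: two errors below \<open>\<epsilon>\<close> cannot bridge
    it.\<close>
  define \<epsilon> where "\<epsilon> = \<bar>?D b c p - ?D c b p\<bar> / 2"
  have \<epsilon>: "\<epsilon> > 0" using \<open>?D b c p \<noteq> ?D c b p\<close> by (simp add: \<epsilon>_def)
  have f1: "f differentiable (at x)" if "x \<in> S" for x
    using f that by (simp add: numeral_2_eq_2)
  have f2: "(\<lambda>x. frechet_derivative f (at x) d) differentiable (at x)" if "x \<in> S" "d \<in> Basis" for x d
    using f that by (simp add: numeral_2_eq_2)
  have cont: "continuous_on S (?D d e)" if "d \<in> Basis" "e \<in> Basis" for d e
    using f that by (simp add: numeral_2_eq_2)
  have near: "\<exists>\<delta>>0. \<forall>x. dist x p < \<delta> \<longrightarrow> x \<in> S \<and> \<bar>?D d e x - ?D d e p\<bar> < \<epsilon>"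
    if "d \<in> Basis" "e \<in> Basis" for d e
  proof -
    have "isCont (?D d e) p"
      using cont[OF that] S continuous_on_eq_continuous_at by blast
    then have "eventually (\<lambda>x. dist (?D d e x) (?D d e p) < \<epsilon>) (nhds p)"
      using \<epsilon> by (metis tendsto_at_iff_tendsto_nhds continuous_at tendstoD)
    moreover have "eventually (\<lambda>x. x \<in> S) (nhds p)"
      using S by (simp add: eventually_nhds_in_open)
    ultimately have "eventually (\<lambda>x. x \<in> S \<and> \<bar>?D d e x - ?D d e p\<bar> < \<epsilon>) (nhds p)"
      by eventually_elim (auto simp: dist_real_def)
    then show ?thesis by (simp add: eventually_nhds_metric)
  qed
  obtain \<delta>1 where \<delta>1: "\<delta>1 > 0" "\<And>x. dist x p < \<delta>1 \<Longrightarrow> x \<in> S \<and> \<bar>?D b c x - ?D b c p\<bar> < \<epsilon>"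
    using near[OF b c] by blast
  obtain \<delta>2 where \<delta>2: "\<delta>2 > 0" "\<And>x. dist x p < \<delta>2 \<Longrightarrow> x \<in> S \<and> \<bar>?D c b x - ?D c b p\<bar> < \<epsilon>"
    using near[OF c b] by blast
  \<comment> \<open>The intermediate points lie within 2 h of p, hence inside both
    neighbourhoods.\<close>
  define h where "h = min \<delta>1 \<delta>2 / 4"
  have h: "h > 0" using \<delta>1 \<delta>2 by (simp add: h_def)
  have close: "dist (p + s *\<^sub>R d + r *\<^sub>R e) p < \<delta>1" "dist (p + s *\<^sub>R d + r *\<^sub>R e) p < \<delta>2"
    if "0 \<le> s" "s \<le> h" "0 \<le> r" "r \<le> h" "d \<in> Basis" "e \<in> Basis" for s r d e
  proof -
    have "norm (s *\<^sub>R d + r *\<^sub>R e) \<le> s + r"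
      using norm_triangle_ineq[of "s *\<^sub>R d" "r *\<^sub>R e"] that by simp
    moreover have "4 * h \<le> \<delta>1" "4 * h \<le> \<delta>2" by (auto simp: h_def)
    ultimately show "dist (p + s *\<^sub>R d + r *\<^sub>R e) p < \<delta>1" "dist (p + s *\<^sub>R d + r *\<^sub>R e) p < \<delta>2"
      using that h by (auto simp: dist_norm add.assoc)
  qed
  obtain s1 r1 where 1: "0 < s1" "s1 < h" "0 < r1" "r1 < h"
    "f (p + h *\<^sub>R b + h *\<^sub>R c) - f (p + h *\<^sub>R b) - f (p + h *\<^sub>R c) + f p =
     h * h * ?D b c (p + s1 *\<^sub>R b + r1 *\<^sub>R c)"
    by (rule second_difference_mvt[OF h, of f p b c]) (use close \<delta>1 f1 f2 b c in auto)
  obtain s2 r2 where 2: "0 < s2" "s2 < h" "0 < r2" "r2 < h"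
    "f (p + h *\<^sub>R c + h *\<^sub>R b) - f (p + h *\<^sub>R c) - f (p + h *\<^sub>R b) + f p =
     h * h * ?D c b (p + s2 *\<^sub>R c + r2 *\<^sub>R b)"
    by (rule second_difference_mvt[OF h, of f p c b]) (use close \<delta>1 f1 f2 b c in auto)
  have "h * h * ?D b c (p + s1 *\<^sub>R b + r1 *\<^sub>R c) = h * h * ?D c b (p + s2 *\<^sub>R c + r2 *\<^sub>R b)"
    using 1(5) 2(5) by (simp add: algebra_simps)
  then have "?D b c (p + s1 *\<^sub>R b + r1 *\<^sub>R c) = ?D c b (p + s2 *\<^sub>R c + r2 *\<^sub>R b)"
    using h by simp
  moreover have "\<bar>?D b c (p + s1 *\<^sub>R b + r1 *\<^sub>R c) - ?D b c p\<bar> < \<epsilon>"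
    using \<delta>1(2) close(1)[of s1 r1 b c] 1 b c by auto
  moreover have "\<bar>?D c b (p + s2 *\<^sub>R c + r2 *\<^sub>R b) - ?D c b p\<bar> < \<epsilon>"
    using \<delta>2(2) close(2)[of s2 r2 c b] 2 b c by auto
  ultimately have "\<bar>?D b c p - ?D c b p\<bar> < 2 * \<epsilon>" by (simp add: abs_if split: if_splits)
  then show False by (simp add: \<epsilon>_def)
qed

section \<open>Derivatives along the flow\<close>

type_synonym event = "real \<times> (real^3)"

definition pd :: "'a::euclidean_space \<Rightarrow> ('a \<Rightarrow> real) \<Rightarrow> 'a \<Rightarrow> real" where
  "pd b f p = frechet_derivative f (at p) b"

abbreviation et :: event where "et \<equiv> (1, 0)"

abbreviation ex :: "3 \<Rightarrow> event" where "ex i \<equiv> (0, axis i 1)"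

lemma et_Basis [simp]: "et \<in> Basis" and ex_Basis [simp]: "ex i \<in> Basis"
  by (auto simp: Basis_prod_def axis_in_Basis_iff)

lemma pd_eqI: "(f has_derivative f') (at p) \<Longrightarrow> pd b f p = f' b"
  unfolding pd_def by (metis frechet_derivative_at)

lemma pd_has_derivative:
  "f differentiable (at p) \<Longrightarrow> (f has_derivative (\<lambda>b. pd b f p)) (at p)"
  unfolding pd_def by (simp add: frechet_derivative_works)

lemma pd_cong:
  assumes "open S" "p \<in> S" "\<And>x. x \<in> S \<Longrightarrow> f x = g x" "f differentiable (at p)"
  shows "pd b f p = pd b g p"
  unfolding pd_def using frechet_derivative_transform_within_open[OF assms(4,1,2,3)] by simp

lemma pd_const [simp]: "pd b (\<lambda>x. c) p = 0"
  by (rule pd_eqI[THEN trans]) auto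

lemma pd_add:
  "f differentiable (at p) \<Longrightarrow> g differentiable (at p) \<Longrightarrow>
    pd b (\<lambda>x. f x + g x) p = pd b f p + pd b g p"
  by (rule pd_eqI[OF has_derivative_add, OF pd_has_derivative pd_has_derivative])

lemma pd_diff:
  "f differentiable (at p) \<Longrightarrow> g differentiable (at p) \<Longrightarrow>
    pd b (\<lambda>x. f x - g x) p = pd b f p - pd b g p"
  by (rule pd_eqI[OF has_derivative_diff, OF pd_has_derivative pd_has_derivative])

lemma pd_minus: "f differentiable (at p) \<Longrightarrow> pd b (\<lambda>x. - f x) p = - pd b f p"
  by (rule pd_eqI[OF has_derivative_minus, OF pd_has_derivative])

lemma pd_mult:
  "f differentiable (at p) \<Longrightarrow> g differentiable (at p) \<Longrightarrow>
    pd b (\<lambda>x. f x * g x) p = f p * pd b g p + pd b f p * g p"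
  by (rule pd_eqI[OF has_derivative_mult, OF pd_has_derivative pd_has_derivative])

lemma pd_divide:
  assumes "f differentiable (at p)" "g differentiable (at p)" "g p \<noteq> 0"
  shows "pd b (\<lambda>x. f x / g x) p = (pd b f p * g p - f p * pd b g p) / (g p * g p)"
  using has_derivative_divide'[OF pd_has_derivative[OF assms(1)] pd_has_derivative[OF assms(2)] assms(3)]
  by (rule pd_eqI)

lemma pd_sum:
  assumes "\<And>i. i \<in> I \<Longrightarrow> f i differentiable (at p)"
  shows "pd b (\<lambda>x. \<Sum>i\<in>I. f i x) p = (\<Sum>i\<in>I. pd b (f i) p)"
  by (rule pd_eqI[OF has_derivative_sum, OF pd_has_derivative]) (use assms in auto)

lemma Ck_on_pd: "Ck_on (Suc k) S f \<Longrightarrow> b \<in> Basis \<Longrightarrow> Ck_on k S (pd b f)"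
  unfolding pd_def by (rule Ck_on_SucD)

lemma Ck_on_pd_3: "Ck_on 3 S f \<Longrightarrow> b \<in> Basis \<Longrightarrow> Ck_on 2 S (pd b f)"
  and Ck_on_pd_2: "Ck_on 2 S f \<Longrightarrow> b \<in> Basis \<Longrightarrow> Ck_on 1 S (pd b f)"
  using Ck_on_pd[of 2 S f b] Ck_on_pd[of 1 S f b]
  by (simp_all add: Suc_numeral[symmetric] numeral_2_eq_2 numeral_3_eq_3 del: Ck_on.simps(2))

lemma pd_commute:
  assumes "open S" "p \<in> S" "Ck_on 2 S f" "b \<in> Basis" "c \<in> Basis"
  shows "pd c (pd b f) p = pd b (pd c f) p"
  using frechet_derivative_commute[OF assms] by (simp add: pd_def[abs_def])

text \<open>Counterpart of \<open>material_deriv\<close> for functions of the pair (t, x), so that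
  it can be composed with \<open>pd\<close> in any direction.\<close>

definition Dm :: "(event \<Rightarrow> real^3) \<Rightarrow> (event \<Rightarrow> real) \<Rightarrow> event \<Rightarrow> real" where
  "Dm v f p = pd et f p + (\<Sum>j\<in>UNIV. v p $ j * pd (ex j) f p)"

definition dvg :: "(event \<Rightarrow> real^3) \<Rightarrow> event \<Rightarrow> real" where
  "dvg z p = (\<Sum>j\<in>UNIV. pd (ex j) (\<lambda>x. z x $ j) p)"

lemma Dm_cong:
  assumes "open S" "p \<in> S" "\<And>x. x \<in> S \<Longrightarrow> f x = g x" "f differentiable (at p)"
  shows "Dm v f p = Dm v g p"
  unfolding Dm_def using pd_cong[OF assms] by simp

lemma Dm_const [simp]: "Dm v (\<lambda>x. c) p = 0"
  by (simp add: Dm_def)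

lemma Dm_add:
  "f differentiable (at p) \<Longrightarrow> g differentiable (at p) \<Longrightarrow>
    Dm v (\<lambda>x. f x + g x) p = Dm v f p + Dm v g p"
  by (simp add: Dm_def pd_add algebra_simps sum.distrib)

lemma Dm_diff:
  "f differentiable (at p) \<Longrightarrow> g differentiable (at p) \<Longrightarrow>
    Dm v (\<lambda>x. f x - g x) p = Dm v f p - Dm v g p"
  by (simp add: Dm_def pd_diff algebra_simps sum.distrib sum_subtractf)

lemma Dm_minus: "f differentiable (at p) \<Longrightarrow> Dm v (\<lambda>x. - f x) p = - Dm v f p"
  by (simp add: Dm_def pd_minus sum_negf)

lemma Dm_mult:
  "f differentiable (at p) \<Longrightarrow> g differentiable (at p) \<Longrightarrow>
    Dm v (\<lambda>x. f x * g x) p = f p * Dm v g p + Dm v f p * g p"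
  by (simp add: Dm_def pd_mult algebra_simps sum.distrib sum_distrib_left sum_distrib_right)

lemma Dm_divide:
  assumes "f differentiable (at p)" "g differentiable (at p)" "g p \<noteq> 0"
  shows "Dm v (\<lambda>x. f x / g x) p = (Dm v f p * g p - f p * Dm v g p) / (g p * g p)"
  by (simp add: Dm_def pd_divide[OF assms] sum_3 add_divide_distrib diff_divide_distrib
      algebra_simps)

lemma Dm_sum:
  assumes "\<And>i. i \<in> I \<Longrightarrow> f i differentiable (at p)"
  shows "Dm v (\<lambda>x. \<Sum>i\<in>I. f i x) p = (\<Sum>i\<in>I. Dm v (f i) p)"
  using assms by (simp add: Dm_def pd_sum sum.distrib sum_distrib_left) (rule sum.swap)

section \<open>Commutation of spatial and material derivatives\<close>

locale flow_region =
  fixes S :: "event set" and v :: "event \<Rightarrow> real^3"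
  assumes open_S: "open S" and smooth_v: "Ck_on 3 S v"
begin

lemma Ck_v: "k \<le> 3 \<Longrightarrow> Ck_on k S (\<lambda>x. v x $ j)"
  by (rule Ck_on_le[of 3]) (auto intro!: Ck_on_nth open_S smooth_v)

lemma v_diff: "p \<in> S \<Longrightarrow> (\<lambda>x. v x $ j) differentiable (at p)"
  using Ck_on_differentiable[OF Ck_v[of 1]] by simp

lemma diffI: "Ck_on k S f \<Longrightarrow> 0 < k \<Longrightarrow> p \<in> S \<Longrightarrow> f differentiable (at p)"
  by (rule Ck_on_differentiable)

lemma Ck_Dm:
  assumes "Ck_on (Suc k) S f" "k \<le> 3"
  shows "Ck_on k S (Dm v f)"
  unfolding Dm_def[abs_def]
  by (intro Ck_on_add Ck_on_sum Ck_on_mult open_S Ck_v Ck_on_pd[OF assms(1)] assms(2)) auto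

text \<open>The commutator of a spatial derivative with the material derivative is the transposed
  velocity gradient. It is the source of the gradient terms in the equation for K and in the
  transport of forms.\<close>

lemma pd_Dm:
  assumes "Ck_on 2 S f" "p \<in> S"
  shows "pd (ex i) (Dm v f) p = Dm v (pd (ex i) f) p
    + (\<Sum>j\<in>UNIV. pd (ex i) (\<lambda>x. v x $ j) p * pd (ex j) f p)"
proof -
  have d: "pd b f differentiable (at p)" if "b \<in> Basis" for b
    using Ck_on_pd[of 1 S f b] assms that by (intro diffI[of 1]) (auto simp: numeral_2_eq_2)
  have "pd (ex i) (Dm v f) p = pd (ex i) (pd et f) p
      + (\<Sum>j\<in>UNIV. pd (ex i) (\<lambda>x. v x $ j * pd (ex j) f x) p)"
    unfolding Dm_def[abs_def]
    by (subst pd_add, (auto intro!: d v_diff assms differentiable_sum differentiable_mult)[2],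
        subst pd_sum) (auto intro!: d v_diff assms differentiable_mult)
  also have "\<dots> = pd et (pd (ex i) f) p + (\<Sum>j\<in>UNIV. v p $ j * pd (ex j) (pd (ex i) f) p)
      + (\<Sum>j\<in>UNIV. pd (ex i) (\<lambda>x. v x $ j) p * pd (ex j) f p)"
    using pd_commute[OF open_S assms(2,1)] assms(2)
    by (simp add: pd_mult d v_diff sum.distrib)
  finally show ?thesis by (simp add: Dm_def)
qed

end

text \<open>The potential W is abstracted away: e, \<open>Wr\<close> and w stand for W and its two
  partial derivatives along the motion, and \<open>chain\<close> is all that is kept of their
  relation.\<close>

locale inertial_fluid = flow_region S v for S v +
  fixes r w e Wr V :: "event \<Rightarrow> real"
  assumes smooth_r: "Ck_on 4 S r" and smooth_w: "Ck_on 3 S w" and smooth_e: "Ck_on 3 S e"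
    and smooth_Wr: "Ck_on 3 S Wr" and smooth_V: "Ck_on 2 S V"
    and r_pos: "\<And>p. p \<in> S \<Longrightarrow> r p > 0"
    and chain: "\<And>b p. b \<in> Basis \<Longrightarrow> p \<in> S \<Longrightarrow>
      pd b e p = Wr p * pd b r p + w p * pd b (Dm v r) p"
begin

definition sig :: "event \<Rightarrow> real" where "sig p = - r p * w p"

definition Kf :: "event \<Rightarrow> real^3" where "Kf p = (\<chi> i. v p $ i + pd (ex i) sig p / r p)"

text \<open>The scalar multiplying the transported field in the flux of the conservation law, with
  the derivative of the energy already written out.\<close>

definition Q :: "event \<Rightarrow> real" where
  "Q p = Wr p + Dm v r p * w p / r p + V p - (\<Sum>j\<in>UNIV. v p $ j * v p $ j) / 2"

definition del :: "event \<Rightarrow> real" where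
  "del p = Wr p - pd et w p - (\<Sum>j\<in>UNIV. pd (ex j) (\<lambda>x. w x * v x $ j) p)"

definition prs :: "event \<Rightarrow> real" where "prs p = r p * del p - e p"

lemma r_nz: "p \<in> S \<Longrightarrow> r p \<noteq> 0"
  using r_pos[of p] by simp

lemma Ck_sig: "Ck_on 3 S sig"
  unfolding sig_def[abs_def]
  by (intro Ck_on_mult Ck_on_minus open_S smooth_w) (rule Ck_on_le[OF smooth_r], simp)

lemma Ck_K: "Ck_on 2 S (\<lambda>p. Kf p $ i)"
proof -
  have "Ck_on 2 S (pd (ex i) sig)"
    using Ck_sig by (intro Ck_on_pd) (auto simp: eval_nat_numeral)
  then show ?thesis
    unfolding Kf_def vec_lambda_beta
    by (intro Ck_on_add Ck_on_divide open_S Ck_v Ck_on_le[OF smooth_r] r_nz) simp_all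
qed

lemma Ck_q: "Ck_on 3 S (Dm v r)"
  using smooth_r by (intro Ck_Dm) (auto simp: eval_nat_numeral)

lemma Ck_Q: "Ck_on 2 S Q"
  unfolding Q_def[abs_def]
  by (intro Ck_on_diff Ck_on_add Ck_on_divide Ck_on_mult Ck_on_sum open_S Ck_v
      Ck_on_const smooth_V Ck_on_le[OF smooth_r] Ck_on_le[OF smooth_w] Ck_on_le[OF smooth_Wr]
      Ck_on_le[OF Ck_q] r_nz) simp_all

lemma Ck_prs: "Ck_on 2 S prs"
proof -
  have "Ck_on 2 S (pd et w)" and "Ck_on 2 S (pd (ex j) (\<lambda>x. w x * v x $ j))" for j
    by (intro Ck_on_pd_3 Ck_on_mult open_S smooth_w Ck_v; simp)+
  then show ?thesis
    unfolding prs_def[abs_def] del_def[abs_def]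
    by (intro Ck_on_diff Ck_on_mult Ck_on_sum open_S Ck_on_le[OF smooth_r] Ck_on_le[OF smooth_Wr]
        Ck_on_le[OF smooth_e]) simp_all
qed

end

text \<open>Regularity lives on S and the balance laws on the smaller set T. Openness of T lets
  identities valid there be differentiated.\<close>

locale inertial_motion = inertial_fluid +
  fixes T :: "event set"
  assumes open_T: "open T" and T_S: "T \<subseteq> S"
    and mass: "\<And>p. p \<in> T \<Longrightarrow> pd et r p + (\<Sum>j\<in>UNIV. pd (ex j) (\<lambda>x. r x * v x $ j) p) = 0"
    and momentum: "\<And>p i. p \<in> T \<Longrightarrow> pd et (\<lambda>x. r x * v x $ i) p
      + (\<Sum>j\<in>UNIV. pd (ex j) (\<lambda>x. r x * (v x $ j * v x $ i)) p) + pd (ex i) prs p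
      + r p * pd (ex i) V p = 0"
begin

text \<open>The pressure gradient contains the gradient of \<open>Dm v w\<close>, a derivative of
  higher order than the rest. The material derivative of the gradient of \<open>sig\<close>, divided
  by the density, contains it with the opposite sign; adding that gradient to the velocity removes
  it, and what survives is a gradient apart from the transposed velocity gradient acting on
  K.\<close>

lemma K_equation:
  assumes p: "p \<in> T"
  shows "Dm v (\<lambda>x. Kf x $ i) p + (\<Sum>j\<in>UNIV. pd (ex i) (\<lambda>x. v x $ j) p * Kf p $ j)
    + pd (ex i) Q p = 0"
proof -
  have pS: "p \<in> S" using p T_S by auto
  have dr: "r differentiable (at x)" and dw: "w differentiable (at x)"
    and dq: "Dm v r differentiable (at x)" and dWr: "Wr differentiable (at x)"
    and de: "e differentiable (at x)" and dV: "V differentiable (at x)"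
    and dsig: "sig differentiable (at x)" if "x \<in> S" for x
    using that smooth_r smooth_w Ck_q smooth_Wr smooth_e smooth_V Ck_sig
    by (auto intro: diffI)
  have dDw: "Dm v w differentiable (at x)" if "x \<in> S" for x
    using Ck_Dm[of 2 w] smooth_w that by (intro diffI[of 2]) (auto simp: eval_nat_numeral)
  have dps: "pd (ex j) sig differentiable (at x)" if "x \<in> S" for x j
    using Ck_on_pd[of 2 S sig "ex j"] Ck_sig that
    by (intro diffI[of 2]) (auto simp: eval_nat_numeral)
  note d = dr dw dq dWr de dV dsig dDw dps v_diff
  define dv where "dv x = dvg v x" for x
  have q: "Dm v r x = - r x * dv x" if "x \<in> T" for x
  proof -
    have "x \<in> S" using that T_S by auto
    then show ?thesis using mass[OF that]
      by (simp add: Dm_def pd_mult d dv_def dvg_def sum_3 algebra_simps)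
  qed
  have del: "r x * del x = r x * Wr x - r x * Dm v w x + w x * Dm v r x" if "x \<in> T" for x
  proof -
    have "x \<in> S" using that T_S by auto
    then have *: "del x = Wr x - Dm v w x - w x * dv x"
      by (simp add: Dm_def del_def pd_mult d sum_3 dv_def dvg_def algebra_simps)
    show ?thesis unfolding * q[OF that] by (simp add: algebra_simps)
  qed
  \<comment> \<open>Here \<open>chain\<close> makes the derivative of e absorb the terms
    \<open>Wr\<close> times the gradient of r and w times the gradient of
    \<open>Dm v r\<close>.\<close>
  have prs: "pd (ex i) prs p = r p * pd (ex i) Wr p - pd (ex i) r p * Dm v w p
      - r p * pd (ex i) (Dm v w) p + pd (ex i) w p * Dm v r p"
  proof -
    have "pd (ex i) prs p = pd (ex i) (\<lambda>x. r x * Wr x - r x * Dm v w x + w x * Dm v r x - e x) p"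
      by (rule pd_cong[OF open_T p, symmetric])
        (auto simp: prs_def del intro!: d pS differentiable_add differentiable_diff differentiable_mult)
    also have "\<dots> = r p * pd (ex i) Wr p - pd (ex i) r p * Dm v w p
      - r p * pd (ex i) (Dm v w) p + pd (ex i) w p * Dm v r p"
      using pS chain[of "ex i" p]
      by (simp add: pd_add pd_diff pd_mult d differentiable_mult differentiable_diff differentiable_add)
    finally show ?thesis .
  qed
  \<comment> \<open>Mass conservation turns the momentum balance into its nonconservative
    form.\<close>
  have mom: "r p * Dm v (\<lambda>x. v x $ i) p + pd (ex i) prs p + r p * pd (ex i) V p = 0"
  proof -
    have "pd et (\<lambda>x. r x * v x $ i) p + (\<Sum>j\<in>UNIV. pd (ex j) (\<lambda>x. r x * (v x $ j * v x $ i)) p)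
        = r p * Dm v (\<lambda>x. v x $ i) p + v p $ i * (Dm v r p + r p * dv p)"
      using pS by (simp add: Dm_def pd_mult d differentiable_mult sum_3 dv_def dvg_def algebra_simps)
    then show ?thesis using momentum[OF p, of i] q[OF p] by simp
  qed
  have Dsig: "pd (ex i) (Dm v sig) p = - (pd (ex i) r p * Dm v w p + r p * pd (ex i) (Dm v w) p
      + pd (ex i) w p * Dm v r p + w p * pd (ex i) (Dm v r) p)"
  proof -
    have "pd (ex i) (Dm v sig) p = pd (ex i) (\<lambda>x. - (r x * Dm v w x) - w x * Dm v r x) p"
      by (rule pd_cong[OF open_S pS, symmetric])
        (auto simp: sig_def[abs_def] Dm_mult Dm_minus differentiable_minus d pS
          intro!: d pS differentiable_minus differentiable_diff differentiable_mult)
    then show ?thesis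
      using pS by (simp add: pd_minus pd_diff pd_mult d differentiable_mult differentiable_minus)
  qed
  have psig: "pd (ex i) sig p = - (r p * pd (ex i) w p + pd (ex i) r p * w p)"
    unfolding sig_def[abs_def] using pS by (simp add: pd_mult pd_minus differentiable_minus d)
  have Dps: "Dm v (pd (ex i) sig) p = pd (ex i) (Dm v sig) p
      - (\<Sum>j\<in>UNIV. pd (ex i) (\<lambda>x. v x $ j) p * pd (ex j) sig p)"
    using pd_Dm[of sig p i] Ck_on_le[OF Ck_sig] pS by simp
  have r0: "r p > 0" using r_pos pS by auto
  have K: "Dm v (\<lambda>x. Kf x $ i) p = Dm v (\<lambda>x. v x $ i) p
      + (Dm v (pd (ex i) sig) p * r p - pd (ex i) sig p * Dm v r p) / (r p * r p)"
    unfolding Kf_def using pS r0 by (simp add: Dm_add Dm_divide d)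
  have Qd: "pd (ex i) Q p = pd (ex i) Wr p
      + ((Dm v r p * pd (ex i) w p + pd (ex i) (Dm v r) p * w p) * r p
          - Dm v r p * w p * pd (ex i) r p) / (r p * r p)
      + pd (ex i) V p - (\<Sum>j\<in>UNIV. v p $ j * pd (ex i) (\<lambda>x. v x $ j) p)"
    unfolding Q_def[abs_def] using pS r0
    by (simp add: pd_add pd_diff pd_divide pd_mult pd_sum d differentiable_mult differentiable_add
        differentiable_diff differentiable_sum differentiable_divide sum.distrib sum_distrib_left algebra_simps)
  have L: "(\<Sum>j\<in>UNIV. pd (ex i) (\<lambda>x. v x $ j) p * Kf p $ j)
    = (\<Sum>j\<in>UNIV. v p $ j * pd (ex i) (\<lambda>x. v x $ j) p)
      + (\<Sum>j\<in>UNIV. pd (ex i) (\<lambda>x. v x $ j) p * pd (ex j) sig p) / r p"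
    by (simp add: Kf_def algebra_simps sum.distrib sum_divide_distrib)
  have mom': "Dm v (\<lambda>x. v x $ i) p = - pd (ex i) prs p / r p - pd (ex i) V p"
    using mom r0 by (simp add: field_simps)
  show ?thesis
    unfolding K L Qd mom' prs Dps Dsig psig using r0 by (simp add: field_simps)
qed

end

section \<open>Vector fields transported by the flow\<close>

text \<open>The vector dual to an antisymmetric two-form in dimension three. The curl and the cross
  product of two gradients are both of this kind, so one transport argument serves both.\<close>

definition axial :: "(3 \<Rightarrow> 3 \<Rightarrow> event \<Rightarrow> real) \<Rightarrow> event \<Rightarrow> real^3" where
  "axial M p = vector [M 2 3 p, M 3 1 p, M 1 2 p]"

lemma axial_nth [simp]: "axial M p $ 1 = M 2 3 p" "axial M p $ 2 = M 3 1 p" "axial M p $ 3 = M 1 2 p"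
  by (simp_all add: axial_def)

lemma Ck_axial:
  assumes "open S" "\<And>l i. Ck_on k S (M l i)"
  shows "Ck_on k S (axial M)"
proof (rule Ck_on_vec[OF assms(1)])
  fix i :: 3
  show "Ck_on k S (\<lambda>p. axial M p $ i)"
    using exhaust_3[of i] assms(2) by auto
qed

text \<open>The spatial exterior derivative of the one-form with components k; \<open>wedge\<close>
  below is likewise the exterior product of two differentials.\<close>

definition curl_form :: "(event \<Rightarrow> real^3) \<Rightarrow> 3 \<Rightarrow> 3 \<Rightarrow> event \<Rightarrow> real" where
  "curl_form k l i p = pd (ex l) (\<lambda>x. k x $ i) p - pd (ex i) (\<lambda>x. k x $ l) p"

definition wedge :: "(event \<Rightarrow> real) \<Rightarrow> (event \<Rightarrow> real) \<Rightarrow> 3 \<Rightarrow> 3 \<Rightarrow> event \<Rightarrow> real" where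
  "wedge a b l i p = pd (ex l) a p * pd (ex i) b p - pd (ex i) a p * pd (ex l) b p"

text \<open>Helmholtz's law: z divided by a density obeying the mass equation is stretched like a
  material line element.\<close>

definition frozen_at :: "(event \<Rightarrow> real^3) \<Rightarrow> (event \<Rightarrow> real^3) \<Rightarrow> event \<Rightarrow> bool" where
  "frozen_at v z p \<longleftrightarrow> (\<forall>i. Dm v (\<lambda>x. z x $ i) p
    = (\<Sum>j\<in>UNIV. z p $ j * pd (ex j) (\<lambda>x. v x $ i) p) - z p $ i * dvg v p)"

text \<open>The hypothesis says that the two-form \<open>M\<close> has vanishing Lie derivative along the flow.\<close>

lemma frozen_axial:
  assumes L: "\<And>l i. Dm v (M l i) p = - (\<Sum>j\<in>UNIV. pd (ex l) (\<lambda>x. v x $ j) p * M j i p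
      + pd (ex i) (\<lambda>x. v x $ j) p * M l j p)"
    and anti: "\<And>l i. M i l p = - M l i p"
  shows "frozen_at v (axial M) p"
proof -
  have z: "M i i p = 0" for i using anti[of i i] by simp
  have a: "M 2 1 p = - M 1 2 p" "M 3 2 p = - M 2 3 p" "M 1 3 p = - M 3 1 p"
    by (rule anti)+
  show ?thesis
    unfolding frozen_at_def forall_3 by (simp add: L sum_3 z a dvg_def algebra_simps)
qed

context flow_region
begin

text \<open>The exterior derivative squares to zero: mixed derivatives cancel in pairs.\<close>

lemma dvg_axial_curl:
  assumes "Ck_on 2 S k" "p \<in> S"
  shows "dvg (axial (curl_form k)) p = 0"
proof -
  have k: "Ck_on 2 S (\<lambda>x. k x $ i)" for i by (intro Ck_on_nth open_S assms)
  have "Ck_on 1 S (pd (ex j) (\<lambda>x. k x $ i))" for i j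
    using k[of i] by (intro Ck_on_pd) (auto simp: eval_nat_numeral)
  then have d: "pd (ex j) (\<lambda>x. k x $ i) differentiable (at p)" for i j
    by (rule diffI) (auto simp: assms)
  have c: "pd (ex l) (pd (ex j) (\<lambda>x. k x $ i)) p = pd (ex j) (pd (ex l) (\<lambda>x. k x $ i)) p" for i j l
    by (rule pd_commute[OF open_S assms(2) k]) auto
  show ?thesis
    using c[of 2 1 3] c[of 3 1 2] c[of 3 2 1]
    by (simp add: dvg_def sum_3 curl_form_def[abs_def] pd_diff d)
qed

lemma Ck_wedge:
  assumes "Ck_on (Suc k) S a" "Ck_on (Suc k) S b"
  shows "Ck_on k S (wedge a b l i)"
  unfolding wedge_def[abs_def]
  by (intro Ck_on_diff Ck_on_mult open_S Ck_on_pd[OF assms(1)] Ck_on_pd[OF assms(2)]) auto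

lemma pd_differentiable:
  assumes "Ck_on 2 S f" "p \<in> S" "b \<in> Basis"
  shows "pd b f differentiable (at p)"
  using Ck_on_pd[of 1 S f b] assms by (intro diffI[of 1]) (auto simp: eval_nat_numeral)

lemma dvg_axial_wedge:
  assumes "Ck_on 2 S a" "Ck_on 2 S b" "p \<in> S"
  shows "dvg (axial (wedge a b)) p = 0"
proof -
  note d = pd_differentiable[OF assms(1,3)] pd_differentiable[OF assms(2,3)]
  note c = pd_commute[OF open_S assms(3,1)] pd_commute[OF open_S assms(3,2)]
  show ?thesis
    using c(1)[of "ex 2" "ex 1"] c(1)[of "ex 3" "ex 1"] c(1)[of "ex 3" "ex 2"]
      c(2)[of "ex 2" "ex 1"] c(2)[of "ex 3" "ex 1"] c(2)[of "ex 3" "ex 2"]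
    by (simp add: dvg_def sum_3 wedge_def[abs_def] pd_diff pd_mult differentiable_mult d algebra_simps)
qed

text \<open>The commutator \<open>pd_Dm\<close> applied to a function constant along the flow: its
  differential is carried as a one-form. Constancy on the whole open set is what allows
  \<open>Dm v a\<close> to be differentiated.\<close>

lemma Dm_pd_transported:
  assumes "Ck_on 2 S a" "\<And>x. x \<in> S \<Longrightarrow> Dm v a x = 0" "p \<in> S"
  shows "Dm v (pd (ex i) a) p = - (\<Sum>j\<in>UNIV. pd (ex i) (\<lambda>x. v x $ j) p * pd (ex j) a p)"
proof -
  have "pd (ex i) (Dm v a) p = pd (ex i) (\<lambda>x. 0) p"
    by (rule pd_cong[OF open_S assms(3), symmetric]) (use assms(2) in auto)
  then show ?thesis using pd_Dm[OF assms(1,3), of i] by simp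
qed

lemma frozen_axial_wedge:
  assumes a: "Ck_on 2 S a" "\<And>x. x \<in> S \<Longrightarrow> Dm v a x = 0"
    and b: "Ck_on 2 S b" "\<And>x. x \<in> S \<Longrightarrow> Dm v b x = 0" and p: "p \<in> S"
  shows "frozen_at v (axial (wedge a b)) p"
proof (rule frozen_axial)
  note d = pd_differentiable[OF a(1) p] pd_differentiable[OF b(1) p]
  show "Dm v (wedge a b l i) p = - (\<Sum>j\<in>UNIV. pd (ex l) (\<lambda>x. v x $ j) p * wedge a b j i p
      + pd (ex i) (\<lambda>x. v x $ j) p * wedge a b l j p)" for l i
    by (simp add: wedge_def[abs_def] Dm_diff Dm_mult differentiable_mult d
        Dm_pd_transported[OF a p] Dm_pd_transported[OF b p] sum_3 algebra_simps)
qed (simp add: wedge_def)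

end

section \<open>Transport of curl K and the local helicity law\<close>

context inertial_motion
begin

lemma Ck_Kvec: "Ck_on 2 S Kf"
  by (intro Ck_on_vec open_S Ck_K)

lemma Ck_curl_K: "Ck_on 1 S (axial (curl_form Kf))"
proof (rule Ck_axial[OF open_S])
  fix l i
  have "Ck_on 1 S (pd (ex j) (\<lambda>x. Kf x $ k))" for j k
    using Ck_K[of k] by (intro Ck_on_pd) (auto simp: eval_nat_numeral)
  then show "Ck_on 1 S (curl_form Kf l i)"
    unfolding curl_form_def[abs_def] by (intro Ck_on_diff open_S)
qed

text \<open>Antisymmetrizing the derivative of \<open>K_equation\<close> kills the second
  derivatives of Q and of the velocity by symmetry. The commutator terms and the differentiated
  gradient terms combine to the Lie derivative of the two-form.\<close>

lemma frozen_curl_K: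
  assumes p: "p \<in> T"
  shows "frozen_at v (axial (curl_form Kf)) p"
proof (rule frozen_axial)
  have pS: "p \<in> S" using p T_S by auto
  let ?K = "\<lambda>i x. Kf x $ i" and ?v = "\<lambda>j x. v x $ j"
  have dK: "?K i differentiable (at p)" for i by (rule diffI[OF Ck_K _ pS]) simp
  have dpK: "pd b (?K i) differentiable (at p)" if "b \<in> Basis" for b i
    by (rule pd_differentiable[OF Ck_K pS that])
  have dpv: "pd b (?v i) differentiable (at p)" if "b \<in> Basis" for b i
    by (rule pd_differentiable[OF Ck_v pS that]) simp
  have dpQ: "pd b Q differentiable (at p)" if "b \<in> Basis" for b
    by (rule pd_differentiable[OF Ck_Q pS that])
  have dDK: "Dm v (?K i) differentiable (at p)" for i
    using Ck_Dm[of 1 "?K i"] Ck_K[of i] by (intro diffI[OF _ _ pS, of 1]) (auto simp: eval_nat_numeral)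
  note d = dK dpK dpv dpQ dDK v_diff[OF pS]
  \<comment> \<open>\<open>K_equation\<close> differentiated in direction \<open>ex l\<close>, which
    is legitimate because it holds on the open set \<open>T\<close>.\<close>
  have E: "Dm v (pd (ex l) (?K i)) p + (\<Sum>j\<in>UNIV. pd (ex l) (?v j) p * pd (ex j) (?K i) p)
      + (\<Sum>j\<in>UNIV. pd (ex i) (?v j) p * pd (ex l) (?K j) p + pd (ex l) (pd (ex i) (?v j)) p * Kf p $ j)
      + pd (ex l) (pd (ex i) Q) p = 0" for l i
  proof -
    have "pd (ex l) (\<lambda>x. Dm v (?K i) x + (\<Sum>j\<in>UNIV. pd (ex i) (?v j) x * Kf x $ j) + pd (ex i) Q x) p
        = pd (ex l) (\<lambda>x. 0) p"
      by (rule pd_cong[OF open_T p, symmetric, THEN sym])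
        (auto simp: K_equation intro!: d differentiable_add differentiable_sum differentiable_mult)
    moreover have "pd (ex l) (\<lambda>x. Dm v (?K i) x + (\<Sum>j\<in>UNIV. pd (ex i) (?v j) x * Kf x $ j)
        + pd (ex i) Q x) p = pd (ex l) (Dm v (?K i)) p
        + (\<Sum>j\<in>UNIV. pd (ex i) (?v j) p * pd (ex l) (?K j) p + pd (ex l) (pd (ex i) (?v j)) p * Kf p $ j)
        + pd (ex l) (pd (ex i) Q) p"
      by (simp add: pd_add pd_sum pd_mult d differentiable_add differentiable_sum differentiable_mult)
    ultimately show ?thesis using pd_Dm[OF Ck_K pS, of l i] by simp
  qed
  have c1: "pd (ex l) (pd (ex i) Q) p = pd (ex i) (pd (ex l) Q) p" for l i
    by (rule pd_commute[OF open_S pS Ck_Q]) auto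
  have c2: "pd (ex l) (pd (ex i) (?v j)) p = pd (ex i) (pd (ex l) (?v j)) p" for l i j
    by (rule pd_commute[OF open_S pS Ck_v]) auto
  show "Dm v (curl_form Kf l i) p = - (\<Sum>j\<in>UNIV. pd (ex l) (?v j) p * curl_form Kf j i p
      + pd (ex i) (?v j) p * curl_form Kf l j p)" for l i
  proof -
    have "Dm v (curl_form Kf l i) p = Dm v (pd (ex l) (?K i)) p - Dm v (pd (ex i) (?K l)) p"
      unfolding curl_form_def[abs_def] by (simp add: Dm_diff d)
    then show ?thesis
      using E[of l i] E[of i l] c1[of l i] c2[of l i]
      by (simp add: curl_form_def sum_3 algebra_simps)
  qed
qed (simp add: curl_form_def)

text \<open>K is carried as a one-form up to a gradient and z as a vector, so the velocity gradients
  cancel in their product except for the divergence. The first two conclusions serve the integral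
  statement, the third is the local law.\<close>

lemma
  assumes p: "p \<in> T" and z: "\<And>i. (\<lambda>x. z x $ i) differentiable (at p)"
    and fz: "frozen_at v z p" and dz: "dvg z p = 0"
  shows Dm_helicity: "Dm v (\<lambda>x. \<Sum>i\<in>UNIV. Kf x $ i * z x $ i) p
      = - (\<Sum>i\<in>UNIV. z p $ i * pd (ex i) Q p) - (\<Sum>i\<in>UNIV. Kf p $ i * z p $ i) * dvg v p"
    and dvg_flux: "(\<Sum>j\<in>UNIV. pd (ex j) (\<lambda>x. Q x * z x $ j) p) = (\<Sum>i\<in>UNIV. z p $ i * pd (ex i) Q p)"
    and helicity_law: "pd et (\<lambda>x. \<Sum>i\<in>UNIV. Kf x $ i * z x $ i) p
      + (\<Sum>j\<in>UNIV. pd (ex j) (\<lambda>x. (\<Sum>i\<in>UNIV. Kf x $ i * z x $ i) * v x $ j + Q x * z x $ j) p) = 0"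
proof -
  have pS: "p \<in> S" using p T_S by auto
  have dK: "(\<lambda>x. Kf x $ i) differentiable (at p)" for i by (rule diffI[OF Ck_K _ pS]) simp
  have dQ: "Q differentiable (at p)" by (rule diffI[OF Ck_Q _ pS]) simp
  note d = dK dQ z v_diff[OF pS]
  have eq: "Dm v (\<lambda>x. Kf x $ i) p = - (\<Sum>j\<in>UNIV. pd (ex i) (\<lambda>x. v x $ j) p * Kf p $ j)
    - pd (ex i) Q p" for i
    using K_equation[OF p, of i] by simp
  have fz': "Dm v (\<lambda>x. z x $ i) p
    = (\<Sum>j\<in>UNIV. z p $ j * pd (ex j) (\<lambda>x. v x $ i) p) - z p $ i * dvg v p" for i
    using fz by (auto simp: frozen_at_def)
  show 1: "Dm v (\<lambda>x. \<Sum>i\<in>UNIV. Kf x $ i * z x $ i) p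
      = - (\<Sum>i\<in>UNIV. z p $ i * pd (ex i) Q p) - (\<Sum>i\<in>UNIV. Kf p $ i * z p $ i) * dvg v p"
  proof -
    have "Dm v (\<lambda>x. \<Sum>i\<in>UNIV. Kf x $ i * z x $ i) p
        = (\<Sum>i\<in>UNIV. Kf p $ i * Dm v (\<lambda>x. z x $ i) p + Dm v (\<lambda>x. Kf x $ i) p * z p $ i)"
      by (subst Dm_sum) (simp_all add: Dm_mult differentiable_mult d)
    then show ?thesis by (simp add: eq fz' sum_3 algebra_simps)
  qed
  have "(\<Sum>j\<in>UNIV. pd (ex j) (\<lambda>x. Q x * z x $ j) p)
      = (\<Sum>i\<in>UNIV. z p $ i * pd (ex i) Q p) + Q p * dvg z p"
    by (simp add: pd_mult d dvg_def sum_3 algebra_simps)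
  then show 2: "(\<Sum>j\<in>UNIV. pd (ex j) (\<lambda>x. Q x * z x $ j) p) = (\<Sum>i\<in>UNIV. z p $ i * pd (ex i) Q p)"
    using dz by simp
  let ?h = "\<lambda>x. \<Sum>i\<in>UNIV. Kf x $ i * z x $ i"
  have h: "?h differentiable (at p)" by (auto intro!: differentiable_sum differentiable_mult d)
  have hv: "pd (ex j) (\<lambda>x. ?h x * v x $ j + Q x * z x $ j) p = ?h p * pd (ex j) (\<lambda>x. v x $ j) p
      + v p $ j * pd (ex j) ?h p + pd (ex j) (\<lambda>x. Q x * z x $ j) p" for j
    using pd_add[OF differentiable_mult[OF h v_diff[OF pS]] differentiable_mult[OF dQ z]]
      pd_mult[OF h v_diff[OF pS]] by simp
  have "pd et ?h p + (\<Sum>j\<in>UNIV. pd (ex j) (\<lambda>x. ?h x * v x $ j + Q x * z x $ j) p)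
    = Dm v ?h p + ?h p * dvg v p + (\<Sum>j\<in>UNIV. pd (ex j) (\<lambda>x. Q x * z x $ j) p)"
    unfolding hv Dm_def dvg_def by (simp add: sum.distrib sum_distrib_left)
  then show "pd et ?h p + (\<Sum>j\<in>UNIV. pd (ex j) (\<lambda>x. ?h x * v x $ j + Q x * z x $ j) p) = 0"
    unfolding 1 2 by simp
qed

end

text \<open>\<open>Y\<close> is the vector of Lagrangian coordinates as functions of time and Eulerian position.\<close>

locale lagrangian_labels = flow_region S v for S v +
  fixes Y :: "3 \<Rightarrow> event \<Rightarrow> real"
  assumes smooth_Y: "\<And>a. Ck_on 2 S (Y a)"
    and Dm_Y: "\<And>a p. p \<in> S \<Longrightarrow> Dm v (Y a) p = 0"
begin

text \<open>The Jacobian of the labels, which will be the inverse of the deformation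
  gradient.\<close>

definition G :: "event \<Rightarrow> real^3^3" where "G p = (\<chi> a j. pd (ex j) (Y a) p)"

text \<open>The columns of the adjugate of \<open>G\<close>, in cyclic order. Written as cross
  products of gradients, they are visibly solenoidal and frozen; \<open>Ef_eq_column\<close>
  identifies them with the columns of F / det F.\<close>

definition Ef :: "3 \<Rightarrow> event \<Rightarrow> real^3" where
  "Ef i = (if i = 1 then axial (wedge (Y 2) (Y 3))
     else if i = 2 then axial (wedge (Y 3) (Y 1)) else axial (wedge (Y 1) (Y 2)))"

lemma Ck_Ef: "Ck_on 1 S (Ef i)"
proof -
  have "Ck_on 1 S (axial (wedge (Y a) (Y b)))" for a b
    using smooth_Y by (intro Ck_axial Ck_wedge open_S) (auto simp: eval_nat_numeral)
  then show ?thesis by (simp add: Ef_def)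
qed

lemma dvg_Ef: "p \<in> S \<Longrightarrow> dvg (Ef i) p = 0"
  by (simp add: Ef_def dvg_axial_wedge smooth_Y)

lemma frozen_Ef: "p \<in> S \<Longrightarrow> frozen_at v (Ef i) p"
  by (simp add: Ef_def frozen_axial_wedge smooth_Y Dm_Y)

lemma G_Ef: "(\<Sum>j\<in>UNIV. G p $ a $ j * Ef i p $ j) = (if a = i then det (G p) else 0)"
proof -
  have "\<forall>a i. (\<Sum>j\<in>UNIV. G p $ a $ j * Ef i p $ j) = (if a = i then det (G p) else 0)"
    unfolding forall_3 by (simp add: Ef_def G_def sum_3 det_3 wedge_def algebra_simps)
  then show ?thesis by blast
qed

lemma G_differentiable: "p \<in> S \<Longrightarrow> (\<lambda>x. G x $ a $ j) differentiable (at p)"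
  by (simp add: G_def pd_differentiable[OF smooth_Y, unfolded pd_def[abs_def]] pd_def[abs_def])

text \<open>The rows of \<open>G\<close> move as covectors and z as a vector, so the velocity
  gradient cancels and only the weight - div v remains.\<close>

lemma Dm_G_frozen:
  assumes p: "p \<in> S" and z: "\<And>i. (\<lambda>x. z x $ i) differentiable (at p)" and fz: "frozen_at v z p"
  shows "Dm v (\<lambda>x. \<Sum>j\<in>UNIV. G x $ a $ j * z x $ j) p
    = - (\<Sum>j\<in>UNIV. G p $ a $ j * z p $ j) * dvg v p"
proof -
  have fz': "Dm v (\<lambda>x. z x $ i) p
    = (\<Sum>j\<in>UNIV. z p $ j * pd (ex j) (\<lambda>x. v x $ i) p) - z p $ i * dvg v p" for i
    using fz by (auto simp: frozen_at_def)
  have DG: "Dm v (\<lambda>x. G x $ a $ j) p = - (\<Sum>k\<in>UNIV. pd (ex j) (\<lambda>x. v x $ k) p * G p $ a $ k)" for j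
    using Dm_pd_transported[OF smooth_Y Dm_Y p, of j a] by (simp add: G_def)
  show ?thesis
  proof -
    have "Dm v (\<lambda>x. \<Sum>j\<in>UNIV. G x $ a $ j * z x $ j) p
        = (\<Sum>j\<in>UNIV. G p $ a $ j * Dm v (\<lambda>x. z x $ j) p + Dm v (\<lambda>x. G x $ a $ j) p * z p $ j)"
      by (subst Dm_sum) (simp_all add: Dm_mult differentiable_mult z G_differentiable[OF p])
    then show ?thesis by (simp add: DG fz' sum_3 algebra_simps)
  qed
qed

lemma det_G_differentiable: "p \<in> S \<Longrightarrow> (\<lambda>x. det (G x)) differentiable (at p)"
  unfolding det_3 by (intro differentiable_add differentiable_diff differentiable_mult G_differentiable)

lemma Dm_det_G:
  assumes "p \<in> S"
  shows "Dm v (\<lambda>x. det (G x)) p = - det (G p) * dvg v p"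
proof -
  have "(\<lambda>x. Ef 1 x $ i) differentiable (at p)" for i
    by (rule diffI[of 1]) (auto intro!: Ck_on_nth open_S Ck_Ef assms simp del: One_nat_def)
  then show ?thesis
    using Dm_G_frozen[OF assms _ frozen_Ef[OF assms], of 1 1] by (simp add: G_Ef)
qed

text \<open>Lagrangian components of z (its Piola transform). Numerator and denominator decay at the
  same rate - div v, so the quotient is constant along paths.\<close>

definition zeta :: "(event \<Rightarrow> real^3) \<Rightarrow> 3 \<Rightarrow> event \<Rightarrow> real" where
  "zeta z a p = (\<Sum>j\<in>UNIV. G p $ a $ j * z p $ j) / det (G p)"

lemma Dm_zeta:
  assumes "p \<in> S" "\<And>i. (\<lambda>x. z x $ i) differentiable (at p)" "frozen_at v z p" "det (G p) \<noteq> 0"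
  shows "Dm v (zeta z a) p = 0"
  unfolding zeta_def[abs_def]
  by (subst Dm_divide) (auto intro!: differentiable_sum differentiable_mult G_differentiable
      det_G_differentiable assms simp: Dm_det_G Dm_G_frozen assms)

end

section \<open>Lagrangian labels of a fluid motion\<close>

text \<open>This and the next lemmas translate derivatives of curried fields into partial
  derivatives on space-time.\<close>

lemma slice_time_derivative:
  fixes f :: "event \<Rightarrow> 'b::real_normed_vector"
  assumes "(f has_derivative f') (at (t, x))"
  shows "((\<lambda>s. f (s, x)) has_vector_derivative f' (1, 0)) (at t)"
proof -
  have "((\<lambda>s. (s, x)) has_derivative (\<lambda>s. (s, 0))) (at t)"
    by (auto intro!: derivative_eq_intros)
  from diff_chain_at[OF this, of f f'] assms
  have "((\<lambda>s. f (s, x)) has_derivative (\<lambda>s. f' (s, 0))) (at t)" by (simp add: o_def)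
  moreover have "(\<lambda>s. f' (s, 0)) = (\<lambda>s. s *\<^sub>R f' (1, 0))"
  proof
    fix s :: real
    have "(s, 0) = s *\<^sub>R (1, 0 :: real^3)" by simp
    then show "f' (s, 0) = s *\<^sub>R f' (1, 0)"
      by (simp only: linear_cmul[OF has_derivative_linear[OF assms]])
  qed
  ultimately show ?thesis by (simp only: has_vector_derivative_def)
qed

lemma slice_space_derivative:
  assumes "(f has_derivative f') (at (t, x))"
  shows "((\<lambda>y. f (t, y)) has_derivative (\<lambda>h. f' (0, h))) (at x)"
proof -
  have "((\<lambda>y. (t, y)) has_derivative (\<lambda>h. (0, h))) (at x)"
    by (auto intro!: derivative_eq_intros)
  from diff_chain_at[OF this, of f f'] assms show ?thesis by (simp add: o_def)
qed

lemma pd_nth: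
  assumes "z differentiable (at p)"
  shows "pd b (\<lambda>x. z x $ i) p = frechet_derivative z (at p) b $ i"
  by (rule pd_eqI[OF bounded_linear.has_derivative[OF bounded_linear_vec_nth
        frechet_derivative_works[THEN iffD1, OF assms]]])

lemma dt_eq_pd:
  assumes "case_prod f differentiable (at (t, x))"
  shows "dt f t x = pd et (case_prod f) (t, x)"
  using slice_time_derivative[OF pd_has_derivative[OF assms]]
  by (simp add: dt_def vector_derivative_at)

lemma dt_nth_eq_pd:
  fixes z :: "real \<Rightarrow> real^3 \<Rightarrow> real^3"
  assumes "case_prod z differentiable (at (t, x))"
  shows "dt z t x $ i = pd et (\<lambda>p. case_prod z p $ i) (t, x)"
  using slice_time_derivative[OF frechet_derivative_works[THEN iffD1, OF assms]]
  by (simp add: dt_def vector_derivative_at pd_nth[OF assms])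

lemma grad_eq_pd:
  assumes "case_prod f differentiable (at (t, x))"
  shows "grad (f t) x $ i = pd (ex i) (case_prod f) (t, x)"
proof -
  have "frechet_derivative (f t) (at x) = (\<lambda>h. pd (0, h) (case_prod f) (t, x))"
    using frechet_derivative_at[OF slice_space_derivative[OF pd_has_derivative[OF assms]]] by simp
  then show ?thesis by (simp add: grad_def)
qed

lemma jacobian_eq_pd:
  fixes z :: "real \<Rightarrow> real^3 \<Rightarrow> real^3"
  assumes "case_prod z differentiable (at (t, x))"
  shows "jacobian (z t) (at x) $ i $ j = pd (ex j) (\<lambda>p. case_prod z p $ i) (t, x)"
proof -
  have "frechet_derivative (z t) (at x) = (\<lambda>h. frechet_derivative (case_prod z) (at (t, x)) (0, h))"
    using frechet_derivative_at[OF slice_space_derivative[OF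
        frechet_derivative_works[THEN iffD1, OF assms]]] by simp
  then show ?thesis
    by (simp add: jacobian_def matrix_def pd_nth[OF assms])
qed

lemma divg_eq_dvg:
  assumes "case_prod z differentiable (at (t, x))"
  shows "divg (z t) x = dvg (case_prod z) (t, x)"
  by (simp add: divg_def trace_def jacobian_eq_pd[OF assms] dvg_def)

lemma curl_eq_axial:
  assumes "case_prod z differentiable (at (t, x))"
  shows "curl (z t) x = axial (curl_form (case_prod z)) (t, x)"
  by (simp add: curl_def jacobian_eq_pd[OF assms] axial_def curl_form_def Let_def)

section \<open>Smooth inversion of 3 by 3 matrices\<close>

definition adjugate3 :: "real^3^3 \<Rightarrow> real^3^3" where
  "adjugate3 M = vector [
     vector [M$2$2 * M$3$3 - M$2$3 * M$3$2, M$1$3 * M$3$2 - M$1$2 * M$3$3, M$1$2 * M$2$3 - M$1$3 * M$2$2],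
     vector [M$2$3 * M$3$1 - M$2$1 * M$3$3, M$1$1 * M$3$3 - M$1$3 * M$3$1, M$1$3 * M$2$1 - M$1$1 * M$2$3],
     vector [M$2$1 * M$3$2 - M$2$2 * M$3$1, M$1$2 * M$3$1 - M$1$1 * M$3$2, M$1$1 * M$2$2 - M$1$2 * M$2$1]]"

text \<open>An explicit rational formula, so that regularity of the entries passes to the inverse by
  the product and quotient rules.\<close>

definition inv3 :: "real^3^3 \<Rightarrow> real^3^3" where
  "inv3 M = (1 / det M) *\<^sub>R adjugate3 M"

lemma inv3_left:
  assumes "det M \<noteq> 0"
  shows "inv3 M ** M = mat 1"
proof -
  have "adjugate3 M ** M = det M *\<^sub>R mat 1"
    unfolding vec_eq_iff forall_3
    by (simp add: matrix_matrix_mult_def sum_3 adjugate3_def det_3 mat_def algebra_simps)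
  moreover have "inv3 M ** M = (1 / det M) *\<^sub>R (adjugate3 M ** M)"
    by (simp add: inv3_def vec_eq_iff matrix_matrix_mult_def sum_3 add_divide_distrib)
  ultimately show ?thesis using assms by simp
qed

lemma inv3_right: "det M \<noteq> 0 \<Longrightarrow> M ** inv3 M = mat 1"
  using inv3_left matrix_left_right_inverse by blast

lemma Ck_det3:
  fixes M :: "'a::euclidean_space \<Rightarrow> real^3^3"
  assumes "open S" "\<And>i j. Ck_on k S (\<lambda>p. M p $ i $ j)"
  shows "Ck_on k S (\<lambda>p. det (M p))"
  unfolding det_3 by (intro Ck_on_add Ck_on_diff Ck_on_mult assms)

lemma Ck_inv3:
  fixes M :: "'a::euclidean_space \<Rightarrow> real^3^3"
  assumes "open S" "\<And>i j. Ck_on k S (\<lambda>p. M p $ i $ j)" "\<And>p. p \<in> S \<Longrightarrow> det (M p) \<noteq> 0"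
  shows "Ck_on k S (\<lambda>p. inv3 (M p) $ i $ j)"
proof -
  have "\<forall>i j. Ck_on k S (\<lambda>p. adjugate3 (M p) $ i $ j)"
    unfolding forall_3 adjugate3_def vector_3
    by (intro conjI Ck_on_diff Ck_on_mult assms)
  then show ?thesis
    unfolding inv3_def vector_scaleR_component real_scaleR_def
    by (intro Ck_on_mult Ck_on_divide Ck_det3 Ck_on_const assms) auto
qed

section \<open>The flow as a map of space-time and its inverse\<close>

locale fluid_kinematics =
  fixes J :: "real set" and U :: "(real^3) set" and \<phi> u :: "real \<Rightarrow> real^3 \<Rightarrow> real^3"
  assumes motion: "fluid_motion J U \<phi>" and velocity: "is_velocity J U \<phi> u"
    and smooth_u: "Ck_on 3 (spacetime_region J U \<phi>) (\<lambda>(t, x). u t x)"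
begin

abbreviation region :: "event set" where "region \<equiv> spacetime_region J U \<phi>"

abbreviation vel :: "event \<Rightarrow> real^3" where "vel \<equiv> case_prod u"

text \<open>Keeping time as a coordinate makes the motion a single injective map between open sets
  of equal dimension, whose inverse is \<open>\<Theta>\<close>.\<close>

definition \<Psi> :: "event \<Rightarrow> event" where "\<Psi> p = (fst p, \<phi> (fst p) (snd p))"

definition \<Theta> :: "event \<Rightarrow> event" where "\<Theta> p = (fst p, the_inv_into U (\<phi> (fst p)) (snd p))"

definition Fm :: "event \<Rightarrow> real^3^3" where
  "Fm p = (\<chi> i j. pd (ex j) (\<lambda>q. case_prod \<phi> q $ i) p)"

definition Yl :: "3 \<Rightarrow> event \<Rightarrow> real" where "Yl a p = snd (\<Theta> p) $ a"

lemma open_J: "open J" and open_U: "open U" and interval_J: "is_interval J"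
  and inj_phi: "t \<in> J \<Longrightarrow> inj_on (\<phi> t) U"
  and smooth_phi: "Ck_on 2 (J \<times> U) (case_prod \<phi>)"
  and smooth_inv: "t \<in> J \<Longrightarrow> Ck_on 2 (\<phi> t ` U) (the_inv_into U (\<phi> t))"
  using motion unfolding fluid_motion_def by simp_all

lemma open_JU: "open (J \<times> U)"
  by (intro open_Times open_J open_U)

lemma region_eq: "B \<subseteq> U \<Longrightarrow> spacetime_region J B \<phi> = \<Psi> ` (J \<times> B)"
  unfolding spacetime_region_def \<Psi>_def image_def by auto

lemma Theta_Psi [simp]: "p \<in> J \<times> U \<Longrightarrow> \<Theta> (\<Psi> p) = p"
  unfolding \<Theta>_def \<Psi>_def by (cases p) (simp add: the_inv_into_f_f[OF inj_phi])

lemma Theta_in: "p \<in> region \<Longrightarrow> \<Theta> p \<in> J \<times> U"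
  and Psi_Theta [simp]: "p \<in> region \<Longrightarrow> \<Psi> (\<Theta> p) = p"
proof -
  assume "p \<in> region"
  then obtain q where "q \<in> J \<times> U" "p = \<Psi> q"
    unfolding region_eq[OF order_refl] by (rule imageE)
  then show "\<Theta> p \<in> J \<times> U" "\<Psi> (\<Theta> p) = p"
    by (simp_all only: Theta_Psi)
qed

lemma Psi_in: "p \<in> J \<times> U \<Longrightarrow> \<Psi> p \<in> region"
  unfolding region_eq[OF order_refl] by (rule imageI)

lemma phi_differentiable: "p \<in> J \<times> U \<Longrightarrow> case_prod \<phi> differentiable (at p)"
  by (rule Ck_on_differentiable[OF smooth_phi]) auto

lemma Psi_continuous: "continuous_on (J \<times> U) \<Psi>"
proof -
  have "\<Psi> = (\<lambda>p. (fst p, case_prod \<phi> p))" by (simp add: fun_eq_iff \<Psi>_def split_beta)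
  then show ?thesis
    using continuous_on_Pair[OF continuous_on_fst[OF continuous_on_id] Ck_on_continuous[OF smooth_phi]]
    by simp
qed

lemma Psi_inj: "inj_on \<Psi> (J \<times> U)"
  by (rule inj_on_inverseI[of _ \<Theta>]) (rule Theta_Psi)

text \<open>Invariance of domain applied to \<open>\<Psi>\<close>; openness of the image at a fixed
  time follows by slicing.\<close>

lemma open_subregion:
  assumes "open B" "B \<subseteq> U"
  shows "open (spacetime_region J B \<phi>)"
proof -
  have "J \<times> B \<subseteq> J \<times> U" using assms by auto
  then show ?thesis unfolding region_eq[OF assms(2)]
    by (intro invariance_of_domain open_Times open_J assms
        continuous_on_subset[OF Psi_continuous] inj_on_subset[OF Psi_inj])
qed

lemma open_region: "open region"
  by (rule open_subregion[OF open_U order_refl])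

lemma open_phi_image:
  assumes "t \<in> J" "open B" "B \<subseteq> U"
  shows "open (\<phi> t ` B)"
proof -
  have "\<phi> t ` B = Pair t -` (spacetime_region J B \<phi>)"
    using assms by (auto simp: spacetime_region_def)
  moreover have "open (Pair t -` (spacetime_region J B \<phi>))"
    by (rule open_vimage[OF open_subregion[OF assms(2,3)]]) (intro continuous_on_Pair continuous_on_const continuous_on_id)
  ultimately show ?thesis by simp
qed

lemma phi_space_derivative:
  assumes "(t, X) \<in> J \<times> U"
  shows "(\<phi> t has_derivative (\<lambda>h. Fm (t, X) *v h)) (at X)"
    and "jacobian (\<phi> t) (at X) = Fm (t, X)"
proof -
  show 1: "jacobian (\<phi> t) (at X) = Fm (t, X)"
    using jacobian_eq_pd[OF phi_differentiable[OF assms]] by (simp add: vec_eq_iff Fm_def)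
  have "\<phi> t differentiable (at X)"
    using slice_space_derivative[OF frechet_derivative_works[THEN iffD1,
          OF phi_differentiable[OF assms]]] by (auto simp: differentiable_def)
  then show "(\<phi> t has_derivative (\<lambda>h. Fm (t, X) *v h)) (at X)"
    using jacobian_works[of "\<phi> t" "at X"] 1 by (simp add: jacobian_works[symmetric])
qed

text \<open>Differentiating the identity of the inverse map with \<open>\<phi> t\<close> at a fixed
  time gives the deformation gradient a left inverse. Here the differentiability of the inverse
  motion enters.\<close>

lemma det_Fm:
  assumes p: "p \<in> J \<times> U"
  shows "det (Fm p) \<noteq> 0"
proof -
  obtain t X where tX: "p = (t, X)" "t \<in> J" "X \<in> U" using p by auto
  let ?i = "the_inv_into U (\<phi> t)"
  have d: "?i differentiable (at (\<phi> t X))"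
    by (rule Ck_on_differentiable[OF smooth_inv]) (use tX in auto)
  have "(?i \<circ> \<phi> t has_derivative (frechet_derivative ?i (at (\<phi> t X)) \<circ> (\<lambda>h. Fm p *v h))) (at X)"
    using phi_space_derivative(1) p d unfolding tX
    by (intro diff_chain_at) (auto simp: frechet_derivative_works[symmetric])
  moreover have "(?i \<circ> \<phi> t has_derivative (\<lambda>h. h)) (at X)"
    by (rule has_derivative_transform_within_open[OF has_derivative_ident open_U tX(3)])
      (simp add: the_inv_into_f_f[OF inj_phi[OF tX(2)]])
  ultimately have "frechet_derivative ?i (at (\<phi> t X)) (Fm p *v h) = h" for h
    by (metis (no_types, lifting) has_derivative_unique o_apply)
  moreover have "linear (frechet_derivative ?i (at (\<phi> t X)))"
    using d by (rule linear_frechet_derivative)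
  ultimately have "Fm p *v h = 0 \<Longrightarrow> h = 0" for h
    by (metis linear_0)
  then show ?thesis
    by (metis invertible_det_nz matrix_left_invertible_ker invertible_left_inverse)
qed

lemma Psi_derivative:
  assumes p: "p \<in> J \<times> U"
  shows "(\<Psi> has_derivative (\<lambda>h. (fst h, fst h *\<^sub>R case_prod u (\<Psi> p) + Fm p *v snd h))) (at p)"
proof -
  obtain t X where tX: "p = (t, X)" "t \<in> J" "X \<in> U" using p by auto
  let ?D = "frechet_derivative (case_prod \<phi>) (at p)"
  have D: "(case_prod \<phi> has_derivative ?D) (at p)"
    using phi_differentiable[OF p] by (simp add: frechet_derivative_works)
  have lin: "linear ?D" using D by (rule has_derivative_linear)
  have "((\<lambda>s. \<phi> s X) has_vector_derivative ?D (1, 0)) (at t)"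
    using slice_time_derivative[of "case_prod \<phi>" ?D t X] D by (simp add: tX)
  moreover have "((\<lambda>s. \<phi> s X) has_vector_derivative u t (\<phi> t X)) (at t)"
    using velocity tX by (auto simp: is_velocity_def)
  ultimately have 1: "?D (1, 0) = case_prod u (\<Psi> p)"
    using vector_derivative_unique_at by (fastforce simp: tX \<Psi>_def)
  have "(\<phi> t has_derivative (\<lambda>h. ?D (0, h))) (at X)"
    using slice_space_derivative[of "case_prod \<phi>" ?D t X] D by (simp add: tX)
  then have 2: "?D (0, h) = Fm p *v h" for h
    using phi_space_derivative(1)[of t X] p has_derivative_unique by (metis tX(1))
  have 3: "?D h = fst h *\<^sub>R case_prod u (\<Psi> p) + Fm p *v snd h" for h
  proof -
    have "?D h = ?D (fst h *\<^sub>R (1, 0) + (0, snd h))" by simp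
    then show ?thesis by (metis linear_add[OF lin] linear_cmul[OF lin] 1 2)
  qed
  have "(case_prod \<phi> has_derivative
      (\<lambda>h. fst h *\<^sub>R case_prod u (\<Psi> p) + Fm p *v snd h)) (at p)"
    using D unfolding ext[of ?D, OF 3] .
  moreover have "\<Psi> = (\<lambda>p. (fst p, case_prod \<phi> p))" by (simp add: fun_eq_iff \<Psi>_def split_beta)
  ultimately show ?thesis
    by (auto intro!: has_derivative_Pair has_derivative_fst has_derivative_ident)
qed

text \<open>The derivative of \<open>\<Psi>\<close> is block triangular with the velocity as its
  time column. The inverse function theorem inverts it, so the labels have time derivative minus
  \<open>inv3 (Fm (\<Theta> p))\<close> applied to u.\<close>

lemma Theta_derivative:
  assumes p: "p \<in> region"
  shows "(\<Theta> has_derivative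
    (\<lambda>h. (fst h, inv3 (Fm (\<Theta> p)) *v (snd h - fst h *\<^sub>R case_prod u p)))) (at p)"
proof -
  note q = Theta_in[OF p]
  have "(\<Theta> has_derivative
    (\<lambda>h. (fst h, inv3 (Fm (\<Theta> p)) *v (snd h - fst h *\<^sub>R case_prod u p)))) (at (\<Psi> (\<Theta> p)))"
  proof (rule has_derivative_inverse_strong[OF open_JU q Psi_continuous _ Psi_derivative[OF q]])
    show "(\<lambda>h. (fst h, fst h *\<^sub>R case_prod u (\<Psi> (\<Theta> p)) + Fm (\<Theta> p) *v snd h)) \<circ>
      (\<lambda>h. (fst h, inv3 (Fm (\<Theta> p)) *v (snd h - fst h *\<^sub>R case_prod u p))) = id"
      using inv3_right[OF det_Fm[OF q]] p by (auto simp: fun_eq_iff matrix_vector_mul_assoc)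
  qed simp
  then show ?thesis using p by simp
qed

lemma Yl_derivative:
  assumes "p \<in> region"
  shows "(Yl a has_derivative
    (\<lambda>h. \<Sum>j\<in>UNIV. inv3 (Fm (\<Theta> p)) $ a $ j * (snd h $ j - fst h * case_prod u p $ j))) (at p)"
  using bounded_linear.has_derivative[OF bounded_linear_vec_nth
      has_derivative_snd[OF Theta_derivative[OF assms]], of a]
  by (simp add: Yl_def[abs_def] matrix_vector_mult_def)

lemma pd_Yl:
  assumes "p \<in> region"
  shows "pd (ex j) (Yl a) p = inv3 (Fm (\<Theta> p)) $ a $ j"
  using pd_eqI[OF Yl_derivative[OF assms, of a], of "ex j"] exhaust_3[of j]
  by (auto simp: sum_3 axis_def)

lemma Ck_Fm: "Ck_on 1 (J \<times> U) (\<lambda>p. Fm p $ i $ j)"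
proof -
  have "Ck_on 2 (J \<times> U) (\<lambda>q. case_prod \<phi> q $ i)"
    by (intro Ck_on_nth open_JU smooth_phi)
  then show ?thesis unfolding Fm_def vec_lambda_beta by (rule Ck_on_pd_2) (rule ex_Basis)
qed

text \<open>Bootstrap: the derivative of \<open>\<Theta>\<close> is rational in the deformation
  gradient at \<open>\<Theta>\<close> and in the velocity, so each order of regularity yields the
  next. It stops at k = 1 because the deformation gradient is only of class 1.\<close>

lemma Ck_Theta_step:
  assumes "Ck_on k region \<Theta>" "k \<le> 1"
  shows "Ck_on (Suc k) region \<Theta>"
proof -
  have F: "Ck_on k region (\<lambda>p. Fm (\<Theta> p) $ i $ j)" for i j
    using Ck_on_compose[OF open_region open_JU _ assms(1) Ck_on_le[OF Ck_Fm assms(2)], of i j] Theta_in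
    by blast
  have I: "Ck_on k region (\<lambda>p. inv3 (Fm (\<Theta> p)) $ i $ j)" for i j
    by (rule Ck_inv3[OF open_region F]) (use det_Fm Theta_in in blast)
  have uk: "Ck_on k region (\<lambda>p. case_prod u p $ j)" for j
    by (rule Ck_on_le[of 3]) (use assms(2) in \<open>auto intro!: Ck_on_nth open_region smooth_u\<close>)
  have "Ck_on (Suc k) region (Yl a)" for a
    by (rule Ck_on_SucI[OF open_region Yl_derivative])
      (assumption, intro Ck_on_sum Ck_on_mult Ck_on_diff Ck_on_const open_region I uk)
  then have "Ck_on (Suc k) region (\<lambda>p. snd (\<Theta> p))"
    by (intro Ck_on_vec open_region) (simp add: Yl_def[abs_def] del: Ck_on.simps(2))
  then have "Ck_on (Suc k) region (\<lambda>p. (fst p, snd (\<Theta> p)))"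
    by (rule Ck_on_Pair[OF open_region Ck_on_bounded_linear[OF open_region bounded_linear_fst]])
  then show ?thesis by (simp add: \<Theta>_def[abs_def] del: Ck_on.simps(2))
qed

lemma Ck_Theta: "Ck_on 2 region \<Theta>"
proof -
  have "Ck_on 0 region \<Theta>"
    using has_derivative_continuous[OF Theta_derivative]
    by (auto intro!: continuous_at_imp_continuous_on)
  then have "Ck_on (Suc (Suc 0)) region \<Theta>"
    by (intro Ck_Theta_step) simp_all
  then show ?thesis by (simp add: numeral_2_eq_2)
qed

lemma Ck_Yl: "Ck_on 2 region (Yl a)"
proof -
  have "Ck_on 2 region (\<lambda>p. snd (\<Theta> p) $ a)"
    by (intro Ck_on_nth Ck_on_bounded_linear_compose[OF _ bounded_linear_snd] open_region Ck_Theta)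
  then show ?thesis by (simp add: Yl_def[abs_def])
qed

lemma labels: "lagrangian_labels region (case_prod u) Yl"
proof
  show "open region" by (rule open_region)
  show "Ck_on 3 region (case_prod u)" using smooth_u .
  show "Ck_on 2 region (Yl a)" for a by (rule Ck_Yl)
  show "Dm (case_prod u) (Yl a) p = 0" if "p \<in> region" for a p
    using pd_eqI[OF Yl_derivative[OF that, of a], of et]
    by (simp add: Dm_def pd_Yl[OF that] sum_negf mult.commute)
qed

sublocale lagrangian_labels region "case_prod u" Yl
  by (rule labels)

lemma G_inverse:
  assumes "p \<in> region"
  shows "G p ** Fm (\<Theta> p) = mat 1" "Fm (\<Theta> p) ** G p = mat 1"
proof -
  have "G p = inv3 (Fm (\<Theta> p))" by (simp add: G_def pd_Yl[OF assms] vec_eq_iff)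
  then show "G p ** Fm (\<Theta> p) = mat 1" "Fm (\<Theta> p) ** G p = mat 1"
    using inv3_left inv3_right det_Fm[OF Theta_in[OF assms]] by auto
qed

lemma det_G:
  assumes "p \<in> region"
  shows "det (G p) = 1 / det (Fm (\<Theta> p))"
proof -
  have "det (G p) * det (Fm (\<Theta> p)) = 1"
    using G_inverse(1)[OF assms] by (metis det_mul det_I)
  then show ?thesis by (metis mult_zero_right nonzero_eq_divide_eq zero_neq_one)
qed

text \<open>\<open>G_Ef\<close> says that \<open>G\<close> sends \<open>Ef i\<close> to det G times
  the i-th unit vector; applying the deformation gradient inverts this.\<close>

lemma Ef_eq_column:
  assumes "p \<in> region"
  shows "Ef i p = det (G p) *\<^sub>R column i (Fm (\<Theta> p))"
proof -
  have "G p *v Ef i p = det (G p) *\<^sub>R axis i 1"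
    by (simp add: vec_eq_iff matrix_vector_mult_def G_Ef axis_def)
  then have "Fm (\<Theta> p) *v (G p *v Ef i p) = det (G p) *\<^sub>R (Fm (\<Theta> p) *v axis i 1)"
    by (simp add: matrix_vector_mult_scaleR)
  then show ?thesis
    by (simp add: matrix_vector_mul_assoc G_inverse(2)[OF assms] matrix_vector_mult_basis)
qed

lemma E_field_eq:
  assumes "(t, x) \<in> region"
  shows "E_field U \<phi> i t x = Ef i (t, x)"
proof -
  have *: "deformation_gradient U \<phi> t x = Fm (\<Theta> (t, x))"
    using phi_space_derivative(2)[of t "the_inv_into U (\<phi> t) x"] Theta_in[OF assms]
    by (simp add: deformation_gradient_def \<Theta>_def)
  show ?thesis
    by (simp add: * E_field_def Ef_eq_column[OF assms] det_G[OF assms] column_def vec_eq_iff)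
qed

lemma path_derivative:
  fixes f :: "event \<Rightarrow> real"
  assumes "(t, X) \<in> J \<times> U" "f differentiable (at (\<Psi> (t, X)))"
  shows "((\<lambda>s. f (\<Psi> (s, X))) has_real_derivative Dm (case_prod u) f (\<Psi> (t, X))) (at t)"
proof -
  let ?f' = "\<lambda>h. pd h f (\<Psi> (t, X))"
  let ?u = "case_prod u (\<Psi> (t, X))"
  have f: "(f has_derivative ?f') (at (\<Psi> (t, X)))" by (rule pd_has_derivative[OF assms(2)])
  have lin: "linear ?f'" using f by (rule has_derivative_linear)
  have "(f \<circ> \<Psi> has_derivative ?f' \<circ> (\<lambda>h. (fst h, fst h *\<^sub>R ?u + Fm (t, X) *v snd h))) (at (t, X))"
    by (rule diff_chain_at[OF Psi_derivative[OF assms(1)] f])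
  from slice_time_derivative[OF this]
  have "((\<lambda>s. f (\<Psi> (s, X))) has_vector_derivative ?f' (1, ?u)) (at t)" by simp
  moreover have "?f' (1, ?u) = Dm (case_prod u) f (\<Psi> (t, X))"
  proof -
    have "?u = (\<Sum>j\<in>UNIV. ?u $ j *\<^sub>R axis j 1)"
      by (simp add: vec_eq_iff sum_component axis_def if_distrib cong: if_cong)
    then have "(1, ?u) = et + (\<Sum>j\<in>UNIV. ?u $ j *\<^sub>R ex j)"
      by (simp add: prod_eq_iff fst_sum snd_sum)
    then have "?f' (1, ?u) = ?f' et + (\<Sum>j\<in>UNIV. ?u $ j *\<^sub>R ?f' (ex j))"
      by (simp only: linear_add[OF lin] linear_sum[OF lin] linear_cmul[OF lin])
    then show ?thesis by (simp add: Dm_def)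
  qed
  ultimately show ?thesis by (simp add: has_real_derivative_iff_has_vector_derivative)
qed

end

section \<open>The inertial fluid in Eulerian coordinates\<close>

lemma W_rho_eq_pd:
  assumes "case_prod W differentiable (at (r, q))"
  shows "W_rho W r q = pd (1, 0) (case_prod W) (r, q)"
    and "W_rhodot W r q = pd (0, 1) (case_prod W) (r, q)"
proof -
  let ?D = "\<lambda>h. pd h (case_prod W) (r, q)"
  have D: "(case_prod W has_derivative ?D) (at (r, q))" by (rule pd_has_derivative[OF assms])
  have lin: "linear ?D" using D by (rule has_derivative_linear)
  have "((\<lambda>r'. (r', q)) has_derivative (\<lambda>h. (h, 0))) (at r)"
    by (auto intro!: derivative_eq_intros)
  from diff_chain_at[OF this, of "case_prod W" ?D] D
  have "((\<lambda>r'. W r' q) has_derivative (\<lambda>h. ?D (h, 0))) (at r)" by (simp add: o_def)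
  moreover have "(\<lambda>h. ?D (h, 0)) = (*) (?D (1, 0))"
  proof
    fix h :: real
    have "(h, 0) = h *\<^sub>R (1, 0 :: real)" by simp
    then show "?D (h, 0) = ?D (1, 0) * h" by (simp only: linear_cmul[OF lin] real_scaleR_def mult.commute)
  qed
  ultimately show "W_rho W r q = ?D (1, 0)"
    unfolding W_rho_def by (intro DERIV_imp_deriv) (simp add: has_field_derivative_def)
  have "((\<lambda>q'. (r, q')) has_derivative (\<lambda>h. (0, h))) (at q)"
    by (auto intro!: derivative_eq_intros)
  from diff_chain_at[OF this, of "case_prod W" ?D] D
  have "((\<lambda>q'. W r q') has_derivative (\<lambda>h. ?D (0, h))) (at q)" by (simp add: o_def)
  moreover have "(\<lambda>h. ?D (0, h)) = (*) (?D (0, 1))"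
  proof
    fix h :: real
    have "(0, h) = h *\<^sub>R (0 :: real, 1)" by simp
    then show "?D (0, h) = ?D (0, 1) * h" by (simp only: linear_cmul[OF lin] real_scaleR_def mult.commute)
  qed
  ultimately show "W_rhodot W r q = ?D (0, 1)"
    unfolding W_rhodot_def by (intro DERIV_imp_deriv) (simp add: has_field_derivative_def)
qed

lemma W_has_derivative:
  assumes "case_prod W differentiable (at (r, q))"
  shows "(case_prod W has_derivative (\<lambda>h. W_rho W r q * fst h + W_rhodot W r q * snd h)) (at (r, q))"
proof -
  let ?D = "\<lambda>h. pd h (case_prod W) (r, q)"
  have D: "(case_prod W has_derivative ?D) (at (r, q))" by (rule pd_has_derivative[OF assms])
  have lin: "linear ?D" using D by (rule has_derivative_linear)
  have "?D = (\<lambda>h. W_rho W r q * fst h + W_rhodot W r q * snd h)"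
  proof
    fix h :: "real \<times> real"
    have "h = fst h *\<^sub>R (1, 0) + snd h *\<^sub>R (0, 1)" by (simp add: prod_eq_iff)
    then have "?D h = fst h *\<^sub>R ?D (1, 0) + snd h *\<^sub>R ?D (0, 1)"
      by (metis linear_add[OF lin] linear_cmul[OF lin])
    then show "?D h = W_rho W r q * fst h + W_rhodot W r q * snd h"
      by (simp add: W_rho_eq_pd[OF assms])
  qed
  then show ?thesis using D by simp
qed

text \<open>Since \<open>\<partial>E/\<partial>\<tau>\<close> is the material derivative \<open>q\<close> of the density, passing from fixed \<open>\<tau>\<close> to
  fixed \<open>\<sigma> = \<rho> \<tau>\<close> adds the term \<open>q W_rhodot / \<rho>\<close>.\<close>

lemma energy_tilde_rho_eq:
  assumes W: "case_prod W differentiable (at (r, q))" and A: "(r, q) \<in> A"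
    and L: "legendre_solution A W R" and r: "r > 0"
  shows "energy_tilde_rho W R r (- r * W_rhodot W r q) = W_rho W r q + q * W_rhodot W r q / r"
proof -
  define w where "w = W_rhodot W r q"
  define s where "s = - r * w"
  have sr: "s / r = - w" using r by (simp add: s_def)
  have Rq: "R r (s / r) = q"
    using L A unfolding legendre_solution_def sr w_def by auto
  have "case_prod R differentiable (at (r, s / r))"
  proof (rule Ck_on_differentiable)
    show "Ck_on 3 ((\<lambda>(r, q). (r, - W_rhodot W r q)) ` A) (case_prod R)"
      using L by (simp add: legendre_solution_def)
    show "(r, s / r) \<in> (\<lambda>(r, q). (r, - W_rhodot W r q)) ` A"
      using A unfolding sr w_def by force
  qed simp
  then have R: "(case_prod R has_derivative (\<lambda>h. pd h (case_prod R) (r, s / r))) (at (r, s / r))"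
    by (rule pd_has_derivative)
  have "((\<lambda>r'. (r', s / r')) has_derivative (\<lambda>h. (h, - (s / (r * r)) * h))) (at r)"
    using r by (auto intro!: derivative_eq_intros simp: field_simps)
  from diff_chain_at[OF this, of "case_prod R"] R
  have "((\<lambda>r'. R r' (s / r')) has_derivative (\<lambda>h. pd (h, - (s / (r * r)) * h) (case_prod R) (r, s / r))) (at r)"
    by (simp add: o_def)
  then have "(\<lambda>r'. R r' (s / r')) differentiable (at r)" by (auto simp: differentiable_def)
  \<comment> \<open>The value of d need not be computed: it enters through d * (w + s / r), and s /
    r = - w.\<close>
  then obtain d where g: "((\<lambda>r'. R r' (s / r')) has_real_derivative d) (at r)"
    using real_differentiableE by blast
  have "((\<lambda>r'. (r', R r' (s / r'))) has_derivative (\<lambda>h. (h, d * h))) (at r)"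
    using g by (auto intro!: derivative_eq_intros simp: has_field_derivative_def)
  from diff_chain_at[OF this, of "case_prod W" "\<lambda>h. W_rho W r q * fst h + W_rhodot W r q * snd h"]
    W_has_derivative[OF W] Rq
  have "((\<lambda>r'. W r' (R r' (s / r'))) has_derivative (\<lambda>h. W_rho W r q * h + w * (d * h))) (at r)"
    by (simp add: o_def w_def)
  then have "((\<lambda>r'. W r' (R r' (s / r'))) has_real_derivative (W_rho W r q + w * d)) (at r)"
    unfolding has_field_derivative_def
    by (rule has_derivative_eq_rhs) (simp add: fun_eq_iff algebra_simps)
  moreover have "((\<lambda>r'. s / r') has_real_derivative - (s / (r * r))) (at r)"
    using r by (auto intro!: derivative_eq_intros simp: field_simps)
  ultimately have "((\<lambda>r'. W r' (R r' (s / r')) + R r' (s / r') * (s / r')) has_real_derivative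
      (W_rho W r q + w * d) + (d * (s / r) + - (s / (r * r)) * R r (s / r))) (at r)"
    by (intro DERIV_add DERIV_mult g)
  moreover have "(W_rho W r q + w * d) + (d * (s / r) + - (s / (r * r)) * R r (s / r))
      = W_rho W r q + q * w / r"
    using r Rq by (simp add: sr) (simp add: s_def field_simps)
  ultimately have "deriv (\<lambda>r'. W r' (R r' (s / r')) + R r' (s / r') * (s / r')) r
      = W_rho W r q + q * w / r"
    using DERIV_imp_deriv by metis
  then show ?thesis
    by (simp add: energy_tilde_rho_def energy_tilde_def energy_def s_def w_def)
qed

section \<open>Identification of the given fields with their space-time versions\<close>

locale inertial_fluid_motion = fluid_kinematics J U \<phi> u for J U \<phi> u +
  fixes B :: "(real^3) set" and \<rho> V :: "real \<Rightarrow> real^3 \<Rightarrow> real"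
    and A :: "(real \<times> real) set" and W R :: "real \<Rightarrow> real \<Rightarrow> real"
  assumes open_B: "open B" and B_U: "B \<subseteq> U"
    and smooth_rho: "Ck_on 4 (spacetime_region J U \<phi>) (\<lambda>(t, x). \<rho> t x)"
    and smooth_Vf: "Ck_on 2 (spacetime_region J U \<phi>) (\<lambda>(t, x). V t x)"
    and open_A: "open A" and smooth_W: "Ck_on 4 A (\<lambda>(r, q). W r q)"
    and rho_pos: "\<forall>(t, x) \<in> spacetime_region J U \<phi>. \<rho> t x > 0"
    and in_domain: "\<forall>(t, x) \<in> spacetime_region J U \<phi>. (\<rho> t x, material_deriv u \<rho> t x) \<in> A"
    and legendre: "legendre_solution A W R"
    and mass_eq: "\<forall>(t, x) \<in> spacetime_region J B \<phi>. mass_equation \<rho> u t x"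
    and momentum_eq: "\<forall>(t, x) \<in> spacetime_region J B \<phi>. momentum_equation W V \<rho> u t x"
begin

abbreviation "rf \<equiv> case_prod \<rho>"
abbreviation "wqf \<equiv> case_prod (W_rhodot_along W \<rho> u)"
abbreviation "Wf \<equiv> case_prod (W_along W \<rho> u)"
abbreviation "Wrf \<equiv> case_prod (W_rho_along W \<rho> u)"
abbreviation "Vf \<equiv> case_prod V"

text \<open>The point of the domain of W reached along the motion; W and its derivatives along the
  flow are compositions with it.\<close>

definition state :: "event \<Rightarrow> real \<times> real" where "state p = (rf p, Dm vel rf p)"

lemma rf_differentiable: "p \<in> region \<Longrightarrow> rf differentiable (at p)"
  by (rule Ck_on_differentiable[OF smooth_rho]) auto

lemma material_deriv_eq:
  assumes "(t, x) \<in> region"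
  shows "material_deriv u \<rho> t x = Dm vel rf (t, x)"
  by (simp add: material_deriv_def dt_eq_pd[OF rf_differentiable[OF assms]] Dm_def inner_vec_def
      grad_eq_pd[OF rf_differentiable[OF assms]])

lemma state_in: "p \<in> region \<Longrightarrow> state p \<in> A"
  using in_domain by (cases p) (auto simp: state_def material_deriv_eq)

lemma W_differentiable: "p \<in> region \<Longrightarrow> case_prod W differentiable (at (state p))"
  using Ck_on_differentiable[OF smooth_W _ state_in] by simp

lemma along_eq:
  assumes "p \<in> region"
  shows "Wf p = case_prod W (state p)"
    and "Wrf p = pd (1, 0) (case_prod W) (state p)"
    and "wqf p = pd (0, 1) (case_prod W) (state p)"
    and "Wrf p = W_rho W (rf p) (Dm vel rf p)"
    and "wqf p = W_rhodot W (rf p) (Dm vel rf p)"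
proof -
  obtain t x where p: "p = (t, x)" by (cases p)
  note m = material_deriv_eq[OF assms[unfolded p]]
  show "Wf p = case_prod W (state p)" by (simp add: p W_along_def m state_def)
  show 1: "Wrf p = W_rho W (rf p) (Dm vel rf p)" by (simp add: p W_rho_along_def m)
  show 2: "wqf p = W_rhodot W (rf p) (Dm vel rf p)" by (simp add: p W_rhodot_along_def m)
  show "Wrf p = pd (1, 0) (case_prod W) (state p)"
    unfolding 1 state_def by (rule W_rho_eq_pd(1)[OF W_differentiable[OF assms, unfolded state_def]])
  show "wqf p = pd (0, 1) (case_prod W) (state p)"
    unfolding 2 state_def by (rule W_rho_eq_pd(2)[OF W_differentiable[OF assms, unfolded state_def]])
qed

lemma Ck_q0: "Ck_on 3 region (Dm vel rf)"
  using smooth_rho by (intro Ck_Dm) (simp_all add: Suc_numeral del: Ck_on.simps(2))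

lemma Ck_state: "Ck_on 3 region state"
proof -
  have "Ck_on 3 region rf" by (rule Ck_on_le[OF smooth_rho]) simp
  then show ?thesis
    unfolding state_def[abs_def] by (rule Ck_on_Pair[OF open_region _ Ck_q0])
qed

lemma Ck_state_compose: "Ck_on 3 A f \<Longrightarrow> Ck_on 3 region (\<lambda>p. f (state p))"
  by (rule Ck_on_compose[OF open_region open_A _ Ck_state]) (use state_in in blast)

lemma Ck_along: "Ck_on 3 region Wf" "Ck_on 3 region Wrf" "Ck_on 3 region wqf"
proof -
  have pW: "Ck_on 3 A (pd b (case_prod W))" if "b \<in> Basis" for b
    using smooth_W that by (intro Ck_on_pd) (simp_all add: Suc_numeral del: Ck_on.simps(2))
  have W: "Ck_on 3 A (case_prod W)" by (rule Ck_on_le[OF smooth_W]) simp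
  note c = Ck_on_cong_imp[OF open_region _ Ck_state_compose]
  show "Ck_on 3 region Wf" by (rule c[OF _ W]) (simp add: along_eq(1))
  show "Ck_on 3 region Wrf" by (rule c[OF _ pW]) (auto simp: along_eq(2) Basis_prod_def)
  show "Ck_on 3 region wqf" by (rule c[OF _ pW]) (auto simp: along_eq(3) Basis_prod_def)
qed

lemma Wf_chain:
  assumes p: "p \<in> region"
  shows "pd b Wf p = Wrf p * pd b rf p + wqf p * pd b (Dm vel rf) p"
proof -
  have q: "Dm vel rf differentiable (at p)" by (rule Ck_on_differentiable[OF Ck_q0 _ p]) simp
  have "(state has_derivative (\<lambda>h. (pd h rf p, pd h (Dm vel rf) p))) (at p)"
    unfolding state_def[abs_def]
    by (intro has_derivative_Pair pd_has_derivative rf_differentiable p q)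
  from diff_chain_at[OF this, of "case_prod W" "\<lambda>h. Wrf p * fst h + wqf p * snd h"]
    W_has_derivative[of W "rf p" "Dm vel rf p"] W_differentiable[OF p]
  have "((\<lambda>p. case_prod W (state p)) has_derivative
      (\<lambda>h. Wrf p * pd h rf p + wqf p * pd h (Dm vel rf) p)) (at p)"
    by (simp add: o_def state_def along_eq(4,5)[OF p])
  then have "(Wf has_derivative (\<lambda>h. Wrf p * pd h rf p + wqf p * pd h (Dm vel rf) p)) (at p)"
    by (rule has_derivative_transform_within_open[OF _ open_region p]) (simp add: along_eq(1))
  then show ?thesis by (rule pd_eqI)
qed

sublocale inertial_fluid region vel rf wqf Wf Wrf Vf
  by unfold_locales (use smooth_rho Ck_along smooth_Vf rho_pos Wf_chain in auto)

abbreviation "sigma_f \<equiv> case_prod (sigma W \<rho> u)"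
abbreviation "K_f \<equiv> case_prod (K_field W \<rho> u)"
abbreviation "energy_f \<equiv> (\<lambda>p. energy_tilde_rho W R (rf p) (sigma_f p) + Vf p - (norm (vel p))\<^sup>2 / 2)"

lemma sigma_eq: "sigma_f = sig"
  by (auto simp: sigma_def sig_def)

lemma K_eq:
  assumes "p \<in> region"
  shows "K_f p = Kf p"
proof -
  obtain t x where p: "p = (t, x)" by (cases p)
  have "sigma_f differentiable (at (t, x))"
    unfolding sigma_eq by (rule Ck_on_differentiable[OF Ck_sig _ assms[unfolded p]]) simp
  from grad_eq_pd[OF this] show ?thesis
    by (simp add: p K_field_def Kf_def vec_eq_iff sigma_eq)
qed

lemma energy_eq:
  assumes "p \<in> region"
  shows "energy_f p = Q p"
proof -
  have "state p \<in> A" "rf p > 0" using state_in r_pos assms by auto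
  then have "energy_tilde_rho W R (rf p) (sig p) = Wrf p + Dm vel rf p * wqf p / rf p"
    using energy_tilde_rho_eq[of W "rf p" "Dm vel rf p" A R] W_differentiable[OF assms] legendre
    by (simp add: state_def sig_def along_eq(4,5)[OF assms])
  then show ?thesis
    by (simp add: sigma_eq Q_def power2_norm_eq_inner inner_vec_def)
qed

lemma pressure_eq:
  assumes "p \<in> region"
  shows "case_prod (pressure W \<rho> u) p = prs p"
proof -
  obtain t x where p: "p = (t, x)" by (cases p)
  have wd: "wqf differentiable (at (t, x))"
    by (rule Ck_on_differentiable[OF Ck_along(3) _ assms[unfolded p]]) simp
  let ?z = "\<lambda>t y. W_rhodot_along W \<rho> u t y *\<^sub>R u t y"
  have z: "case_prod ?z = (\<lambda>p. wqf p *\<^sub>R vel p)" by (simp add: fun_eq_iff)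
  have "case_prod ?z differentiable (at (t, x))"
    unfolding z by (intro differentiable_scaleR wd Ck_on_differentiable[OF smooth_v] assms[unfolded p]) simp
  from divg_eq_dvg[OF this] dt_eq_pd[OF wd] show ?thesis
    by (simp add: p pressure_def delta_W_def prs_def del_def dvg_def z)
qed

lemma inertial_momentum:
  assumes pB: "(t, x) \<in> spacetime_region J B \<phi>"
  shows "pd et (\<lambda>p. rf p * vel p $ i) (t, x)
      + (\<Sum>j\<in>UNIV. pd (ex j) (\<lambda>p. rf p * (vel p $ j * vel p $ i)) (t, x)) + pd (ex i) prs (t, x)
      + rf (t, x) * pd (ex i) Vf (t, x) = 0"
proof -
  have p: "(t, x) \<in> region" using pB B_U by (auto simp: spacetime_region_def)
  note rd = rf_differentiable[OF p]
  have vd: "vel differentiable (at (t, x))" by (rule Ck_on_differentiable[OF smooth_v _ p]) simp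
  have Vd: "Vf differentiable (at (t, x))" by (rule Ck_on_differentiable[OF smooth_Vf _ p]) simp
  let ?m = "\<lambda>s y. \<rho> s y *\<^sub>R u s y"
  have m: "case_prod ?m = (\<lambda>p. rf p *\<^sub>R vel p)" by (simp add: fun_eq_iff)
  have md: "case_prod ?m differentiable (at (t, x))"
    unfolding m by (intro differentiable_scaleR rd vd)
  \<comment> \<open>The i-th column of the momentum flux, whose divergence is the i-th component of
    \<open>tensor_div\<close>; the pressure enters only its i-th entry.\<close>
  define z where "z s y = (\<rho> s y *\<^sub>R outer (u s y) (u s y) + mat (pressure W \<rho> u s y)) *v axis i 1" for s y
  have zc: "case_prod z p $ j = rf p * (vel p $ j * vel p $ i)
      + (if j = i then case_prod (pressure W \<rho> u) p else 0)" for p j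
    by (cases p) (auto simp: z_def matrix_vector_mult_basis column_def outer_def mat_def)
  have Ckr: "Ck_on 1 region rf" by (rule Ck_on_le[OF smooth_rho]) simp
  have Ckp: "Ck_on 1 region (case_prod (pressure W \<rho> u))"
    by (rule Ck_on_cong_imp[OF open_region _ Ck_on_le[OF Ck_prs]]) (auto simp: pressure_eq)
  have Ckm: "Ck_on 1 region (\<lambda>p. rf p * (vel p $ j * vel p $ i))" for j
    by (intro Ck_on_mult open_region Ckr Ck_v) simp_all
  have "Ck_on 1 region (case_prod z)"
  proof (rule Ck_on_vec[OF open_region])
    show "Ck_on 1 region (\<lambda>p. case_prod z p $ j)" for j
      unfolding zc using Ckm[of j] Ck_on_add[OF open_region Ckm[of j] Ckp]
      by (cases "j = i") (simp_all del: Ck_on.simps(2))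
  qed
  then have zd: "case_prod z differentiable (at (t, x))"
    by (rule Ck_on_differentiable[OF _ _ p]) simp
  have md': "(\<lambda>p. rf p * (vel p $ j * vel p $ i)) differentiable (at (t, x))" for j
    by (rule Ck_on_differentiable[OF Ckm _ p]) simp
  have pd': "case_prod (pressure W \<rho> u) differentiable (at (t, x))"
    by (rule Ck_on_differentiable[OF Ckp _ p]) simp
  have "pd (ex j) (\<lambda>p. case_prod z p $ j) (t, x) = pd (ex j) (\<lambda>p. rf p * (vel p $ j * vel p $ i)) (t, x)
      + (if j = i then pd (ex j) (case_prod (pressure W \<rho> u)) (t, x) else 0)" for j
    unfolding zc by (cases "j = i") (simp_all add: pd_add md' pd')
  then have "divg (z t) x = (\<Sum>j\<in>UNIV. pd (ex j) (\<lambda>p. rf p * (vel p $ j * vel p $ i)) (t, x))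
      + pd (ex i) (case_prod (pressure W \<rho> u)) (t, x)"
    by (simp add: divg_eq_dvg[OF zd] dvg_def sum.distrib)
  moreover have "pd (ex i) (case_prod (pressure W \<rho> u)) (t, x) = pd (ex i) prs (t, x)"
    by (rule pd_cong[OF open_region p pressure_eq pd'])
  moreover have "tensor_div (\<lambda>y. \<rho> t y *\<^sub>R outer (u t y) (u t y) + mat (pressure W \<rho> u t y)) x $ i
      = divg (z t) x"
    by (simp add: tensor_div_def z_def[abs_def])
  moreover have "dt ?m t x $ i = pd et (\<lambda>p. rf p * vel p $ i) (t, x)"
    unfolding dt_nth_eq_pd[OF md] m by simp
  moreover have "(dt ?m t x + tensor_div (\<lambda>y. \<rho> t y *\<^sub>R outer (u t y) (u t y)
      + mat (pressure W \<rho> u t y)) x + \<rho> t x *\<^sub>R grad (V t) x) $ i = 0"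
    using bspec[OF momentum_eq pB] by (simp only: momentum_equation_def case_prod_conv zero_index)
  ultimately show ?thesis
    by (simp add: grad_eq_pd[OF Vd])
qed

lemma inertial_mass:
  assumes pB: "(t, x) \<in> spacetime_region J B \<phi>"
  shows "pd et rf (t, x) + (\<Sum>j\<in>UNIV. pd (ex j) (\<lambda>p. rf p * vel p $ j) (t, x)) = 0"
proof -
  have p: "(t, x) \<in> region" using pB B_U by (auto simp: spacetime_region_def)
  have vd: "vel differentiable (at (t, x))" by (rule Ck_on_differentiable[OF smooth_v _ p]) simp
  let ?m = "\<lambda>s y. \<rho> s y *\<^sub>R u s y"
  have m: "case_prod ?m = (\<lambda>p. rf p *\<^sub>R vel p)" by (simp add: fun_eq_iff)
  have md: "case_prod ?m differentiable (at (t, x))"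
    unfolding m by (intro differentiable_scaleR rf_differentiable p vd)
  show ?thesis
    using mass_eq pB divg_eq_dvg[OF md] dt_eq_pd[OF rf_differentiable[OF p]]
    by (auto simp: mass_equation_def dvg_def m)
qed

sublocale inertial_motion region vel rf wqf Wf Wrf Vf "spacetime_region J B \<phi>"
proof
  show "open (spacetime_region J B \<phi>)" by (rule open_subregion[OF open_B B_U])
  show "spacetime_region J B \<phi> \<subseteq> region" using B_U by (auto simp: spacetime_region_def)
  show "pd et rf p + (\<Sum>j\<in>UNIV. pd (ex j) (\<lambda>p. rf p * vel p $ j) p) = 0" if "p \<in> spacetime_region J B \<phi>" for p
    using inertial_mass[of "fst p" "snd p"] that by simp
  show "pd et (\<lambda>p. rf p * vel p $ i) p + (\<Sum>j\<in>UNIV. pd (ex j) (\<lambda>p. rf p * (vel p $ j * vel p $ i)) p)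
      + pd (ex i) prs p + rf p * pd (ex i) Vf p = 0" if "p \<in> spacetime_region J B \<phi>" for p i
    using inertial_momentum[of "fst p" "snd p" i] that by simp
qed

abbreviation "regionB \<equiv> spacetime_region J B \<phi>"

text \<open>The two kinds of fields in the theorem, \<open>\<Omega>\<close> and \<open>E\<^sub>i\<close>, are solenoidal and frozen into the flow,
  and nothing else about them is used.\<close>

definition transported :: "(event \<Rightarrow> real^3) \<Rightarrow> bool" where
  "transported z \<longleftrightarrow> Ck_on 1 region z \<and> (\<forall>p\<in>region. dvg z p = 0) \<and> (\<forall>p\<in>regionB. frozen_at vel z p)"

lemma transported_Ef: "transported (Ef i)"
  unfolding transported_def using Ck_Ef dvg_Ef frozen_Ef T_S by blast

lemma transported_curl_K: "transported (axial (curl_form Kf))"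
  unfolding transported_def using Ck_curl_K dvg_axial_curl[OF Ck_Kvec] frozen_curl_K by blast

lemma Omega_eq:
  assumes "p \<in> region"
  shows "case_prod (Omega_field W \<rho> u) p = axial (curl_form Kf) p"
proof -
  obtain t x where p: "p = (t, x)" by (cases p)
  have CK: "Ck_on 2 region K_f"
    by (rule Ck_on_cong_imp[OF open_region _ Ck_Kvec]) (simp add: K_eq)
  have "K_f differentiable (at (t, x))"
    by (rule Ck_on_differentiable[OF CK _ assms[unfolded p]]) simp
  then have "case_prod (Omega_field W \<rho> u) p = axial (curl_form K_f) p"
    by (simp add: p Omega_field_def curl_eq_axial)
  moreover have "pd b (\<lambda>x. K_f x $ i) p = pd b (\<lambda>x. Kf x $ i) p" for b i
    by (rule pd_cong[OF open_region assms])
      (auto simp: K_eq intro!: Ck_on_differentiable[OF Ck_on_nth[OF open_region CK] _ assms])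
  ultimately show ?thesis by (simp add: axial_def curl_form_def)
qed

text \<open>Agreement is claimed only on the region of the flow, since the given fields are
  unconstrained outside it.\<close>

lemma transported_representative:
  assumes "Z = Omega_field W \<rho> u \<or> (\<exists>i. Z = E_field U \<phi> i)"
  obtains z where "transported z" "\<And>p. p \<in> region \<Longrightarrow> case_prod Z p = z p"
  using assms
proof
  assume "Z = Omega_field W \<rho> u"
  then show thesis using that[OF transported_curl_K] Omega_eq by blast
next
  assume "\<exists>i. Z = E_field U \<phi> i"
  then obtain i where "Z = E_field U \<phi> i" by blast
  then show thesis using that[OF transported_Ef, of i] E_field_eq by auto
qed

lemma helicity_conservation:
  assumes z: "transported z" and Z: "\<And>p. p \<in> region \<Longrightarrow> case_prod Z p = z p"
    and pB: "(t, x) \<in> regionB"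
  shows "dt (\<lambda>s y. K_field W \<rho> u s y \<bullet> Z s y) t x
    + divg (\<lambda>y. (K_field W \<rho> u t y \<bullet> Z t y) *\<^sub>R u t y
        + (energy_tilde_rho W R (\<rho> t y) (sigma W \<rho> u t y)
           + V t y - (norm (u t y))\<^sup>2 / 2) *\<^sub>R Z t y) x = 0"
proof -
  have p: "(t, x) \<in> region" using pB T_S by blast
  have Cz: "Ck_on 1 region z" using z by (simp only: transported_def)
  let ?h = "\<lambda>p. \<Sum>i\<in>UNIV. Kf p $ i * z p $ i"
  let ?hZ = "\<lambda>s y. K_field W \<rho> u s y \<bullet> Z s y"
  define fl where "fl s y = (K_field W \<rho> u s y \<bullet> Z s y) *\<^sub>R u s y
        + (energy_tilde_rho W R (\<rho> s y) (sigma W \<rho> u s y)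
           + V s y - (norm (u s y))\<^sup>2 / 2) *\<^sub>R Z s y" for s y
  have h_eq: "case_prod ?hZ q = ?h q" if "q \<in> region" for q
    using Z[OF that] K_eq[OF that] by (cases q) (simp add: inner_vec_def)
  have Ch: "Ck_on 1 region ?h"
    by (intro Ck_on_sum Ck_on_mult Ck_on_nth open_region Cz Ck_on_le[OF Ck_K]) simp
  have fl_eq: "case_prod fl q $ j = ?h q * vel q $ j + Q q * z q $ j" if "q \<in> region" for q j
    using Z[OF that] h_eq[OF that] energy_eq[OF that] by (cases q) (simp add: fl_def)
  have Cf: "Ck_on 1 region (\<lambda>p. ?h p * vel p $ j + Q p * z p $ j)" for j
    by (intro Ck_on_add Ck_on_mult Ck_on_nth open_region Cz Ch Ck_on_le[OF Ck_Q] Ck_v) simp_all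
  have Cfl: "Ck_on 1 region (\<lambda>p. case_prod fl p $ j)" for j
    by (rule Ck_on_cong_imp[OF open_region _ Cf]) (simp add: fl_eq)
  have d1: "?h differentiable (at (t, x))" by (rule Ck_on_differentiable[OF Ch _ p]) simp
  have d1': "case_prod ?hZ differentiable (at (t, x))"
    by (rule Ck_on_differentiable[OF Ck_on_cong_imp[OF open_region _ Ch] _ p]) (simp_all add: h_eq)
  have d2: "case_prod fl differentiable (at (t, x))"
    by (rule Ck_on_differentiable[OF Ck_on_vec[OF open_region Cfl] _ p]) simp
  have d3: "(\<lambda>p. case_prod fl p $ j) differentiable (at (t, x))" for j
    by (rule Ck_on_differentiable[OF Cfl _ p]) simp
  have "dt ?hZ t x = pd et ?h (t, x)"
    unfolding dt_eq_pd[OF d1'] by (rule pd_cong[OF open_region p h_eq d1'])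
  moreover have "divg (fl t) x = (\<Sum>j\<in>UNIV. pd (ex j) (\<lambda>p. ?h p * vel p $ j + Q p * z p $ j) (t, x))"
    unfolding divg_eq_dvg[OF d2] dvg_def
    by (intro sum.cong refl pd_cong[OF open_region p fl_eq d3])
  moreover have "(\<lambda>x. z x $ i) differentiable (at (t, x))" for i
    by (rule Ck_on_differentiable[OF Ck_on_nth[OF open_region Cz] _ p]) simp
  ultimately show ?thesis
    using helicity_law[OF pB, of z] z p pB by (simp add: transported_def fl_def[abs_def])
qed

end

section \<open>Normals and integrals over moving domains\<close>

lemma set_integrable_bounded_continuous:
  fixes f :: "'a::euclidean_space \<Rightarrow> real"
  assumes "open D" "bounded D" "continuous_on (closure D) f"
  shows "set_integrable lborel D f"
proof (rule set_integrable_subset)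
  show "set_integrable lborel (closure D) f"
    unfolding set_integrable_def
    by (rule borel_integrable_compact) (use assms in \<open>auto simp: compact_closure\<close>)
qed (use assms closure_subset in auto)

text \<open>The lift to \<open>real^1\<close> fits f to a change of variables theorem for
  vector-valued functions; both integrability hypotheses carry the result back to Lebesgue
  integrals.\<close>

lemma change_of_variables_lborel:
  fixes f :: "real^3 \<Rightarrow> real" and g :: "real^3 \<Rightarrow> real^3"
  assumes D: "open D"
    and g: "\<And>x. x \<in> D \<Longrightarrow> (g has_derivative (\<lambda>h. M x *v h)) (at x)" and inj: "inj_on g D"
    and f: "set_integrable lborel (g ` D) f"
    and fg: "set_integrable lborel D (\<lambda>x. \<bar>det (M x)\<bar> * f (g x))"
  shows "(LINT x:g ` D|lborel. f x) = (LINT x:D|lborel. \<bar>det (M x)\<bar> * f (g x))"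
proof -
  let ?F = "\<lambda>x. vec (f x) :: real^1"
  have "integrable lebesgue (\<lambda>x. indicator (g ` D) x *\<^sub>R f x)"
    using f unfolding set_integrable_def
    by (subst integrable_completion) (auto dest: borel_measurable_integrable)
  then have "f absolutely_integrable_on (g ` D)" by (simp add: set_integrable_def)
  then have "?F absolutely_integrable_on (g ` D)"
    by (simp add: absolutely_integrable_on_1_iff)
  then have "integral D (\<lambda>x. \<bar>det (matrix (\<lambda>h. M x *v h))\<bar> *\<^sub>R ?F (g x)) = integral (g ` D) ?F"
    using has_absolute_integral_change_of_variables[of D g "\<lambda>x h. M x *v h" ?F "integral (g ` D) ?F"]
      D g inj by (auto intro: has_derivative_at_withinI)
  then have "integral D (\<lambda>x. \<bar>det (M x)\<bar> * f (g x)) = integral (g ` D) f"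
    by (simp add: integral_on_1_eq vec_eq_iff)
  then show ?thesis
    using set_borel_integral_eq_integral(2)[OF f] set_borel_integral_eq_integral(2)[OF fg] by simp
qed

text \<open>A normal is a covector, so it pulls back by the transposed derivative. Differentiability
  of g at X alone carries one family of cones into the other.\<close>

lemma outer_unit_normal_pullback:
  assumes U: "open U" "D \<subseteq> U" "X \<in> U" and inj: "inj_on g U"
    and g: "(g has_derivative (\<lambda>h. M *v h)) (at X)" and M: "M ** N = mat 1"
    and X: "X \<in> frontier D" and n: "outer_unit_normal (g ` D) (g X) n"
  defines "m \<equiv> transpose M *v n"
  shows "m \<noteq> 0" and "outer_unit_normal D X (m /\<^sub>R norm m)"
proof -
  have n1: "norm n = 1" using n by (simp add: outer_unit_normal_def)
  have "transpose N *v m = transpose (M ** N) *v n"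
    unfolding m_def matrix_transpose_mul matrix_vector_mul_assoc ..
  then have "transpose N *v m = n" by (simp only: M transpose_mat matrix_vector_mul_lid)
  then show m0: "m \<noteq> 0" using n1 by auto
  define c where "c = norm m"
  have c: "c > 0" using m0 by (simp add: c_def)
  obtain C where C: "C > 0" "\<And>h. norm (M *v h) \<le> C * norm h"
    using bounded_linear.pos_bounded[OF has_derivative_bounded_linear[OF g]] by (auto simp: mult.commute)
  have nM: "n \<bullet> (M *v h) = m \<bullet> h" for h
    unfolding m_def by (simp add: dot_lmul_matrix[symmetric])
  \<comment> \<open>Injectivity keeps g x away from g X, as the punctured neighbourhood
    requires.\<close>
  have gX: "filterlim g (at (g X)) (at X)"
  proof (rule filterlim_atI)
    show "(g \<longlongrightarrow> g X) (at X)"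
      using has_derivative_continuous[OF g] by (simp add: continuous_within)
    have "eventually (\<lambda>x. x \<in> U) (at X)" using U by (simp add: eventually_at_in_open')
    moreover have "eventually (\<lambda>x. x \<noteq> X) (at X)" by (simp add: eventually_neq_at_within)
    ultimately show "eventually (\<lambda>x. g x \<noteq> g X) (at X)"
      by eventually_elim (use inj U in \<open>auto dest: inj_onD\<close>)
  qed
  have cone: "eventually (\<lambda>x. ((m /\<^sub>R c) \<bullet> (x - X) < - e * norm (x - X) \<longrightarrow> x \<in> D) \<and>
      ((m /\<^sub>R c) \<bullet> (x - X) > e * norm (x - X) \<longrightarrow> x \<notin> D)) (at X)" if e: "e > 0" for e
  proof -
    \<comment> \<open>The margin e * c * |x - X| is split in two: one half pays for the
      linearization error, the other for e' * |g x - g X|, which is at most \<open>\<eta>\<close> *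
      |x - X| because |g x - g X| is at most (C + \<open>\<eta>\<close>) * |x - X|.\<close>
    define \<eta> where "\<eta> = e * c / 2"
    define e' where "e' = \<eta> / (C + \<eta>)"
    have \<eta>: "\<eta> > 0" using e c by (simp add: \<eta>_def)
    have e': "e' > 0" using \<eta> C by (simp add: e'_def)
    have "\<exists>d>0. \<forall>y. norm (y - X) < d \<longrightarrow> norm (g y - g X - M *v (y - X)) \<le> \<eta> * norm (y - X)"
      using g \<eta> unfolding has_derivative_at_alt by blast
    then obtain d where d: "d > 0"
      "\<And>y. norm (y - X) < d \<Longrightarrow> norm (g y - g X - M *v (y - X)) \<le> \<eta> * norm (y - X)" by blast
    have 1: "eventually (\<lambda>x. norm (x - X) < d) (at X)"
      using d(1) by (auto simp: eventually_at dist_norm)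
    have 2: "eventually (\<lambda>x. x \<in> U) (at X)" using U by (simp add: eventually_at_in_open')
    have "eventually (\<lambda>y. (n \<bullet> (y - g X) < - e' * norm (y - g X) \<longrightarrow> y \<in> g ` D) \<and>
        (n \<bullet> (y - g X) > e' * norm (y - g X) \<longrightarrow> y \<notin> g ` D)) (at (g X))"
      using n e' unfolding outer_unit_normal_def by blast
    from eventually_compose_filterlim[OF this gX] 1 2
    show ?thesis
    proof eventually_elim
      case (elim x)
      let ?r = "g x - g X - M *v (x - X)"
      have r: "norm ?r \<le> \<eta> * norm (x - X)" using d(2) elim by blast
      have "\<bar>n \<bullet> ?r\<bar> \<le> norm ?r" using Cauchy_Schwarz_ineq2[of n ?r] n1 by simp
      then have nr: "\<bar>n \<bullet> (g x - g X) - m \<bullet> (x - X)\<bar> \<le> \<eta> * norm (x - X)"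
        using r unfolding inner_diff_right[of n "g x - g X"] nM by linarith
      have "norm (g x - g X) \<le> norm ?r + norm (M *v (x - X))"
        using norm_triangle_ineq[of ?r "M *v (x - X)"] by simp
      also have "\<dots> \<le> (C + \<eta>) * norm (x - X)"
        using r C(2)[of "x - X"] by (simp add: algebra_simps)
      finally have "e' * norm (g x - g X) \<le> e' * ((C + \<eta>) * norm (x - X))"
        using e' by (intro mult_left_mono) auto
      moreover have "e' * (C + \<eta>) = \<eta>" using \<eta> C(1) by (simp add: e'_def)
      ultimately have gl: "e' * norm (g x - g X) \<le> \<eta> * norm (x - X)"
        by (simp only: mult.assoc[symmetric])
      have mem: "x \<in> D" if "g x \<in> g ` D"
        using that inj U elim by (auto dest: inj_onD)
      have mc: "(m /\<^sub>R c) \<bullet> (x - X) = m \<bullet> (x - X) / c" by (simp add: divide_inverse mult.commute)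
      have ec: "e * norm (x - X) * c = 2 * \<eta> * norm (x - X)" by (simp add: \<eta>_def)
      show ?case
      proof (intro conjI impI)
        assume "(m /\<^sub>R c) \<bullet> (x - X) < - e * norm (x - X)"
        then have "m \<bullet> (x - X) < - (2 * \<eta> * norm (x - X))"
          using ec unfolding mc pos_divide_less_eq[OF c] by linarith
        then have "n \<bullet> (g x - g X) < - e' * norm (g x - g X)" using nr gl by linarith
        then show "x \<in> D" using elim mem by blast
      next
        assume "(m /\<^sub>R c) \<bullet> (x - X) > e * norm (x - X)"
        then have "m \<bullet> (x - X) > 2 * \<eta> * norm (x - X)"
          using ec unfolding mc pos_less_divide_eq[OF c] by linarith
        then have "n \<bullet> (g x - g X) > e' * norm (g x - g X)" using nr gl by linarith
        then show "x \<notin> D" using elim by blast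
      qed
    qed
  qed
  show "outer_unit_normal D X (m /\<^sub>R norm m)"
    unfolding outer_unit_normal_def using X m0 cone by (auto simp: c_def)
qed

text \<open>Away from zero the sign is locally constant, so the modulus is smooth there. This is
  applied to Jacobian determinants of either sign.\<close>

lemma Ck_on_sgn: "Ck_on k {x::real. x \<noteq> 0} sgn" and Ck_on_abs: "Ck_on k {x::real. x \<noteq> 0} abs"
proof -
  have o: "open {x::real. x \<noteq> 0}" by (simp add: open_Collect_neq)
  have d: "(f has_derivative f') (at x)" if "x \<noteq> 0" "(g has_derivative f') (at x)"
    "\<And>y. sgn y = sgn x \<Longrightarrow> g y = f y" for x :: real and f g f' :: "real \<Rightarrow> real"
  proof (cases "x > 0")
    case True
    then show ?thesis
      using has_derivative_transform_within_open[OF that(2), of "{0<..}" f] that(3) by auto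
  next
    case False
    then show ?thesis
      using has_derivative_transform_within_open[OF that(2), of "{..<0}" f] that(1,3) by auto
  qed
  have s: "(sgn has_derivative (\<lambda>h. 0)) (at x)" if "x \<noteq> 0" for x :: real
    by (rule d[OF that, of "\<lambda>y. sgn x"]) auto
  have a: "(abs has_derivative (\<lambda>h. sgn x * h)) (at x)" if "x \<noteq> 0" for x :: real
    by (rule d[OF that, of "\<lambda>y. sgn x * y"])
      (auto intro!: derivative_eq_intros simp: sgn_if split: if_splits)
  show sg: "Ck_on k {x::real. x \<noteq> 0} sgn" for k
  proof (cases k)
    case 0
    then show ?thesis
      using has_derivative_continuous[OF s] by (auto intro!: continuous_at_imp_continuous_on)
  next
    case (Suc j)
    have "Ck_on (Suc j) {x::real. x \<noteq> 0} sgn"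
      by (rule Ck_on_SucI[OF o s]) (simp, rule Ck_on_const[OF o])
    then show ?thesis using Suc by simp
  qed
  show "Ck_on k {x::real. x \<noteq> 0} abs"
  proof (rule Ck_on_le)
    show "Ck_on (Suc k) {x::real. x \<noteq> 0} abs"
      by (rule Ck_on_SucI[OF o a]) (auto intro!: Ck_on_mult o sg)
  qed simp
qed

section \<open>Jacobians and integrals over the moving domain\<close>

context fluid_kinematics
begin

lemma det_G_nonzero: "p \<in> region \<Longrightarrow> det (G p) \<noteq> 0"
  using det_G det_Fm[OF Theta_in] by simp

lemma Ck_G: "Ck_on 1 region (\<lambda>p. G p $ a $ j)"
  unfolding G_def vec_lambda_beta by (intro Ck_on_pd_2 smooth_Y ex_Basis)

lemma Ck_det_G: "Ck_on 1 region (\<lambda>p. det (G p))"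
  by (intro Ck_det3 open_region Ck_G)

lemma Ck_abs_det_G: "Ck_on 1 region (\<lambda>p. \<bar>det (G p)\<bar>)"
  by (rule Ck_on_compose[OF open_region _ _ Ck_det_G Ck_on_abs])
    (use det_G_nonzero in \<open>auto simp: open_Collect_neq\<close>)

text \<open>Near p the modulus is the determinant times the sign it has at p.\<close>

lemma Dm_abs_det_G:
  assumes p: "p \<in> region"
  shows "Dm vel (\<lambda>x. \<bar>det (G x)\<bar>) p = - \<bar>det (G p)\<bar> * dvg vel p"
proof -
  let ?s = "sgn (det (G p))"
  have d: "(\<lambda>x. det (G x)) differentiable (at p)" by (rule det_G_differentiable[OF p])
  have "isCont (\<lambda>x. det (G x)) p" using d differentiable_imp_continuous_within by blast
  then have "((\<lambda>x. det (G x)) \<longlongrightarrow> det (G p)) (nhds p)"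
    using tendsto_at_iff_tendsto_nhds[of "\<lambda>x. det (G x)" p] by (simp add: isCont_def)
  then have lim: "((\<lambda>x. ?s * det (G x)) \<longlongrightarrow> ?s * det (G p)) (nhds p)"
    by (rule tendsto_mult[OF tendsto_const])
  have "eventually (\<lambda>x. ?s * det (G x) > 0) (nhds p)"
    by (rule order_tendstoD(1)[OF lim]) (use det_G_nonzero[OF p] in \<open>auto simp: sgn_if\<close>)
  then obtain N where N: "open N" "p \<in> N" "\<And>x. x \<in> N \<Longrightarrow> ?s * det (G x) > 0"
    by (auto simp: eventually_nhds)
  have e: "?s * det (G x) = \<bar>det (G x)\<bar>" if "x \<in> N" for x
    using N(3)[OF that] by (auto simp: sgn_if split: if_splits)
  have "Dm vel (\<lambda>x. ?s * det (G x)) p = Dm vel (\<lambda>x. \<bar>det (G x)\<bar>) p"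
    by (rule Dm_cong[OF N(1,2) e]) (auto intro!: differentiable_mult d)
  moreover have "Dm vel (\<lambda>x. ?s * det (G x)) p = ?s * Dm vel (\<lambda>x. det (G x)) p"
    by (subst Dm_mult) (auto intro: d)
  ultimately show ?thesis
    unfolding Dm_det_G[OF p] e[OF N(2), symmetric] by (simp add: mult.assoc)
qed

lemma Psi_slice_continuous: "t \<in> J \<Longrightarrow> C \<subseteq> U \<Longrightarrow> continuous_on C (\<lambda>X. \<Psi> (t, X))"
  by (rule continuous_on_compose2[OF Psi_continuous]) (auto intro!: continuous_intros)

lemma region_slice_continuous:
  fixes g :: "event \<Rightarrow> 'b::topological_space"
  assumes "continuous_on region g" "t \<in> J" "C \<subseteq> U"
  shows "continuous_on C (\<lambda>X. g (\<Psi> (t, X)))"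
  by (rule continuous_on_compose2[OF assms(1) Psi_slice_continuous[OF assms(2,3)]])
    (use assms Psi_in in auto)

lemma phi_continuous: "t \<in> J \<Longrightarrow> C \<subseteq> U \<Longrightarrow> continuous_on C (\<phi> t)"
  using continuous_on_snd[OF Psi_slice_continuous] by (simp add: \<Psi>_def)

lemma closure_phi_image:
  assumes "t \<in> J" "bounded D" "closure D \<subseteq> U"
  shows "closure (\<phi> t ` D) = \<phi> t ` closure D"
proof
  have c: "continuous_on (closure D) (\<phi> t)" by (rule phi_continuous[OF assms(1,3)])
  have "compact (\<phi> t ` closure D)"
    by (intro compact_continuous_image c) (use assms in \<open>simp add: compact_closure\<close>)
  then show "closure (\<phi> t ` D) \<subseteq> \<phi> t ` closure D"
    by (intro closure_minimal image_mono closure_subset compact_imp_closed)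
  show "\<phi> t ` closure D \<subseteq> closure (\<phi> t ` D)"
    by (intro image_closure_subset c closed_closure closure_subset)
qed

lemma frontier_phi_image:
  assumes t: "t \<in> J" and D: "open D" "bounded D" "closure D \<subseteq> U"
  shows "frontier (\<phi> t ` D) = \<phi> t ` frontier D"
proof -
  have "D \<subseteq> U" using D closure_subset by blast
  then have "interior (\<phi> t ` D) = \<phi> t ` D" "interior D = D"
    using open_phi_image[OF t D(1)] D by (simp_all add: interior_open)
  moreover have "\<phi> t ` (closure D - D) = \<phi> t ` closure D - \<phi> t ` D"
    by (rule inj_on_image_set_diff[OF inj_phi[OF t]]) (use D \<open>D \<subseteq> U\<close> in auto)
  ultimately show ?thesis
    by (simp add: frontier_def closure_phi_image[OF t D(2,3)])
qed

text \<open>The Jacobian factor is written with \<open>G\<close>, a field on space-time, so that the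
  pulled-back integrand can be differentiated by \<open>Dm\<close>.\<close>

lemma image_integral:
  assumes t: "t \<in> J" and D: "open D" "bounded D" "closure D \<subseteq> U"
    and g: "continuous_on region g"
  shows "(LINT x:\<phi> t ` D|lborel. g (t, x))
    = (LINT X:D|lborel. g (\<Psi> (t, X)) / \<bar>det (G (\<Psi> (t, X)))\<bar>)"
proof -
  have DU: "D \<subseteq> U" using D closure_subset by blast
  have cl: "closure (\<phi> t ` D) = \<phi> t ` closure D" by (rule closure_phi_image[OF t D(2,3)])
  have e: "g (\<Psi> (t, X)) / \<bar>det (G (\<Psi> (t, X)))\<bar> = \<bar>det (Fm (t, X))\<bar> * g (t, \<phi> t X)" if "X \<in> U" for X
  proof -
    have "(t, X) \<in> J \<times> U" using that t by simp
    from det_G[OF Psi_in[OF this]] Theta_Psi[OF this]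
    have "det (G (\<Psi> (t, X))) = 1 / det (Fm (t, X))" by simp
    moreover have "\<Psi> (t, X) = (t, \<phi> t X)" by (simp add: \<Psi>_def)
    ultimately show ?thesis by (simp add: abs_divide mult.commute)
  qed
  have gd: "continuous_on region (\<lambda>p. g p / \<bar>det (G p)\<bar>)"
    using det_G_nonzero
    by (intro continuous_on_divide g Ck_on_continuous[OF Ck_abs_det_G]) auto
  have "set_integrable lborel D (\<lambda>X. g (\<Psi> (t, X)) / \<bar>det (G (\<Psi> (t, X)))\<bar>)"
    by (rule set_integrable_bounded_continuous[OF D(1,2) region_slice_continuous[OF gd t D(3)]])
  moreover have "set_integrable lborel (\<phi> t ` D) (\<lambda>x. g (t, x))"
  proof (rule set_integrable_bounded_continuous[OF open_phi_image[OF t D(1) DU]])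
    show "bounded (\<phi> t ` D)"
      using compact_continuous_image[OF phi_continuous[OF t D(3)]] D(2) closure_subset
      by (metis bounded_subset compact_closure compact_imp_bounded image_mono)
    show "continuous_on (closure (\<phi> t ` D)) (\<lambda>x. g (t, x))"
      by (rule continuous_on_compose2[OF g])
        (use cl t D in \<open>auto intro!: continuous_intros simp: spacetime_region_def\<close>)
  qed
  moreover have "set_integrable lborel D (\<lambda>X. g (\<Psi> (t, X)) / \<bar>det (G (\<Psi> (t, X)))\<bar>)
      \<longleftrightarrow> set_integrable lborel D (\<lambda>X. \<bar>det (Fm (t, X))\<bar> * g (t, \<phi> t X))"
    by (rule set_integrable_cong) (use e DU in auto)
  ultimately have "(LINT x:\<phi> t ` D|lborel. g (t, x)) = (LINT X:D|lborel. \<bar>det (Fm (t, X))\<bar> * g (t, \<phi> t X))"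
    using phi_space_derivative(1)[of t] t DU
    by (intro change_of_variables_lborel[OF D(1) _ inj_on_subset[OF inj_phi[OF t] DU]]) auto
  also have "\<dots> = (LINT X:D|lborel. g (\<Psi> (t, X)) / \<bar>det (G (\<Psi> (t, X)))\<bar>)"
    using e DU D(1) by (intro set_lebesgue_integral_cong) auto
  finally show ?thesis .
qed

text \<open>Differentiation under the integral by dominated convergence: on the fixed bounded domain
  the difference quotients are bounded by a maximum of the material derivative.\<close>

lemma integral_time_derivative:
  assumes t: "t \<in> J" and D: "open D" "bounded D" "closure D \<subseteq> U" and f: "Ck_on 1 region f"
  shows "((\<lambda>s. LINT X:D|lborel. f (\<Psi> (s, X))) has_real_derivative
    (LINT X:D|lborel. Dm vel f (\<Psi> (t, X)))) (at t)"
proof -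
  let ?I = "\<lambda>s. LINT X:D|lborel. f (\<Psi> (s, X))" and ?f' = "\<lambda>s X. Dm vel f (\<Psi> (s, X))"
  have DU: "D \<subseteq> U" using D closure_subset by blast
  have fd: "f differentiable (at p)" if "p \<in> region" for p
    by (rule Ck_on_differentiable[OF f _ that]) simp
  have cf: "continuous_on region f" by (rule Ck_on_continuous[OF f])
  have "Ck_on 0 region (Dm vel f)" by (rule Ck_Dm) (use f in simp_all)
  then have cf': "continuous_on region (Dm vel f)" by simp
  \<comment> \<open>A compact time interval inside \<open>J\<close> makes the set of times and
    labels compact and yields one bound M for all particles.\<close>
  obtain \<delta> where \<delta>: "\<delta> > 0" "cball t \<delta> \<subseteq> J"
    using open_J t open_contains_cball by blast
  have "compact (cball t \<delta> \<times> closure D)"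
    using D(2) by (intro compact_Times) (auto simp: compact_closure)
  moreover have "continuous_on (cball t \<delta> \<times> closure D) (\<lambda>p. Dm vel f (\<Psi> p))"
  proof (rule continuous_on_compose2[OF cf'])
    show "continuous_on (cball t \<delta> \<times> closure D) \<Psi>"
      using \<delta> D by (intro continuous_on_subset[OF Psi_continuous]) auto
    show "\<Psi> ` (cball t \<delta> \<times> closure D) \<subseteq> region" using \<delta> D Psi_in by blast
  qed
  ultimately have "bounded ((\<lambda>p. Dm vel f (\<Psi> p)) ` (cball t \<delta> \<times> closure D))"
    by (intro compact_imp_bounded compact_continuous_image)
  then obtain M where M: "\<And>s X. s \<in> cball t \<delta> \<Longrightarrow> X \<in> closure D \<Longrightarrow> \<bar>?f' s X\<bar> \<le> M"
    unfolding bounded_iff by (force simp del: mem_cball)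
  have path: "((\<lambda>s. f (\<Psi> (s, X))) has_real_derivative ?f' s X) (at s)" if "s \<in> J" "X \<in> U" for s X
    using that by (intro path_derivative fd Psi_in) auto
  have lip: "\<bar>f (\<Psi> (s, X)) - f (\<Psi> (t, X))\<bar> \<le> M * \<bar>s - t\<bar>" if "s \<in> cball t \<delta>" "X \<in> D" for s X
  proof -
    have X: "X \<in> closure D" "X \<in> U" using that DU closure_subset by auto
    have "norm (f (\<Psi> (s, X)) - f (\<Psi> (t, X))) \<le> M * norm (s - t)"
      by (rule field_differentiable_bound[of "cball t \<delta>" _ "\<lambda>s. ?f' s X"])
        (use \<delta> that X path M in \<open>auto intro: has_field_derivative_at_within simp del: mem_cball\<close>)
    then show ?thesis by simp
  qed
  have int: "set_integrable lborel D (\<lambda>X. f (\<Psi> (s, X)))" if "s \<in> J" for s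
    by (rule set_integrable_bounded_continuous[OF D(1,2) region_slice_continuous[OF cf that D(3)]])
  have int': "set_integrable lborel D (\<lambda>X. ?f' t X)"
    by (rule set_integrable_bounded_continuous[OF D(1,2) region_slice_continuous[OF cf' t D(3)]])
  have "((\<lambda>s. (?I s - ?I t) / (s - t)) \<longlongrightarrow> (LINT X:D|lborel. ?f' t X)) (at t within cball t \<delta>)"
    unfolding tendsto_at_iff_sequentially
  proof (intro allI impI)
    fix s :: "nat \<Rightarrow> real"
    assume s: "\<forall>i. s i \<in> cball t \<delta> - {t}" and lim: "s \<longlonglongrightarrow> t"
    have sJ: "s i \<in> J" for i using s \<delta> by blast
    have st: "s i - t \<noteq> 0" for i using s by (metis DiffE eq_iff_diff_eq_0 singletonI)
    let ?q = "\<lambda>i X. indicator D X *\<^sub>R ((f (\<Psi> (s i, X)) - f (\<Psi> (t, X))) / (s i - t))"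
    have "(\<lambda>i. LINT X|lborel. ?q i X) \<longlonglongrightarrow> (LINT X|lborel. indicator D X *\<^sub>R ?f' t X)"
    proof (rule integral_dominated_convergence[where w = "\<lambda>X. indicator D X * M"])
      show "(\<lambda>X. indicator D X *\<^sub>R ?f' t X) \<in> borel_measurable lborel"
        using int' unfolding set_integrable_def by (rule borel_measurable_integrable)
      show "?q i \<in> borel_measurable lborel" for i
        using integrable_divide[OF set_integral_diff(1)[OF int[OF sJ[of i]] int[OF t],
              unfolded set_integrable_def], of "s i - t"]
        by (intro borel_measurable_integrable) simp
      show "integrable lborel (\<lambda>X. indicator D X * M)"
        using D emeasure_bounded_finite[OF D(2)] by (auto intro!: integrable_mult_left)
      show "AE X in lborel. (\<lambda>i. ?q i X) \<longlonglongrightarrow> indicator D X *\<^sub>R ?f' t X"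
      proof (rule AE_I2)
        fix X :: "real^3"
        show "(\<lambda>i. ?q i X) \<longlonglongrightarrow> indicator D X *\<^sub>R ?f' t X"
        proof (cases "X \<in> D")
          case True
          then have "((\<lambda>r. (f (\<Psi> (r, X)) - f (\<Psi> (t, X))) / (r - t)) \<longlongrightarrow> ?f' t X) (at t)"
            using path[OF t] DU by (auto simp: has_field_derivative_iff)
          then have "(\<lambda>i. (f (\<Psi> (s i, X)) - f (\<Psi> (t, X))) / (s i - t)) \<longlonglongrightarrow> ?f' t X"
            using s lim unfolding tendsto_at_iff_sequentially by (auto simp: o_def)
          then show ?thesis using True by simp
        qed simp
      qed
      show "AE X in lborel. norm (?q i X) \<le> indicator D X * M" for i
      proof (rule AE_I2)
        fix X :: "real^3"
        show "norm (?q i X) \<le> indicator D X * M"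
          using lip[of "s i" X] s st[of i] by (cases "X \<in> D") (auto simp: pos_divide_le_eq abs_divide)
      qed
    qed
    moreover have "(LINT X|lborel. ?q i X) = (?I (s i) - ?I t) / (s i - t)" for i
    proof -
      have "(LINT X:D|lborel. (f (\<Psi> (s i, X)) - f (\<Psi> (t, X))) / (s i - t))
          = (LINT X:D|lborel. f (\<Psi> (s i, X)) - f (\<Psi> (t, X))) / (s i - t)" by simp
      then show ?thesis
        unfolding set_integral_diff(2)[OF int[OF sJ[of i]] int[OF t]]
        by (simp only: set_lebesgue_integral_def)
    qed
    ultimately show "((\<lambda>s. (?I s - ?I t) / (s - t)) \<circ> s) \<longlonglongrightarrow> (LINT X:D|lborel. ?f' t X)"
      by (simp only: o_def set_lebesgue_integral_def)
  qed
  moreover have "at t within cball t \<delta> = at t"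
    using \<delta>(1) by (intro at_within_interior) simp
  ultimately show ?thesis by (simp add: has_field_derivative_iff)
qed

lemma constant_on_J:
  fixes f :: "real \<Rightarrow> real"
  assumes "\<And>t. t \<in> J \<Longrightarrow> (f has_real_derivative 0) (at t)" "s \<in> J" "t \<in> J"
  shows "f s = f t"
proof -
  have "convex J" using interval_J by (simp add: is_interval_convex_1)
  then obtain c where "\<forall>x\<in>J. f x = c"
    using has_field_derivative_zero_constant[of J f] assms(1)
    by (metis has_field_derivative_at_within)
  then show ?thesis using assms by simp
qed

end

section \<open>Tangency and helicity\<close>

context inertial_fluid_motion
begin

lemma transported_differentiable:
  assumes "transported z" "p \<in> region"
  shows "(\<lambda>x. z x $ i) differentiable (at p)"
  by (rule Ck_on_differentiable[of 1 region])
    (use assms in \<open>auto intro!: Ck_on_nth open_region simp: transported_def simp del: One_nat_def\<close>)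

lemma Ck_zeta:
  assumes "transported z"
  shows "Ck_on 1 region (zeta z a)"
  unfolding zeta_def[abs_def] using assms
  by (intro Ck_on_divide Ck_on_sum Ck_on_mult Ck_on_nth open_region Ck_G Ck_det_G det_G_nonzero)
    (simp_all only: transported_def)

lemma zeta_constant:
  assumes z: "transported z" and D: "D \<subseteq> B" "closure D \<subseteq> U"
    and st: "s \<in> J" "t \<in> J" and X: "X \<in> closure D"
  shows "zeta z a (\<Psi> (t, X)) = zeta z a (\<Psi> (s, X))"
proof -
  have 1: "zeta z a (\<Psi> (t, X)) = zeta z a (\<Psi> (s, X))" if "X \<in> D" for X
  proof (rule constant_on_J[OF _ st(2,1)])
    fix r assume r: "r \<in> J"
    have XU: "(r, X) \<in> J \<times> U" and XB: "\<Psi> (r, X) \<in> regionB"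
      using that D B_U r by (auto simp: \<Psi>_def spacetime_region_def)
    have "zeta z a differentiable (at (\<Psi> (r, X)))"
      by (rule Ck_on_differentiable[OF Ck_zeta[OF z] _ Psi_in[OF XU]]) simp
    moreover have "Dm vel (zeta z a) (\<Psi> (r, X)) = 0"
      using z XB Psi_in[OF XU]
      by (intro Dm_zeta transported_differentiable det_G_nonzero) (auto simp: transported_def)
    ultimately show "((\<lambda>s. zeta z a (\<Psi> (s, X))) has_real_derivative 0) (at r)"
      using path_derivative[OF XU] by metis
  qed
  \<comment> \<open>A boundary point of D may lie outside B, where no equation is imposed; constancy
    reaches it from D by continuity.\<close>
  have "zeta z a (\<Psi> (t, X)) - zeta z a (\<Psi> (s, X)) = 0"
    by (rule continuous_constant_on_closure[OF _ _ X])
      (use 1 in \<open>auto intro!: continuous_on_diff region_slice_continuous st D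
        Ck_on_continuous[OF Ck_zeta[OF z]]\<close>)
  then show ?thesis by simp
qed

lemma G_mult_field:
  assumes "p \<in> region"
  shows "G p *v z p = det (G p) *\<^sub>R (\<chi> a. zeta z a p)"
  using det_G_nonzero[OF assms] by (simp add: vec_eq_iff matrix_vector_mult_def zeta_def)

text \<open>A normal at time t is pulled back to the reference domain and then carried to time s. At
  both times the scalar product of field and normal is a nonzero multiple of the same pairing of
  \<open>\<zeta>\<close> with m.\<close>

lemma tangent_transported:
  assumes z: "transported z" and Z: "\<And>p. p \<in> region \<Longrightarrow> case_prod Z p = z p"
    and D: "open D" "bounded D" "D \<subseteq> B" "closure D \<subseteq> U" and st: "s \<in> J" "t \<in> J"
    and tan: "tangent_to_boundary (\<phi> s ` D) (Z s)"
  shows "tangent_to_boundary (\<phi> t ` D) (Z t)"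
  unfolding tangent_to_boundary_def
proof (intro allI impI)
  fix p n assume n: "outer_unit_normal (\<phi> t ` D) p n"
  then have "p \<in> \<phi> t ` frontier D"
    using frontier_phi_image[OF st(2) D(1,2,4)] by (auto simp: outer_unit_normal_def)
  then obtain X where X: "p = \<phi> t X" "X \<in> frontier D" by blast
  have XD: "X \<in> closure D" "X \<in> U" using X D by (auto simp: frontier_def)
  have DU: "D \<subseteq> U" using D closure_subset by blast
  have tX: "(t, X) \<in> J \<times> U" and sX: "(s, X) \<in> J \<times> U" using st XD by auto
  let ?p = "\<Psi> (t, X)" and ?q = "\<Psi> (s, X)"
  have p: "?p \<in> region" "?p = (t, p)" and q: "?q \<in> region" "?q = (s, \<phi> s X)"
    using Psi_in tX sX X by (auto simp: \<Psi>_def)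
  define \<zeta> where "\<zeta> = (\<chi> a. zeta z a ?p)"
  have \<zeta>: "(\<chi> a. zeta z a ?q) = \<zeta>"
    using zeta_constant[OF z D(3,4) st XD(1)] by (simp add: \<zeta>_def)
  define m where "m = transpose (Fm (t, X)) *v n"
  have Gt: "G ?p ** Fm (t, X) = mat 1" "Fm (t, X) ** G ?p = mat 1"
    using G_inverse[OF p(1)] Theta_Psi[OF tX] by simp_all
  have Gs: "G ?q ** Fm (s, X) = mat 1" and Gs': "inv3 (Fm (s, X)) = G ?q"
    using G_inverse[OF q(1)] Theta_Psi[OF sX] pd_Yl[OF q(1)] by (simp_all add: G_def vec_eq_iff)
  have m: "m \<noteq> 0" "outer_unit_normal D X (m /\<^sub>R norm m)"
    unfolding m_def
    by (rule outer_unit_normal_pullback[OF open_U DU XD(2) inj_phi[OF st(2)]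
          phi_space_derivative(1)[OF tX] Gt(2) X(2) n[unfolded X(1)]])+
  \<comment> \<open>The reference normal carried to time s, by the same pullback lemma applied to
    the inverse of \<open>\<phi> s\<close>.\<close>
  define k where "k = transpose (G ?q) *v (m /\<^sub>R norm m)"
  let ?g = "the_inv_into U (\<phi> s)"
  have g: "?g (\<phi> s Y) = Y" if "Y \<in> U" for Y
    using that by (simp add: the_inv_into_f_f[OF inj_phi[OF st(1)]])
  have "(\<lambda>Y. ?g (\<phi> s Y)) ` D = (\<lambda>Y. Y) ` D"
    by (rule image_cong) (use g DU in auto)
  then have gD: "?g ` \<phi> s ` D = D" by (simp add: image_image)
  have gd: "(?g has_derivative (\<lambda>h. G ?q *v h)) (at (\<phi> s X))"
    using slice_space_derivative[of \<Theta> _ s "\<phi> s X", OF Theta_derivative[OF q(1)[unfolded q(2)]]]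
      Theta_Psi[OF sX] Gs'
    by (auto dest: has_derivative_snd simp: \<Theta>_def q(2))
  have sX': "\<phi> s X \<in> frontier (\<phi> s ` D)" "\<phi> s X \<in> \<phi> s ` U" "\<phi> s ` D \<subseteq> \<phi> s ` U"
    using X(2) XD(2) DU frontier_phi_image[OF st(1) D(1,2,4)] by auto
  have ginj: "inj_on ?g (\<phi> s ` U)" by (rule inj_on_inverseI[of _ "\<phi> s"]) (use g in auto)
  have "outer_unit_normal (?g ` \<phi> s ` D) (?g (\<phi> s X)) (m /\<^sub>R norm m)"
    using m(2) by (simp only: gD g[OF XD(2)])
  from outer_unit_normal_pullback[OF open_phi_image[OF st(1) open_U order_refl] sX'(3,2) ginj gd Gs
      sX'(1) this]
  have k: "k \<noteq> 0" "outer_unit_normal (\<phi> s ` D) (\<phi> s X) (k /\<^sub>R norm k)"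
    unfolding k_def .
  have "Z s (\<phi> s X) \<bullet> (k /\<^sub>R norm k) = 0"
    using tan k(2) unfolding tangent_to_boundary_def by blast
  moreover have "Z s (\<phi> s X) = z ?q" using Z[OF q(1)] by (simp add: q(2))
  ultimately have "z ?q \<bullet> k = 0" using k(1) by simp
  also have "z ?q \<bullet> k = (G ?q *v z ?q) \<bullet> (m /\<^sub>R norm m)"
    unfolding k_def by (simp add: dot_lmul_matrix inner_commute[of "z ?q"] inner_commute[of "G ?q *v z ?q"])
  finally have \<zeta>m: "\<zeta> \<bullet> m = 0"
    using det_G_nonzero[OF q(1)] m(1) by (simp add: G_mult_field[OF q(1)] \<zeta>)
  have "transpose (G ?p) *v m = transpose (Fm (t, X) ** G ?p) *v n"
    unfolding m_def matrix_transpose_mul matrix_vector_mul_assoc ..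
  then have "n = transpose (G ?p) *v m"
    by (simp only: Gt(2) transpose_mat matrix_vector_mul_lid)
  then have "z ?p \<bullet> n = (G ?p *v z ?p) \<bullet> m"
    by (simp add: dot_lmul_matrix inner_commute[of "z ?p"] inner_commute[of "G ?p *v z ?p"])
  then have "z ?p \<bullet> n = 0"
    using \<zeta>m by (simp add: G_mult_field[OF p(1)] \<zeta>_def)
  then show "Z t p \<bullet> n = 0"
    using Z[OF p(1)] by (simp add: p(2))
qed

text \<open>Since z is solenoidal, the integrand is the divergence of Q z. This field is smooth on
  the image of U, which contains the closed domain, so the divergence theorem applies and tangency
  kills the boundary integrand almost everywhere.\<close>

lemma flux_integral_zero:
  assumes z: "transported z" and Z: "\<And>p. p \<in> region \<Longrightarrow> case_prod Z p = z p"
    and D: "bounded D" "D \<subseteq> B" "closure D \<subseteq> U" and t: "t \<in> J"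
    and dd: "divergence_domain (\<phi> t ` D)" and tan: "tangent_to_boundary (\<phi> t ` D) (Z t)"
  shows "(LINT x:\<phi> t ` D|lborel. \<Sum>i\<in>UNIV. z (t, x) $ i * pd (ex i) Q (t, x)) = 0"
proof -
  let ?N = "\<phi> t ` U" and ?w = "\<lambda>p. Q p *\<^sub>R z p"
  let ?v = "\<lambda>x. ?w (t, x)"
  have oN: "open ?N" by (rule open_phi_image[OF t open_U order_refl])
  have cl: "closure (\<phi> t ` D) \<subseteq> ?N"
    unfolding closure_phi_image[OF t D(1,3)] using D(3) by blast
  have Cw: "Ck_on 1 region ?w"
    by (intro Ck_on_scaleR open_region Ck_on_le[OF Ck_Q]) (use z in \<open>simp_all add: transported_def\<close>)
  have Cp: "Ck_on 1 ?N (\<lambda>x. (t, x))"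
    by (intro Ck_on_Pair Ck_on_const Ck_on_bounded_linear oN bounded_linear_ident)
  have Cv: "Ck_on 1 ?N ?v"
    by (rule Ck_on_compose[OF oN open_region _ Cp Cw]) (use t in \<open>auto simp: spacetime_region_def\<close>)
  have dv: "divg ?v x = (\<Sum>i\<in>UNIV. z (t, x) $ i * pd (ex i) Q (t, x))" if "x \<in> \<phi> t ` D" for x
  proof -
    have pB: "(t, x) \<in> regionB" using that D t by (auto simp: spacetime_region_def)
    then have p: "(t, x) \<in> region" using T_S by blast
    have "?w differentiable (at (t, x))" by (rule Ck_on_differentiable[OF Cw _ p]) simp
    moreover have "case_prod (\<lambda>s y. ?w (s, y)) = ?w" by (simp add: fun_eq_iff)
    ultimately have "divg ?v x = dvg ?w (t, x)"
      using divg_eq_dvg[of "\<lambda>s y. ?w (s, y)" t x] by (simp only:)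
    also have "\<dots> = (\<Sum>j\<in>UNIV. pd (ex j) (\<lambda>x. Q x * z x $ j) (t, x))"
      by (simp add: dvg_def)
    also have "\<dots> = (\<Sum>i\<in>UNIV. z (t, x) $ i * pd (ex i) Q (t, x))"
      using z pB p by (intro dvg_flux transported_differentiable) (auto simp: transported_def)
    finally show ?thesis .
  qed
  obtain \<mu> n where \<mu>1: "AE p in \<mu>. outer_unit_normal (\<phi> t ` D) p (n p)"
    and \<mu>2: "\<forall>N v. open N \<longrightarrow> closure (\<phi> t ` D) \<subseteq> N \<longrightarrow> Ck_on 1 N v \<longrightarrow>
      (LINT x:\<phi> t ` D|lborel. divg v x) = (LINT p|\<mu>. v p \<bullet> n p)"
    using dd unfolding divergence_domain_def by (elim conjE exE) (rule that)
  note \<mu> = \<mu>1 \<mu>2[rule_format, OF oN cl Cv]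
  have "AE p in \<mu>. ?v p \<bullet> n p = 0"
    using \<mu>(1)
  proof eventually_elim
    case (elim p)
    then have "p \<in> ?N" using cl by (auto simp: outer_unit_normal_def frontier_def)
    then have "Z t p = z (t, p)" using Z[of "(t, p)"] t by (auto simp: spacetime_region_def)
    moreover have "Z t p \<bullet> n p = 0" using tan elim by (auto simp: tangent_to_boundary_def)
    ultimately show ?case by simp
  qed
  then have "(LINT p|\<mu>. ?v p \<bullet> n p) = 0" by (rule integral_eq_zero_AE)
  moreover have "(LINT x:\<phi> t ` D|lborel. divg ?v x)
      = (LINT x:\<phi> t ` D|lborel. \<Sum>i\<in>UNIV. z (t, x) $ i * pd (ex i) Q (t, x))"
    by (rule set_lebesgue_integral_cong) (use dv dd in \<open>auto simp: divergence_domain_def\<close>)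
  ultimately show ?thesis using \<mu>(2) by simp
qed

lemma helicity_constant:
  assumes z: "transported z" and Z: "\<And>p. p \<in> region \<Longrightarrow> case_prod Z p = z p"
    and D: "open D" "bounded D" "D \<subseteq> B" "closure D \<subseteq> U"
    and dd: "\<And>t. t \<in> J \<Longrightarrow> divergence_domain (\<phi> t ` D)"
    and tan: "\<And>t. t \<in> J \<Longrightarrow> tangent_to_boundary (\<phi> t ` D) (Z t)"
    and st: "s \<in> J" "t \<in> J"
  shows "(LINT x:\<phi> t ` D|lborel. K_field W \<rho> u t x \<bullet> Z t x)
    = (LINT x:\<phi> s ` D|lborel. K_field W \<rho> u s x \<bullet> Z s x)"
proof -
  let ?h = "\<lambda>p. \<Sum>i\<in>UNIV. Kf p $ i * z p $ i" and ?d = "\<lambda>p. \<bar>det (G p)\<bar>"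
  let ?w = "\<lambda>p. \<Sum>i\<in>UNIV. z p $ i * pd (ex i) Q p"
  let ?f = "\<lambda>p. ?h p / ?d p"
  have DU: "D \<subseteq> U" using D B_U by blast
  have Cz: "Ck_on 1 region z" using z by (simp only: transported_def)
  have Ch: "Ck_on 1 region ?h"
    by (intro Ck_on_sum Ck_on_mult Ck_on_nth open_region Cz Ck_on_le[OF Ck_K]) simp
  have Cf: "Ck_on 1 region ?f"
    using det_G_nonzero by (intro Ck_on_divide open_region Ch Ck_abs_det_G) auto
  have cw: "continuous_on region ?w"
    by (rule Ck_on_continuous[of 1])
      (intro Ck_on_sum Ck_on_mult Ck_on_nth open_region Cz Ck_on_pd_2[OF Ck_Q] ex_Basis)
  have sets: "\<phi> r ` D \<in> sets lborel" if "r \<in> J" for r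
    using open_phi_image[OF that D(1) DU] by simp
  have I: "(LINT x:\<phi> r ` D|lborel. K_field W \<rho> u r x \<bullet> Z r x) = (LINT X:D|lborel. ?f (\<Psi> (r, X)))"
    if r: "r \<in> J" for r
  proof -
    have "(LINT x:\<phi> r ` D|lborel. K_field W \<rho> u r x \<bullet> Z r x) = (LINT x:\<phi> r ` D|lborel. ?h (r, x))"
    proof (rule set_lebesgue_integral_cong[OF sets[OF r]], intro allI impI)
      fix x assume "x \<in> \<phi> r ` D"
      then have p: "(r, x) \<in> region" using r DU by (auto simp: spacetime_region_def)
      show "K_field W \<rho> u r x \<bullet> Z r x = ?h (r, x)"
        using K_eq[OF p] Z[OF p] by (simp add: inner_vec_def)
    qed
    then show ?thesis
      using image_integral[OF r D(1,2,4) Ck_on_continuous[OF Ch]] by simp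
  qed
  have "((\<lambda>r. LINT X:D|lborel. ?f (\<Psi> (r, X))) has_real_derivative 0) (at r)" if r: "r \<in> J" for r
  proof -
    \<comment> \<open>The volume term - h div v from \<open>Dm_helicity\<close> is cancelled by the
      decay of the Jacobian in the denominator.\<close>
    have Df: "Dm vel ?f (\<Psi> (r, X)) = - (?w (\<Psi> (r, X)) / ?d (\<Psi> (r, X)))" if "X \<in> D" for X
    proof -
      let ?p = "\<Psi> (r, X)"
      have pB: "?p \<in> regionB" using that r D by (auto simp: \<Psi>_def spacetime_region_def)
      then have p: "?p \<in> region" using T_S by blast
      have d: "?d ?p \<noteq> 0" using det_G_nonzero[OF p] by simp
      have "Dm vel ?h ?p = - ?w ?p - ?h ?p * dvg vel ?p"
        using z pB p by (intro Dm_helicity transported_differentiable) (auto simp: transported_def)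
      moreover have "Dm vel ?f ?p = (Dm vel ?h ?p * ?d ?p - ?h ?p * Dm vel ?d ?p) / (?d ?p * ?d ?p)"
        by (rule Dm_divide[where f = ?h and g = ?d, OF _ _ d])
          (auto intro: Ck_on_differentiable[OF Ch _ p] Ck_on_differentiable[OF Ck_abs_det_G _ p])
      moreover have "((- a - h * g) * d - h * (- d * g)) / (d * d) = - (a / d)"
        if "d \<noteq> 0" for a d g h :: real
        using that by (simp add: field_simps)
      ultimately show ?thesis
        by (simp only: Dm_abs_det_G[OF p] d not_False_eq_True)
    qed
    have "(LINT X:D|lborel. Dm vel ?f (\<Psi> (r, X))) = (LINT X:D|lborel. - (?w (\<Psi> (r, X)) / ?d (\<Psi> (r, X))))"
      by (rule set_lebesgue_integral_cong) (use D Df in auto)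
    \<comment> \<open>Back to the Eulerian domain at time r, where the divergence theorem is
      available.\<close>
    also have "\<dots> = - (LINT x:\<phi> r ` D|lborel. ?w (r, x))"
      unfolding image_integral[OF r D(1,2,4) cw] by (simp add: set_lebesgue_integral_def)
    also have "\<dots> = 0"
      using flux_integral_zero[OF z Z D(2,3,4) r dd[OF r] tan[OF r]] by simp
    finally show ?thesis
      using integral_time_derivative[OF r D(1,2,4) Cf] by simp
  qed
  from constant_on_J[OF this st(2,1)] show ?thesis
    by (simp only: I st)
qed

end

theorem theorem8:
  fixes J :: "real set"
    and B U :: "(real^3) set"
    and \<phi> :: "real \<Rightarrow> real^3 \<Rightarrow> real^3"
    and \<rho> V :: "real \<Rightarrow> real^3 \<Rightarrow> real"
    and u :: "real \<Rightarrow> real^3 \<Rightarrow> real^3"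
    and A :: "(real \<times> real) set"
    and W R :: "real \<Rightarrow> real \<Rightarrow> real"
    and Z :: "real \<Rightarrow> real^3 \<Rightarrow> real^3"
  assumes motion: "fluid_motion J U \<phi>" "0 \<in> J" "open B" "B \<subseteq> U"
    and velocity: "is_velocity J U \<phi> u"
    and smooth_rho: "Ck_on 4 (spacetime_region J U \<phi>) (\<lambda>(t, x). \<rho> t x)"
    and smooth_u: "Ck_on 3 (spacetime_region J U \<phi>) (\<lambda>(t, x). u t x)"
    and smooth_V: "Ck_on 2 (spacetime_region J U \<phi>) (\<lambda>(t, x). V t x)"
    and smooth_W: "open A" "Ck_on 4 A (\<lambda>(r, q). W r q)"
    and rho_pos: "\<forall>(t, x) \<in> spacetime_region J U \<phi>. \<rho> t x > 0"
    and in_domain: "\<forall>(t, x) \<in> spacetime_region J U \<phi>. (\<rho> t x, material_deriv u \<rho> t x) \<in> A"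
    and legendre: "legendre_solution A W R"
    and mass: "\<forall>(t, x) \<in> spacetime_region J B \<phi>. mass_equation \<rho> u t x"
    and momentum: "\<forall>(t, x) \<in> spacetime_region J B \<phi>. momentum_equation W V \<rho> u t x"
    and field: "Z = Omega_field W \<rho> u \<or> (\<exists>i. Z = E_field U \<phi> i)"
  shows "(\<forall>(t, x) \<in> spacetime_region J B \<phi>.
            dt (\<lambda>s y. K_field W \<rho> u s y \<bullet> Z s y) t x
            + divg (\<lambda>y. (K_field W \<rho> u t y \<bullet> Z t y) *\<^sub>R u t y
                + (energy_tilde_rho W R (\<rho> t y) (sigma W \<rho> u t y)
                   + V t y - (norm (u t y))\<^sup>2 / 2) *\<^sub>R Z t y) x = 0)
       \<and> (\<forall>D. material_domain J U B \<phi> D \<and> tangent_to_boundary (\<phi> 0 ` D) (Z 0) \<longrightarrow>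
            (\<forall>t\<in>J. tangent_to_boundary (\<phi> t ` D) (Z t) \<and>
               (LINT x:(\<phi> t ` D)|lborel. K_field W \<rho> u t x \<bullet> Z t x)
               = (LINT x:(\<phi> 0 ` D)|lborel. K_field W \<rho> u 0 x \<bullet> Z 0 x)))"
proof -
  interpret inertial_fluid_motion J U \<phi> u B \<rho> V A W R
    by unfold_locales (rule motion velocity smooth_u smooth_rho smooth_V smooth_W rho_pos in_domain
        legendre mass momentum)+
  obtain z where z: "transported z" and Z: "\<And>p. p \<in> region \<Longrightarrow> case_prod Z p = z p"
    by (rule transported_representative[OF field]) blast
  show ?thesis
  proof (intro conjI allI impI ballI)
    fix p assume "p \<in> regionB"
    then show "case p of (t, x) \<Rightarrow> dt (\<lambda>s y. K_field W \<rho> u s y \<bullet> Z s y) t x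
        + divg (\<lambda>y. (K_field W \<rho> u t y \<bullet> Z t y) *\<^sub>R u t y
            + (energy_tilde_rho W R (\<rho> t y) (sigma W \<rho> u t y)
               + V t y - (norm (u t y))\<^sup>2 / 2) *\<^sub>R Z t y) x = 0"
      using helicity_conservation[OF z Z] by (cases p) simp
  next
    fix D t
    assume D: "material_domain J U B \<phi> D \<and> tangent_to_boundary (\<phi> 0 ` D) (Z 0)" and t: "t \<in> J"
    then have D': "open D" "bounded D" "D \<subseteq> B" "closure D \<subseteq> U"
      and dd: "\<And>r. r \<in> J \<Longrightarrow> divergence_domain (\<phi> r ` D)"
      and tan0: "tangent_to_boundary (\<phi> 0 ` D) (Z 0)"
      by (auto simp: material_domain_def)
    have tan: "tangent_to_boundary (\<phi> r ` D) (Z r)" if "r \<in> J" for r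
      by (rule tangent_transported[OF z Z D' \<open>0 \<in> J\<close> that tan0])
    show "tangent_to_boundary (\<phi> t ` D) (Z t)" by (rule tan[OF t])
    show "(LINT x:(\<phi> t ` D)|lborel. K_field W \<rho> u t x \<bullet> Z t x)
        = (LINT x:(\<phi> 0 ` D)|lborel. K_field W \<rho> u 0 x \<bullet> Z 0 x)"
      by (rule helicity_constant[OF z Z D' dd tan \<open>0 \<in> J\<close> t])
  qed
qed

end
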